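(* Let $\tilde m>0$ and $a\in\mathbb{R}\setminus\{0\}$, and let $V_0,V_1:\mathbb{R}\to\mathbb{R}$ be smooth, compactly supported functions that are small in the sense that $\|V_0\|_{L^\infty}+\tfrac12\|V_1\|_{L^1}<\tilde m/|a|$. Then the joint initial value problem for the field $U$ and the particle trajectory $z$, $$\left\{\begin{array}{rcl}\eta^{\mu\nu}\partial_\mu\partial_\nu U(x)&=&a\int\delta^{(2)}(x-z(\tau))\,d\tau,\\ U(0,x^1)&=&-\frac a2|x^1|+V_0(x^1),\\ \partial_0U(0,x^1)&=&V_1(x^1),\end{array}\right.$$ $$\frac{dz^1}{dx^0}=\frac{p^1}{\sqrt{m^2+(p^1)^2}},\qquad \frac{dp^1}{dx^0}=-\frac{a^2}{2}\frac{p^1}{\sqrt{m^2+(p^1)^2}}+a\frac{m}{\sqrt{m^2+(p^1)^2}}\,\partial_1V(x^0,z^1),\qquad z^1(0)=0,\ p^1(0)=0,$$ where $m=m(x^0)=\tilde m-aU(x^0,z^1(x^0))$, admits a unique global-in-time solution with $U$ a Lipschitz continuous scalar field on $\mathbb{R}_{\ge0}\times\mathbb{R}$ and $z$ a Lipschitz continuous world-line.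
   Context: Space-time has coordinates $(x^0,x^1)$ and metric $\eta_{\mu\nu}=\mathrm{diag}(1,-1)$, so $\eta^{\mu\nu}\partial_\mu\partial_\nu=\partial_0^2-\partial_1^2$. The particle has world-line $z=(x^0,z^1(x^0))$, $x^0\ge0$, proper time $\tau$ with $d\tau=\sqrt{1-(dz^1/dx^0)^2}\,dx^0$, bare mass $\tilde m$, scalar charge $a$, and dynamical momentum $p^1$. The function $V$ is the solution of the free wave equation $\eta^{\mu\nu}\partial_\mu\partial_\nu V=0$, $V(0,x^1)=V_0(x^1)$, $\partial_0V(0,x^1)=V_1(x^1)$. The Cauchy problem for $U$ with given $z$ is understood in the distributional sense. Its solution is $U=V+U_{\rm stat}+U_{\rm source}$, where $U_{\rm stat}$ solves the free wave equation with data $U_{\rm stat}(0,x^1)=-\frac a2|x^1|$, $\partial_0U_{\rm stat}(0,x^1)=0$, and $U_{\rm source}$ solves the sourced equation $\eta^{\mu\nu}\partial_\mu\partial_\nu U_{\rm source}=a\int\delta^{(2)}(x-z(\tau))d\tau$ with zero data. By Duhamel's principle, $$U_{\rm source}(x^0,x^1)=\frac a2\int_0^{x^0}\sqrt{1-\left(\tfrac{dz^1}{dx^0}(t)\right)^2}\ \chi_{[x^1-(x^0-t),\,x^1+(x^0-t)]}(z^1(t))\,dt,$$ where $\chi_I$ is the indicator function of $I$. The ordinary differential equations for $(z^1,p^1)$ are equivalently understood in integrated form. *)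

theory Defs
  imports "HOL-Probability.Probability"
begin

text \<open>
  Space-time is the type \<open>real \<times> real\<close> with points \<open>(x0, x1)\<close>. The field \<open>U\<close>, the world-line \<open>z\<close>
  and the momentum \<open>p\<close> are total functions of which only the restriction to \<open>x0 \<ge> 0\<close> is
  meaningful; the free field \<open>V\<close> and the test functions live on the whole plane.
\<close>

definition dderiv :: "'a::euclidean_space \<Rightarrow> ('a \<Rightarrow> real) \<Rightarrow> 'a \<Rightarrow> real" where
  "dderiv e f x = frechet_derivative f (at x) e"

text \<open>
  All iterated partial derivatives, including the function itself, are (Frechet) differentiable,
  hence continuous; this is \<open>C\<^sup>\<infinity>\<close>.
\<close>

definition smooth :: "('a::euclidean_space \<Rightarrow> real) \<Rightarrow> bool" where
  "smooth f \<longleftrightarrow> (\<forall>es. set es \<subseteq> Basis \<longrightarrow> foldr dderiv es f differentiable_on UNIV)"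

definition compactly_supported :: "('a::euclidean_space \<Rightarrow> real) \<Rightarrow> bool" where
  "compactly_supported f \<longleftrightarrow> compact (closure {x. f x \<noteq> 0})"

abbreviation d0 :: "(real \<times> real \<Rightarrow> real) \<Rightarrow> real \<times> real \<Rightarrow> real" where
  "d0 \<equiv> dderiv (1, 0)"

abbreviation d1 :: "(real \<times> real \<Rightarrow> real) \<Rightarrow> real \<times> real \<Rightarrow> real" where
  "d1 \<equiv> dderiv (0, 1)"

definition wave_op :: "(real \<times> real \<Rightarrow> real) \<Rightarrow> real \<times> real \<Rightarrow> real" where
  "wave_op f x = d0 (d0 f) x - d1 (d1 f) x"

definition free_wave ::
    "(real \<Rightarrow> real) \<Rightarrow> (real \<Rightarrow> real) \<Rightarrow> (real \<times> real \<Rightarrow> real) \<Rightarrow> bool" where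
  "free_wave V0 V1 V \<longleftrightarrow>
     smooth V \<and> (\<forall>x. wave_op V x = 0) \<and> (\<forall>y. V (0, y) = V0 y) \<and> (\<forall>y. d0 V (0, y) = V1 y)"

text \<open>
  Distributional Cauchy problem on the closed half-plane \<open>x0 \<ge> 0\<close> with source distribution \<open>S\<close>.
  The support of a test function may meet \<open>x0 = 0\<close>; the two boundary terms, which arise from
  integrating \<open>\<integral> U \<cdot> wave_op \<phi>\<close> by parts twice in \<open>x0\<close>, impose both initial conditions.
\<close>

definition weak_wave_cauchy ::
    "((real \<times> real \<Rightarrow> real) \<Rightarrow> real) \<Rightarrow> (real \<Rightarrow> real) \<Rightarrow> (real \<Rightarrow> real) \<Rightarrow>
     (real \<times> real \<Rightarrow> real) \<Rightarrow> bool" where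
  "weak_wave_cauchy S U0 U1 U \<longleftrightarrow>
     (\<forall>\<phi>. smooth \<phi> \<and> compactly_supported \<phi> \<longrightarrow>
        (LINT x:{0..} \<times> UNIV|lborel. U x * wave_op \<phi> x) =
          S \<phi> + (LINT y|lborel. U1 y * \<phi> (0, y)) - (LINT y|lborel. U0 y * d0 \<phi> (0, y)))"

definition velocity :: "(real \<Rightarrow> real) \<Rightarrow> real \<Rightarrow> real" where
  "velocity z t = vector_derivative z (at t within {0..})"

text \<open>
  The distribution \<open>\<integral> \<delta>\<^sup>(\<^sup>2\<^sup>)(x - z(\<tau>)) d\<tau>\<close> evaluated at \<open>\<phi>\<close>, that is \<open>\<integral> \<phi>(z(\<tau>)) d\<tau>\<close> with
  the proper time expressed through \<open>x0\<close>.
\<close>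

definition worldline_delta :: "(real \<Rightarrow> real) \<Rightarrow> (real \<times> real \<Rightarrow> real) \<Rightarrow> real" where
  "worldline_delta z \<phi> = (LINT t:{0..}|lborel. \<phi> (t, z t) * sqrt (1 - (velocity z t)\<^sup>2))"

definition dyn_mass ::
    "real \<Rightarrow> real \<Rightarrow> (real \<times> real \<Rightarrow> real) \<Rightarrow> (real \<Rightarrow> real) \<Rightarrow> real \<Rightarrow> real" where
  "dyn_mass mb a U z t = mb - a * U (t, z t)"

text \<open>The bare mass is \<open>mb\<close>. The equations of motion are stated in integrated form.\<close>

definition particle_motion ::
    "real \<Rightarrow> real \<Rightarrow> (real \<times> real \<Rightarrow> real) \<Rightarrow> (real \<times> real \<Rightarrow> real) \<Rightarrow>
     (real \<Rightarrow> real) \<Rightarrow> (real \<Rightarrow> real) \<Rightarrow> bool" where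
  "particle_motion mb a V U z p \<longleftrightarrow>
     (let m = dyn_mass mb a U z in
        z 0 = 0 \<and> p 0 = 0 \<and>
        (\<forall>t\<ge>0. ((\<lambda>s. p s / sqrt ((m s)\<^sup>2 + (p s)\<^sup>2)) has_integral (z t - z 0)) {0..t}) \<and>
        (\<forall>t\<ge>0. ((\<lambda>s. - (a\<^sup>2 / 2) * (p s / sqrt ((m s)\<^sup>2 + (p s)\<^sup>2))
                     + a * (m s / sqrt ((m s)\<^sup>2 + (p s)\<^sup>2)) * d1 V (s, z s))
                 has_integral (p t - p 0)) {0..t}))"

definition joint_solution ::
    "real \<Rightarrow> real \<Rightarrow> (real \<Rightarrow> real) \<Rightarrow> (real \<Rightarrow> real) \<Rightarrow> (real \<times> real \<Rightarrow> real) \<Rightarrow>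
     (real \<times> real \<Rightarrow> real) \<Rightarrow> (real \<Rightarrow> real) \<Rightarrow> (real \<Rightarrow> real) \<Rightarrow> bool" where
  "joint_solution mb a V0 V1 V U z p \<longleftrightarrow>
     (\<exists>C. C-lipschitz_on ({0..} \<times> UNIV) U) \<and>
     (\<exists>L. L-lipschitz_on {0..} z) \<and>
     weak_wave_cauchy (\<lambda>\<phi>. a * worldline_delta z \<phi>) (\<lambda>y. - (a / 2) * \<bar>y\<bar> + V0 y) V1 U \<and>
     particle_motion mb a V U z p"

end

theory Submission
  imports Defs
begin

text \<open>
  In the light-cone coordinates \<open>u = x0 + x1\<close>, \<open>v = x0 - x1\<close> the wave operator is \<open>4 \<partial>\<^sub>u \<partial>\<^sub>v\<close>. Integrating by parts
  there shows that for every given world-line d'Alembert's formula plus Duhamel's integral over the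
  backward light cone solves the distributional Cauchy problem. The solution is unique: test functions
  that are products of antiderivatives of bump functions in \<open>u\<close> and in \<open>v\<close>, cut off in the past of
  \<open>x0 = 0\<close>, turn the weak equation for a difference of two solutions into the vanishing of its
  averages over small squares lying to the upper right of any given point, and
  Duhamel's integral is continuous from that side even when the world-line becomes lightlike.

  A world-line of speed at most 1 stays in its own backward light cones, so on it the field is
  \<open>V - (a/2) i\<close> with \<open>i\<close> the accumulated difference of coordinate time and proper time. Hence
  the mass is \<open>mb - a V + (a\<^sup>2/2) i\<close>, which the smallness assumption keeps away from 0, and
  the problem becomes an ordinary differential equation for \<open>(z, p, i)\<close> with a globally Lipschitz
  right-hand side. Finally \<open>E = sqrt (m\<^sup>2 + p\<^sup>2)\<close> satisfies
  \<open>E' = - (a\<^sup>2/2) (1 - m/E) - a (m/E) \<partial>\<^sub>0V\<close>, which bounds \<open>m/E\<close> from below and the speed away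
  from 1; this makes the field globally Lipschitz.
\<close>

section \<open>Smooth functions\<close>

text \<open>The obstacle is a circle: the field depends on the world-line through
  \<open>velocity\<close>, the mass in the equation of motion depends on the field, and for a
  competing solution neither the sign of the mass nor differentiability of the world-line is known
  beforehand. The field is therefore studied for arbitrary 1-Lipschitz world-lines, possibly
  lightlike and with kinks; this is the origin of the merely bounded Borel weights, of the
  measurability of derivatives and of the one-sided limits. Only when the field on the world-line
  has been identified does the mass turn out positive and the velocity continuous. The subluminal
  bound serves existence: the constructed field has to be Lipschitz, and the time that a world-line
  spends between two neighbouring light rays is controlled only when its speed stays away from
  1.\<close>

lemma dderivI: "(f has_derivative f') (at x) \<Longrightarrow> dderiv e f x = f' e"
  unfolding dderiv_def using frechet_derivative_at by metis

lemma dderiv_real_eq: "(f has_real_derivative D) (at x) \<Longrightarrow> dderiv 1 f x = D"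
  using dderivI[of f "(*) D" x 1] by (simp add: has_field_derivative_def)

lemma smooth_differentiable: "smooth f \<Longrightarrow> f differentiable (at x)"
  unfolding smooth_def differentiable_on_def
  by (drule spec[of _ "[]"]) simp

lemma smooth_dderiv: "smooth f \<Longrightarrow> e \<in> Basis \<Longrightarrow> smooth (dderiv e f)"
  unfolding smooth_def
proof (intro allI impI)
  fix es :: "'a list" assume *: "\<forall>es. set es \<subseteq> Basis \<longrightarrow> foldr dderiv es f differentiable_on UNIV" "e \<in> Basis" "set es \<subseteq> Basis"
  then show "foldr dderiv es (dderiv e f) differentiable_on UNIV"
    using *(1)[rule_format, of "es @ [e]"] by simp
qed

text \<open>A coinduction principle: a class of differentiable functions closed under partial
  derivatives contains all iterated derivatives of its members. Smoothness of a concrete function is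
  then shown by naming such a class.\<close>

lemma smooth_coinduct:
  assumes "f \<in> P"
    and diff: "\<And>g x. g \<in> P \<Longrightarrow> g differentiable (at x)"
    and closed: "\<And>g e. g \<in> P \<Longrightarrow> e \<in> Basis \<Longrightarrow> dderiv e g \<in> P"
  shows "smooth f"
proof -
  have "foldr dderiv es f \<in> P" if "set es \<subseteq> Basis" for es
    using that by (induction es) (auto simp: assms)
  then show ?thesis
    unfolding smooth_def by (auto simp: differentiable_on_def diff)
qed

lemma smooth_const: "smooth (\<lambda>x. c)"
proof (rule smooth_coinduct[where P = "range (\<lambda>c x. c)"])
  fix g :: "'a \<Rightarrow> real" and e :: 'a assume "g \<in> range (\<lambda>c x. c)" "e \<in> Basis"
  then show "dderiv e g \<in> range (\<lambda>c x. c)"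
    by (auto intro!: image_eqI[of _ _ 0] ext simp: dderivI[OF has_derivative_const])
qed auto

lemma smooth_real_deriv:
  fixes f :: "real \<Rightarrow> real"
  assumes "smooth f"
  shows "(f has_real_derivative dderiv 1 f x) (at x)"
proof -
  obtain f' where f': "(f has_derivative f') (at x)"
    using smooth_differentiable[OF assms] by (auto simp: differentiable_def)
  then interpret linear f'
    by (rule has_derivative_linear)
  have "f' h = f' 1 * h" for h
    using scaleR[of h 1] by simp
  then have "f' = (*) (f' 1)" by (rule ext)
  with f' show ?thesis
    by (simp add: has_field_derivative_def dderivI[OF f'])
qed

lemma smooth_real_antideriv:
  fixes f :: "real \<Rightarrow> real"
  assumes "smooth f" and "\<And>x. (F has_real_derivative f x) (at x)"
  shows "smooth F"
  unfolding smooth_def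
proof (intro allI impI)
  fix es :: "real list" assume es: "set es \<subseteq> Basis"
  have 1: "dderiv 1 F = f"
    using assms(2) by (auto simp: dderiv_real_eq)
  show "foldr dderiv es F differentiable_on UNIV"
  \<comment> \<open>In \<open>foldr\<close> the last entry of the list is the derivative taken
    first, so the list is split at its end; on the real line that entry can only be 1.\<close>
  proof (cases es rule: rev_cases)
    case Nil
    then show ?thesis
      using assms(2) by (auto simp: differentiable_on_def real_differentiable_def)
  next
    case (snoc ys y)
    then have "y = 1" "set ys \<subseteq> Basis" using es by auto
    then show ?thesis using assms(1) snoc 1 unfolding smooth_def by simp
  qed
qed

text \<open>Functions of a single linear form, closed under sums and products. The chain and product
  rules stay inside this algebra, so it fits the coinduction principle; it contains the test
  functions built from functions of \<open>x0\<close>, \<open>x0 + x1\<close> and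
  \<open>x0 - x1\<close>.\<close>

inductive_set ridge_alg :: "('a::euclidean_space \<Rightarrow> real) set" where
  ridge: "smooth A \<Longrightarrow> (\<lambda>x. A (inner c x)) \<in> ridge_alg"
| add: "f \<in> ridge_alg \<Longrightarrow> g \<in> ridge_alg \<Longrightarrow> (\<lambda>x. f x + g x) \<in> ridge_alg"
| mult: "f \<in> ridge_alg \<Longrightarrow> g \<in> ridge_alg \<Longrightarrow> (\<lambda>x. f x * g x) \<in> ridge_alg"

lemma ridge_alg_differentiable:
  fixes x :: "'a::euclidean_space"
  shows "f \<in> ridge_alg \<Longrightarrow> f differentiable (at x)"
proof (induction rule: ridge_alg.induct)
  case (ridge A c)
  have "(\<lambda>x. inner c x) differentiable (at x)"
    by (auto simp: differentiable_def intro!: exI derivative_eq_intros)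
  moreover have "A differentiable (at (inner c x))"
    by (rule smooth_differentiable[OF ridge])
  ultimately show ?case
    using differentiable_chain_at[of "inner c" x A] by (simp add: o_def)
qed (simp_all only: differentiable_add differentiable_mult)

lemma has_derivative_ridge:
  fixes x :: "'a::euclidean_space"
  assumes "smooth A"
  shows "((\<lambda>x. A (inner c x)) has_derivative (\<lambda>h. inner c h * dderiv 1 A (inner c x))) (at x)"
  using DERIV_compose_FDERIV[OF smooth_real_deriv[OF assms], of "\<lambda>x. inner c x"] has_derivative_inner_right[OF has_derivative_ident, of c]
  by auto

lemma dderiv_ridge_alg: "f \<in> ridge_alg \<Longrightarrow> dderiv e f \<in> ridge_alg"
proof (induction rule: ridge_alg.induct)
  case (ridge A c)
  have "dderiv e (\<lambda>x. A (inner c x)) = (\<lambda>x. inner c e * dderiv 1 A (inner c x))"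
    by (rule ext, subst dderivI[OF has_derivative_ridge[OF ridge]]) simp
  moreover have "(\<lambda>x. inner c e) \<in> ridge_alg"
    using ridge_alg.ridge[OF smooth_const[of "inner c e"]] by simp
  ultimately show ?case
    using ridge_alg.ridge[OF smooth_dderiv[OF ridge, of 1]] ridge_alg.mult by fastforce
next
  case (add f g)
  have "dderiv e (\<lambda>x. f x + g x) = (\<lambda>x. dderiv e f x + dderiv e g x)"
  proof
    fix x
    obtain f' g' where d: "(f has_derivative f') (at x)" "(g has_derivative g') (at x)"
      using add(1,2)[THEN ridge_alg_differentiable[of _ x]] by (auto simp: differentiable_def)
    then show "dderiv e (\<lambda>x. f x + g x) x = dderiv e f x + dderiv e g x"
      using dderivI[OF has_derivative_add[OF d]] by (simp add: dderivI)
  qed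
  then show ?case using ridge_alg.add add by metis
next
  case (mult f g)
  have "dderiv e (\<lambda>x. f x * g x) = (\<lambda>x. f x * dderiv e g x + dderiv e f x * g x)"
  proof
    fix x
    obtain f' g' where d: "(f has_derivative f') (at x)" "(g has_derivative g') (at x)"
      using mult(1,2)[THEN ridge_alg_differentiable[of _ x]] by (auto simp: differentiable_def)
    then show "dderiv e (\<lambda>x. f x * g x) x = f x * dderiv e g x + dderiv e f x * g x"
      using dderivI[OF has_derivative_mult[OF d]] by (simp add: dderivI)
  qed
  then show ?case using ridge_alg.add ridge_alg.mult mult by metis
qed

lemma smooth_ridge_alg: "f \<in> ridge_alg \<Longrightarrow> smooth f"
  by (rule smooth_coinduct[of _ ridge_alg]) (auto intro: ridge_alg_differentiable dderiv_ridge_alg)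

lemma smooth_reals_mult:
  fixes f g :: "real \<Rightarrow> real"
  assumes "smooth f" "smooth g"
  shows "smooth (\<lambda>x. f (c * x) * g (d * x))"
  using smooth_ridge_alg[OF ridge_alg.mult[OF ridge_alg.ridge[OF assms(1), of c] ridge_alg.ridge[OF assms(2), of d]]]
  by simp

lemma smooth_translate:
  fixes f :: "real \<Rightarrow> real"
  assumes "smooth f"
  shows "smooth (\<lambda>x. f (x + c))"
proof (rule smooth_coinduct[where P = "(\<lambda>f x. f (x + c)) ` {f. smooth f}"])
  fix g :: "real \<Rightarrow> real" and x e :: real
  assume "g \<in> (\<lambda>f x. f (x + c)) ` {f. smooth f}"
  then obtain k where k: "smooth k" "g = (\<lambda>x. k (x + c))" by auto
  have d: "(g has_real_derivative dderiv 1 k (x + c)) (at x)" for x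
    unfolding k(2) by (rule DERIV_cong[OF DERIV_chain2[OF smooth_real_deriv[OF k(1)]]])
      (auto intro!: derivative_eq_intros)
  show "g differentiable (at x)"
    using d[of x] real_differentiable_def by blast
  assume "e \<in> Basis"
  then have "dderiv e g = (\<lambda>x. dderiv 1 k (x + c))"
    using d by (auto simp: dderiv_real_eq)
  then show "dderiv e g \<in> (\<lambda>f x. f (x + c)) ` {f. smooth f}"
    using smooth_dderiv[OF k(1), of 1] by auto
qed (use assms in auto)

section \<open>Bump functions and their antiderivatives\<close>

definition exp_inv :: "real poly \<Rightarrow> real \<Rightarrow> real" where
  "exp_inv Q x = (if x > 0 then poly Q (1 / x) * exp (- (1 / x)) else 0)"

lemma poly_exp_minus_tendsto_0: "((\<lambda>y::real. poly Q y * exp (- y)) \<longlongrightarrow> 0) at_top"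
proof -
  have "((\<lambda>y::real. \<Sum>i\<le>degree Q. coeff Q i * (y ^ i / exp y)) \<longlongrightarrow> (\<Sum>i\<le>degree Q. coeff Q i * 0)) at_top"
    by (intro tendsto_intros tendsto_power_div_exp_0)
  then show ?thesis
    by (simp add: poly_altdef exp_minus divide_inverse sum_distrib_right mult.assoc)
qed

text \<open>With \<open>y = 1 / x\<close> the derivative of \<open>Q(y) exp(-y)\<close> is
  \<open>y^2 (Q - Q')(y) exp(-y)\<close>: the polynomial parameter is there to make the class closed
  under differentiation. \<open>Q = 1\<close> is the classical flat function.\<close>

lemma has_real_derivative_exp_inv:
  "(exp_inv Q has_real_derivative exp_inv ([:0, 0, 1:] * (Q - pderiv Q)) x) (at x)"
proof -
  consider "x > 0" | "x < 0" | "x = 0" by linarith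
  then show ?thesis
  proof cases
    case 1
    have "((\<lambda>x. poly Q (1 / x) * exp (- (1 / x))) has_real_derivative
        poly (pderiv Q) (1 / x) * (- (1 / x\<^sup>2)) * exp (- (1 / x)) + poly Q (1 / x) * (exp (- (1 / x)) * (1 / x\<^sup>2))) (at x)"
      using 1 by (auto intro!: derivative_eq_intros DERIV_chain2[OF poly_DERIV]
        simp: power2_eq_square field_simps)
    moreover have "poly (pderiv Q) (1 / x) * (- (1 / x\<^sup>2)) * exp (- (1 / x)) + poly Q (1 / x) * (exp (- (1 / x)) * (1 / x\<^sup>2))
        = exp_inv ([:0, 0, 1:] * (Q - pderiv Q)) x"
      using 1 by (simp add: exp_inv_def power2_eq_square algebra_simps)
    ultimately have "((\<lambda>x. poly Q (1 / x) * exp (- (1 / x))) has_real_derivative exp_inv ([:0, 0, 1:] * (Q - pderiv Q)) x) (at x)"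
      by simp
    then show ?thesis
      by (rule has_field_derivative_transform_within_open[of _ _ _ "{0<..}"]) (use 1 in \<open>auto simp: exp_inv_def\<close>)
  next
    case 2
    have "((\<lambda>x. 0) has_real_derivative exp_inv ([:0, 0, 1:] * (Q - pderiv Q)) x) (at x)"
      using 2 by (simp add: exp_inv_def)
    then show ?thesis
      by (rule has_field_derivative_transform_within_open[of _ _ _ "{..<0}"]) (use 2 in \<open>auto simp: exp_inv_def\<close>)
  next
    case 3
    \<comment> \<open>The difference quotient at 0 is of the same form, with \<open>Q\<close>
      multiplied by \<open>y = 1 / h\<close>; hence the factor \<open>[:0, 1:]\<close>.\<close>
    have "((\<lambda>h. poly ([:0, 1:] * Q) (1 / h) * exp (- (1 / h))) \<longlongrightarrow> 0) (at_right 0)"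
      using filterlim_compose[OF poly_exp_minus_tendsto_0 filterlim_inverse_at_top_right, of "[:0, 1:] * Q"]
      by (simp add: inverse_eq_divide)
    then have "((\<lambda>h. exp_inv Q h / h) \<longlongrightarrow> 0) (at_right 0)"
      by (rule Lim_transform_eventually) (auto simp: exp_inv_def eventually_at_filter)
    moreover have "((\<lambda>h. exp_inv Q h / h) \<longlongrightarrow> 0) (at_left 0)"
      by (rule Lim_transform_eventually[OF tendsto_const]) (auto simp: exp_inv_def eventually_at_filter)
    ultimately have "((\<lambda>h. exp_inv Q h / h) \<longlongrightarrow> 0) (at 0)"
      by (simp add: filterlim_split_at)
    then show ?thesis
      using 3 by (simp add: has_field_derivative_iff exp_inv_def)
  qed
qed

lemma smooth_exp_inv: "smooth (exp_inv Q)"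
proof (rule smooth_coinduct[where P = "range exp_inv"])
  fix g and x e :: real assume "g \<in> range exp_inv"
  then obtain Q where Q: "g = exp_inv Q" by auto
  show "g differentiable (at x)"
    using has_real_derivative_exp_inv[of Q x] Q real_differentiable_def by blast
  assume "e \<in> Basis"
  then have "dderiv e g = exp_inv ([:0, 0, 1:] * (Q - pderiv Q))"
    using dderiv_real_eq[OF has_real_derivative_exp_inv[of Q]] Q by auto
  then show "dderiv e g \<in> range exp_inv" by simp
qed simp

definition bump :: "real \<Rightarrow> real \<Rightarrow> real \<Rightarrow> real" where
  "bump p q x = exp_inv 1 (x - p) * exp_inv 1 (q - x)"

lemma bump_pos: "p < x \<Longrightarrow> x < q \<Longrightarrow> bump p q x > 0"
  by (simp add: bump_def exp_inv_def)

lemma bump_eq_0: "x \<le> p \<or> q \<le> x \<Longrightarrow> bump p q x = 0"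
  by (auto simp: bump_def exp_inv_def)

lemma bump_nonneg: "bump p q x \<ge> 0"
  by (simp add: bump_def exp_inv_def)

lemma smooth_bump: "smooth (bump p q)"
proof -
  have "bump p q = (\<lambda>x. (\<lambda>x. exp_inv 1 (x + - p)) (1 * x) * (\<lambda>x. exp_inv 1 (x + q)) ((-1) * x))"
    by (auto simp: bump_def)
  then show ?thesis
    by (metis smooth_reals_mult[OF smooth_translate smooth_translate] smooth_exp_inv)
qed

lemma smooth_real_continuous:
  fixes f :: "real \<Rightarrow> real"
  shows "smooth f \<Longrightarrow> continuous_on S f"
  by (meson smooth_differentiable differentiable_imp_continuous_on differentiable_on_def
      differentiable_at_withinI)

text \<open>The antiderivative of the bump that vanishes to the right of \<open>q\<close>. To the
  left of \<open>p\<close> it is constant, because the integral over an empty interval is 0. This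
  normalisation bounds the support of test functions towards the future; towards the past a separate
  cut-off does it.\<close>

definition tail :: "real \<Rightarrow> real \<Rightarrow> real \<Rightarrow> real" where
  "tail p q x = integral {p..x} (bump p q) - integral {p..q} (bump p q)"

lemma has_real_derivative_tail:
  assumes "p < q"
  shows "(tail p q has_real_derivative bump p q x) (at x)"
proof -
  \<comment> \<open>A base point below both \<open>p\<close> and \<open>x\<close> turns
    \<open>tail\<close> near \<open>x\<close> into a single indefinite integral up to a
    constant.\<close>
  define c where "c = min (p - 1) (x - 1)"
  have int: "bump p q integrable_on {l..r}" for l r
    by (intro integrable_continuous_real smooth_real_continuous smooth_bump)
  have eq: "tail p q y = integral {c..y} (bump p q) - integral {p..q} (bump p q)" if "y > c" for y
  proof (cases "y \<ge> p")
    case True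
    have "integral {c..p} (bump p q) + integral {p..y} (bump p q) = integral {c..y} (bump p q)"
      by (rule Henstock_Kurzweil_Integration.integral_combine) (use True int in \<open>auto simp: c_def\<close>)
    moreover have "integral {c..p} (bump p q) = integral {c..p} (\<lambda>x. 0)"
      by (rule integral_cong) (auto simp: bump_eq_0)
    ultimately show ?thesis by (simp add: tail_def)
  next
    case False
    have "integral {c..y} (bump p q) = integral {c..y} (\<lambda>x. 0)"
      by (rule integral_cong) (use False in \<open>auto simp: bump_eq_0\<close>)
    then show ?thesis using False by (simp add: tail_def)
  qed
  have "((\<lambda>y. integral {c..y} (bump p q)) has_real_derivative bump p q x) (at x within {c..x + 1})"
    by (rule integral_has_real_derivative) (auto simp: c_def intro: smooth_real_continuous smooth_bump)
  then have "((\<lambda>y. integral {c..y} (bump p q)) has_real_derivative bump p q x) (at x)"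
    using at_within_interior[of x "{c..x + 1}"] by (auto simp: c_def)
  then have "((\<lambda>y. integral {c..y} (bump p q) - integral {p..q} (bump p q)) has_real_derivative bump p q x) (at x)"
    by (auto intro!: derivative_eq_intros)
  then show ?thesis
    by (rule has_field_derivative_transform_within_open[of _ _ _ "{c<..}"]) (auto simp: c_def eq)
qed

lemma smooth_tail: "p < q \<Longrightarrow> smooth (tail p q)"
  by (rule smooth_real_antideriv[OF smooth_bump has_real_derivative_tail])

lemma tail_eq_0:
  assumes "p < q" "q \<le> x"
  shows "tail p q x = 0"
proof -
  have "tail p q x = tail p q q"
  proof (rule DERIV_isconst2[of q "x + 1"])
    show "continuous_on {q..x + 1} (tail p q)"
      by (intro smooth_real_continuous smooth_tail assms)
    fix y assume "q < y"
    then show "DERIV (tail p q) y :> 0"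
      using has_real_derivative_tail[OF assms(1), of y] by (simp add: bump_eq_0)
  qed (use assms in auto)
  then show ?thesis by (simp add: tail_def)
qed

lemma tail_eq_const:
  assumes "x \<le> p"
  shows "tail p q x = - integral {p..q} (bump p q)"
  using assms by (cases "x = p") (auto simp: tail_def)

lemma integral_bump_pos:
  assumes "p < q"
  shows "integral {p..q} (bump p q) > 0"
proof -
  have "integral {p..q} (bump p q) \<ge> 0"
    by (intro integral_nonneg integrable_continuous_real smooth_real_continuous smooth_bump) (auto simp: bump_nonneg)
  moreover have "integral {p..q} (bump p q) \<noteq> 0"
    using integral_eq_0_iff[of p q "bump p q", OF smooth_real_continuous[OF smooth_bump] assms bump_nonneg]
      assms bump_pos[of p "(p + q) / 2" q]
    by (auto dest!: bspec[of _ _ "(p + q) / 2"])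
  ultimately show ?thesis by simp
qed

section \<open>Smooth functions on the plane\<close>

lemma Basis_plane [simp]: "(1, 0) \<in> (Basis :: (real \<times> real) set)" "(0, 1) \<in> (Basis :: (real \<times> real) set)"
  by (auto simp: Basis_prod_def)

lemmas smooth_d0 = smooth_dderiv[OF _ Basis_plane(1)]
lemmas smooth_d1 = smooth_dderiv[OF _ Basis_plane(2)]

lemma smooth_plane_has_derivative:
  assumes "smooth f"
  shows "(f has_derivative (\<lambda>h. fst h * d0 f x + snd h * d1 f x)) (at x)"
proof -
  obtain f' where f': "(f has_derivative f') (at x)"
    using smooth_differentiable[OF assms, of x] unfolding differentiable_def by blast
  then interpret linear f'
    by (rule has_derivative_linear)
  have "f' = (\<lambda>h. fst h * f' (1, 0) + snd h * f' (0, 1))"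
  proof
    fix h
    have "f' h = f' (fst h *\<^sub>R (1, 0) + snd h *\<^sub>R (0, 1))" by simp
    also have "\<dots> = fst h * f' (1, 0) + snd h * f' (0, 1)"
      unfolding add scaleR by simp
    finally show "f' h = fst h * f' (1, 0) + snd h * f' (0, 1)" .
  qed
  then have "f' = (\<lambda>h. fst h * d0 f x + snd h * d1 f x)"
    by (simp only: dderivI[OF f'])
  with f' show ?thesis by simp
qed

lemma smooth_plane_chain:
  assumes "smooth f" "(X has_real_derivative a) (at t within S)" "(Y has_real_derivative b) (at t within S)"
  shows "((\<lambda>t. f (X t, Y t)) has_real_derivative (a * d0 f (X t, Y t) + b * d1 f (X t, Y t))) (at t within S)"
proof -
  have "((\<lambda>t. (X t, Y t)) has_derivative (\<lambda>h. (a * h, b * h))) (at t within S)"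
    using assms(2,3) by (auto simp: has_field_derivative_def intro!: derivative_intros)
  from has_derivative_compose[OF this smooth_plane_has_derivative[OF assms(1)]]
  show ?thesis
    unfolding has_field_derivative_def by (rule has_derivative_eq_rhs) (auto simp: algebra_simps)
qed

lemma smooth_plane_continuous: "smooth f \<Longrightarrow> continuous_on S f" for f :: "real \<times> real \<Rightarrow> real"
  by (meson smooth_differentiable differentiable_imp_continuous_on differentiable_on_def
      differentiable_at_withinI)

lemma smooth_plane_partials:
  assumes "smooth f"
  shows "((\<lambda>s. f (s, y)) has_real_derivative d0 f (x, y)) (at x)"
    and "((\<lambda>s. f (x, s)) has_real_derivative d1 f (x, y)) (at y)"
  using smooth_plane_chain[OF assms, of "\<lambda>s. s" 1 x UNIV "\<lambda>_. y" 0]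
    smooth_plane_chain[OF assms, of "\<lambda>s. x" 0 y UNIV "\<lambda>s. s" 1] by auto

text \<open>The mean value theorem, applied twice in either order, evaluates the same second
  difference; this is the core of the symmetry of mixed partial derivatives.\<close>

lemma second_difference:
  assumes "smooth f" "h > 0"
  shows "\<exists>s\<in>{x..x+h}. \<exists>t\<in>{y..y+h}. f (x + h, y + h) - f (x + h, y) - f (x, y + h) + f (x, y) = h\<^sup>2 * d1 (d0 f) (s, t)"
    and "\<exists>s\<in>{x..x+h}. \<exists>t\<in>{y..y+h}. f (x + h, y + h) - f (x + h, y) - f (x, y + h) + f (x, y) = h\<^sup>2 * d0 (d1 f) (s, t)"
proof -
  have "\<exists>z>x. z < x + h \<and> (f (x + h, y + h) - f (x + h, y)) - (f (x, y + h) - f (x, y)) =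
      (x + h - x) * (d0 f (z, y + h) - d0 f (z, y))"
    by (rule MVT2[of _ _ "\<lambda>s. f (s, y + h) - f (s, y)"])
      (use assms in \<open>auto intro!: derivative_intros smooth_plane_partials\<close>)
  then obtain s where s: "x < s" "s < x + h"
    "(f (x + h, y + h) - f (x + h, y)) - (f (x, y + h) - f (x, y)) = h * (d0 f (s, y + h) - d0 f (s, y))" by auto
  have "\<exists>z>y. z < y + h \<and> d0 f (s, y + h) - d0 f (s, y) = (y + h - y) * d1 (d0 f) (s, z)"
    by (rule MVT2[of _ _ "\<lambda>t. d0 f (s, t)"])
      (use assms in \<open>auto intro!: smooth_plane_partials smooth_d0\<close>)
  then obtain t where "y < t" "t < y + h" "d0 f (s, y + h) - d0 f (s, y) = h * d1 (d0 f) (s, t)" by auto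
  with s show "\<exists>s\<in>{x..x+h}. \<exists>t\<in>{y..y+h}. f (x + h, y + h) - f (x + h, y) - f (x, y + h) + f (x, y) = h\<^sup>2 * d1 (d0 f) (s, t)"
    by (intro bexI[of _ s] bexI[of _ t]) (auto simp: power2_eq_square)
  have "\<exists>z>y. z < y + h \<and> (f (x + h, y + h) - f (x, y + h)) - (f (x + h, y) - f (x, y)) =
      (y + h - y) * (d1 f (x + h, z) - d1 f (x, z))"
    by (rule MVT2[of _ _ "\<lambda>s. f (x + h, s) - f (x, s)"])
      (use assms in \<open>auto intro!: derivative_intros smooth_plane_partials\<close>)
  then obtain t where t: "y < t" "t < y + h"
    "(f (x + h, y + h) - f (x, y + h)) - (f (x + h, y) - f (x, y)) = h * (d1 f (x + h, t) - d1 f (x, t))" by auto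
  have "\<exists>z>x. z < x + h \<and> d1 f (x + h, t) - d1 f (x, t) = (x + h - x) * d0 (d1 f) (z, t)"
    by (rule MVT2[of _ _ "\<lambda>s. d1 f (s, t)"])
      (use assms in \<open>auto intro!: smooth_plane_partials smooth_d1\<close>)
  then obtain s where "x < s" "s < x + h" "d1 f (x + h, t) - d1 f (x, t) = h * d0 (d1 f) (s, t)" by auto
  with t show "\<exists>s\<in>{x..x+h}. \<exists>t\<in>{y..y+h}. f (x + h, y + h) - f (x + h, y) - f (x, y + h) + f (x, y) = h\<^sup>2 * d0 (d1 f) (s, t)"
    by (intro bexI[of _ s] bexI[of _ t]) (auto simp: power2_eq_square)
qed

lemma d0_d1_commute:
  assumes "smooth f"
  shows "d0 (d1 f) = d1 (d0 f)"
proof (rule ccontr)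
  assume "d0 (d1 f) \<noteq> d1 (d0 f)"
  then obtain x y where ne: "d0 (d1 f) (x, y) \<noteq> d1 (d0 f) (x, y)" by fastforce
  \<comment> \<open>The two orders produce different intermediate points, so the mixed derivatives
    are compared at independent arguments; being different near the diagonal point is then an open
    condition.\<close>
  define g where "g = (\<lambda>(X, Y). d0 (d1 f) X - d1 (d0 f) Y)"
  have "continuous_on UNIV g"
    unfolding g_def case_prod_beta
    by (intro continuous_intros continuous_on_compose2[OF smooth_plane_continuous[OF smooth_d0[OF smooth_d1[OF assms]], of UNIV]]
       continuous_on_compose2[OF smooth_plane_continuous[OF smooth_d1[OF smooth_d0[OF assms]], of UNIV]]) auto
  then have "open (g -` (- {0}))"
    by (intro open_vimage) auto
  moreover have "((x, y), (x, y)) \<in> g -` (- {0})"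
    using ne by (simp add: g_def)
  ultimately obtain A B where AB: "open A" "open B" "(x, y) \<in> A" "(x, y) \<in> B" "A \<times> B \<subseteq> g -` (- {0})"
    by (metis open_prod_elim mem_Sigma_iff)
  then have "open (A \<inter> B)" "(x, y) \<in> A \<inter> B" by auto
  then obtain C D where CD: "open C" "open D" "x \<in> C" "y \<in> D" "C \<times> D \<subseteq> A \<inter> B"
    by (metis open_prod_elim mem_Sigma_iff)
  obtain e where e: "e > 0" "cball x e \<subseteq> C" using CD open_contains_cball by metis
  obtain e' where e': "e' > 0" "cball y e' \<subseteq> D" using CD open_contains_cball by metis
  define h where "h = min e e'"
  have h: "h > 0" using e e' by (simp add: h_def)
  have sub: "{x..x+h} \<times> {y..y+h} \<subseteq> A \<inter> B"
  proof -
    have "{x..x+h} \<subseteq> C" "{y..y+h} \<subseteq> D"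
      using e e' by (auto simp: h_def dist_real_def subset_iff)
    then show ?thesis using CD by blast
  qed
  obtain s t where st: "s\<in>{x..x+h}" "t\<in>{y..y+h}" "f (x + h, y + h) - f (x + h, y) - f (x, y + h) + f (x, y) = h\<^sup>2 * d1 (d0 f) (s, t)"
    using second_difference(1)[OF assms h] by blast
  obtain s' t' where st': "s'\<in>{x..x+h}" "t'\<in>{y..y+h}" "f (x + h, y + h) - f (x + h, y) - f (x, y + h) + f (x, y) = h\<^sup>2 * d0 (d1 f) (s', t')"
    using second_difference(2)[OF assms h] by blast
  have "d0 (d1 f) (s', t') = d1 (d0 f) (s, t)" using st(3) st'(3) h by simp
  moreover have "((s', t'), (s, t)) \<in> A \<times> B" using sub st st' by blast
  ultimately show False using AB(5) by (auto simp: g_def)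
qed

section \<open>Integration in light-cone coordinates\<close>

text \<open>The class in which the fields live. Indicators of half-planes and cones belong to it,
  and so does the source field of a bounded weight, which can jump across a light ray along which
  the world-line runs.\<close>

definition loc_bdd :: "('a::euclidean_space \<Rightarrow> real) \<Rightarrow> bool" where
  "loc_bdd f \<longleftrightarrow> f \<in> borel_measurable borel \<and> (\<forall>S. bounded S \<longrightarrow> (\<exists>C. \<forall>x\<in>S. \<bar>f x\<bar> \<le> C))"

definition bdd_supp :: "('a::euclidean_space \<Rightarrow> real) \<Rightarrow> bool" where
  "bdd_supp f \<longleftrightarrow> loc_bdd f \<and> bounded {x. f x \<noteq> 0}"

lemma bdd_supp_measurable: "bdd_supp f \<Longrightarrow> f \<in> borel_measurable borel"
  by (simp add: bdd_supp_def loc_bdd_def)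

lemma loc_bdd_continuous:
  fixes f :: "'a::euclidean_space \<Rightarrow> real"
  assumes "continuous_on UNIV f"
  shows "loc_bdd f"
  unfolding loc_bdd_def
proof (intro conjI allI impI)
  show "f \<in> borel_measurable borel"
    using assms by (rule borel_measurable_continuous_onI)
  fix S :: "'a set" assume "bounded S"
  then have "compact (f ` closure S)"
    by (intro compact_continuous_image continuous_on_subset[OF assms]) (auto simp: compact_closure)
  then have "bounded (f ` closure S)" by (rule compact_imp_bounded)
  then obtain C where "\<forall>x\<in>f ` closure S. norm x \<le> C" by (auto simp: bounded_iff)
  then show "\<exists>C. \<forall>x\<in>S. \<bar>f x\<bar> \<le> C"
    using closure_subset by (metis image_eqI real_norm_def subsetD)
qed

lemma loc_bdd_mult:
  assumes "loc_bdd f" "loc_bdd g"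
  shows "loc_bdd (\<lambda>x. f x * g x)"
  unfolding loc_bdd_def
proof (intro conjI allI impI)
  show "(\<lambda>x. f x * g x) \<in> borel_measurable borel"
    using assms by (auto simp: loc_bdd_def)
  fix S :: "'a set" assume "bounded S"
  then obtain C D where "\<forall>x\<in>S. \<bar>f x\<bar> \<le> C" "\<forall>x\<in>S. \<bar>g x\<bar> \<le> D"
    using assms by (auto simp: loc_bdd_def) metis
  then show "\<exists>C. \<forall>x\<in>S. \<bar>f x * g x\<bar> \<le> C"
    by (intro exI[of _ "C * D"]) (force simp: abs_mult intro: mult_mono)
qed

lemma loc_bdd_add:
  assumes "loc_bdd f" "loc_bdd g"
  shows "loc_bdd (\<lambda>x. f x + g x)"
  unfolding loc_bdd_def
proof (intro conjI allI impI)
  show "(\<lambda>x. f x + g x) \<in> borel_measurable borel"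
    using assms by (auto simp: loc_bdd_def)
  fix S :: "'a set" assume "bounded S"
  then obtain C D where "\<forall>x\<in>S. \<bar>f x\<bar> \<le> C" "\<forall>x\<in>S. \<bar>g x\<bar> \<le> D"
    using assms by (auto simp: loc_bdd_def) metis
  then show "\<exists>C. \<forall>x\<in>S. \<bar>f x + g x\<bar> \<le> C"
    by (intro exI[of _ "C + D"]) force
qed

lemma loc_bdd_indicator: "A \<in> sets borel \<Longrightarrow> loc_bdd (indicator A)"
  unfolding loc_bdd_def by (auto intro!: exI[of _ 1] simp: indicator_def)

lemma bdd_supp_mult:
  assumes "loc_bdd f" "bdd_supp g"
  shows "bdd_supp (\<lambda>x. f x * g x)"
  using assms by (auto simp: bdd_supp_def loc_bdd_mult intro: bounded_subset)

lemma bdd_supp_integrable: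
  assumes "bdd_supp f"
  shows "integrable lborel f"
proof -
  let ?A = "closure {x. f x \<noteq> 0}"
  have A: "bounded ?A"
    using assms by (simp add: bdd_supp_def bounded_closure)
  then obtain C where C: "\<forall>x\<in>?A. \<bar>f x\<bar> \<le> C"
    using assms by (auto simp: bdd_supp_def loc_bdd_def)
  show ?thesis
    by (rule integrableI_bounded_set[of ?A _ _ C])
      (use C A closure_subset[of "{x. f x \<noteq> 0}"] emeasure_bounded_finite[of ?A] bdd_supp_measurable[OF assms] in auto)
qed

lemma bdd_supp_linear:
  fixes T :: "'a::euclidean_space \<Rightarrow> 'b::euclidean_space"
  assumes f: "bdd_supp f" and T: "bounded_linear T" and T': "bounded_linear T'" and inv: "\<And>x. T' (T x) = x"
  shows "bdd_supp (\<lambda>x. f (T x))"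
  unfolding bdd_supp_def loc_bdd_def
proof (intro conjI allI impI)
  have "T \<in> borel_measurable borel"
    by (intro borel_measurable_continuous_onI linear_continuous_on T)
  then show "(\<lambda>x. f (T x)) \<in> borel_measurable borel"
    using bdd_supp_measurable[OF f] by measurable
  fix S :: "'a set" assume "bounded S"
  then have "bounded (T ` S)"
    by (intro bounded_linear_image T)
  then obtain C where "\<forall>x\<in>T ` S. \<bar>f x\<bar> \<le> C"
    using f by (auto simp: bdd_supp_def loc_bdd_def)
  then show "\<exists>C. \<forall>x\<in>S. \<bar>f (T x)\<bar> \<le> C"
    by auto
next
  have "bounded (T' ` {x. f x \<noteq> 0})"
    using f T' by (intro bounded_linear_image) (auto simp: bdd_supp_def)
  moreover have "{x. f (T x) \<noteq> 0} \<subseteq> T' ` {x. f x \<noteq> 0}"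
    using inv by (metis (mono_tags, lifting) image_eqI mem_Collect_eq subsetI)
  ultimately show "bounded {x. f (T x) \<noteq> 0}"
    by (rule bounded_subset)
qed

abbreviation lc :: "real \<Rightarrow> real \<Rightarrow> real \<times> real" where
  "lc u v \<equiv> ((u + v) / 2, (u - v) / 2)"

text \<open>Fubini with the shear \<open>y = u - s\<close> for fixed \<open>s\<close>, then the
  substitution \<open>s = (u + v) / 2\<close> for fixed \<open>u\<close>, which yields the Jacobian
  1/2.\<close>

lemma lightcone_integral:
  fixes f :: "real \<times> real \<Rightarrow> real"
  assumes f: "bdd_supp f"
  shows "(LINT x|lborel. f x) = (LINT u|lborel. LINT v|lborel. f (lc u v)) / 2"
proof -
  have "(LINT x|lborel. f x) = (LINT s|lborel. LINT y|lborel. f (s, y))"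
    using lborel_pair.integral_fst'[of f] bdd_supp_integrable[OF f] by (simp add: lborel_prod)
  also have "\<dots> = (LINT s|lborel. LINT u|lborel. f (s, u - s))"
  proof (rule Bochner_Integration.integral_cong[OF refl])
    fix s show "(LINT y|lborel. f (s, y)) = (LINT u|lborel. f (s, u - s))"
      using lborel_integral_real_affine[of 1 "\<lambda>y. f (s, y)" "- s"] by simp
  qed
  also have "\<dots> = (LINT u|lborel. LINT s|lborel. f (s, u - s))"
  proof (rule lborel_pair.Fubini_integral[symmetric])
    have "bdd_supp (\<lambda>x. f (fst x, snd x - fst x))"
      by (rule bdd_supp_linear[OF f, of _ "\<lambda>x. (fst x, snd x + fst x)"])
        (auto intro!: bounded_linear_intros)
    then show "integrable (lborel \<Otimes>\<^sub>M lborel) (\<lambda>(s, u). f (s, u - s))"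
      unfolding lborel_prod case_prod_beta by (rule bdd_supp_integrable)
  qed
  also have "\<dots> = (LINT u|lborel. (LINT v|lborel. f (lc u v)) / 2)"
  proof (rule Bochner_Integration.integral_cong[OF refl])
    fix u
    have *: "(u / 2 + 1 / 2 * v, u - (u / 2 + 1 / 2 * v)) = (lc u v)" for v :: real
      by (simp add: field_simps)
    show "(LINT s|lborel. f (s, u - s)) = (LINT v|lborel. f (lc u v)) / 2"
      using lborel_integral_real_affine[of "1/2" "\<lambda>s. f (s, u - s)" "u / 2"] unfolding * by simp
  qed
  finally show ?thesis by simp
qed

text \<open>The opposite order of integration comes from the reflection of \<open>x1\<close>, which
  exchanges \<open>u\<close> and \<open>v\<close>.\<close>

lemma lightcone_integral':
  fixes f :: "real \<times> real \<Rightarrow> real"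
  assumes f: "bdd_supp f"
  shows "(LINT x|lborel. f x) = (LINT v|lborel. LINT u|lborel. f (lc u v)) / 2"
proof -
  have r: "bdd_supp (\<lambda>x. f (fst x, - snd x))"
    by (rule bdd_supp_linear[OF f, of _ "\<lambda>x. (fst x, - snd x)"])
      (auto intro!: bounded_linear_intros bounded_linear_minus)
  have "(LINT x|lborel. f x) = (LINT s|lborel. LINT y|lborel. f (s, y))"
    using lborel_pair.integral_fst'[of f] bdd_supp_integrable[OF f] by (simp add: lborel_prod)
  also have "\<dots> = (LINT s|lborel. LINT y|lborel. f (s, - y))"
  proof (rule Bochner_Integration.integral_cong[OF refl])
    fix s show "(LINT y|lborel. f (s, y)) = (LINT y|lborel. f (s, - y))"
      using lborel_integral_real_affine[of "-1" "\<lambda>y. f (s, y)" 0] by simp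
  qed
  also have "\<dots> = (LINT x|lborel. f (fst x, - snd x))"
    using lborel_pair.integral_fst'[of "\<lambda>x. f (fst x, - snd x)"] bdd_supp_integrable[OF r] by (simp add: lborel_prod)
  also have "\<dots> = (LINT u|lborel. LINT v|lborel. f ((u + v) / 2, - ((u - v) / 2))) / 2"
    by (subst lightcone_integral[OF r]) simp
  finally show ?thesis by (simp only: minus_divide_left minus_diff_eq add.commute)
qed

section \<open>Test functions\<close>

lemma dderiv_outside_support:
  assumes "\<And>x. x \<notin> K \<Longrightarrow> f x = 0" "closed K" "x \<notin> K"
  shows "dderiv e f x = 0"
proof -
  have "((\<lambda>x. 0) has_derivative (\<lambda>h. 0)) (at x)" by simp
  then have "(f has_derivative (\<lambda>h. 0)) (at x)"
    by (rule has_derivative_transform_within_open[where s = "- K"]) (use assms in auto)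
  then show ?thesis by (simp add: dderivI)
qed

lemma compactly_supported_dderiv:
  assumes "compactly_supported f"
  shows "compactly_supported (dderiv e f)"
proof -
  have "{x. dderiv e f x \<noteq> 0} \<subseteq> closure {x. f x \<noteq> 0}"
    using dderiv_outside_support[of "closure {x. f x \<noteq> 0}" f] closure_subset[of "{x. f x \<noteq> 0}"]
    by blast
  then have "closure {x. dderiv e f x \<noteq> 0} \<subseteq> closure {x. f x \<noteq> 0}"
    by (simp add: closure_minimal)
  then show ?thesis
    using assms unfolding compactly_supported_def by (metis closed_closure compact_Int_closed inf.absorb2)
qed

lemma compactly_supported_alt: "compactly_supported f \<longleftrightarrow> bounded {x. f x \<noteq> 0}"
  unfolding compactly_supported_def compact_closure by simp

lemma compactly_supported_wave_op:
  assumes "compactly_supported \<phi>"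
  shows "compactly_supported (wave_op \<phi>)"
proof -
  have "{x. wave_op \<phi> x \<noteq> 0} \<subseteq> {x. d0 (d0 \<phi>) x \<noteq> 0} \<union> {x. d1 (d1 \<phi>) x \<noteq> 0}"
    by (auto simp: wave_op_def)
  then show ?thesis
    using compactly_supported_dderiv[OF compactly_supported_dderiv[OF assms]]
    unfolding compactly_supported_alt by (metis bounded_Un bounded_subset)
qed

lemma wave_op_continuous: "smooth \<phi> \<Longrightarrow> continuous_on S (wave_op \<phi>)"
  unfolding wave_op_def by (intro continuous_intros smooth_plane_continuous smooth_d0 smooth_d1)

lemma bdd_supp_wave_op: "smooth \<phi> \<Longrightarrow> compactly_supported \<phi> \<Longrightarrow> bdd_supp (wave_op \<phi>)"
  unfolding bdd_supp_def
  by (simp add: loc_bdd_continuous wave_op_continuous compactly_supported_wave_op compactly_supported_alt[symmetric])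

lemma integral_half_line:
  fixes g g' :: "real \<Rightarrow> real"
  assumes "\<And>x. (g has_real_derivative g' x) (at x)" "continuous_on UNIV g'" "bounded {x. g x \<noteq> 0}"
  shows "(LINT x|lborel. indicator {c..} x * g' x) = - g c"
proof -
  obtain R where R: "\<forall>x\<in>{x. g x \<noteq> 0}. norm x \<le> R"
    using assms(3) unfolding bounded_iff by blast
  then have g0: "g x = 0" if "x > R" for x using that by fastforce
  have g'0: "g' x = 0" if "x > R" for x
  proof (rule DERIV_unique[OF assms(1)])
    have "((\<lambda>x. 0) has_real_derivative 0) (at x)" by simp
    then show "(g has_real_derivative 0) (at x)"
      by (rule has_field_derivative_transform_within_open[of _ _ _ "{R<..}"]) (use that g0 in auto)
  qed
  define b where "b = max c (R + 1)"
  have "(LINT x|lborel. indicator {c..} x * g' x) = (LINT x|lborel. g' x * indicator {c..b} x)"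
    by (rule Bochner_Integration.integral_cong) (auto simp: indicator_def b_def g'0)
  also have "\<dots> = g b - g c"
    by (rule integral_FTC_Icc_real)
      (use assms in \<open>auto simp: b_def continuous_on_eq_continuous_at\<close>)
  finally show ?thesis using g0[of b] by (simp add: b_def)
qed

lemma lightcone_curve_bounded:
  fixes f :: "real \<times> real \<Rightarrow> real"
  assumes "compactly_supported f"
  shows "bounded {v. f (lc u v) \<noteq> (0::real)}" "bounded {u. f (lc u v) \<noteq> 0}"
proof -
  have 1: "bounded ((\<lambda>x. fst x - snd x) ` {x. f x \<noteq> 0})"
    and 2: "bounded ((\<lambda>x. fst x + snd x) ` {x. f x \<noteq> 0})"
    using assms by (auto intro!: bounded_linear_image bounded_linear_intros simp: compactly_supported_alt)
  show "bounded {v. f (lc u v) \<noteq> (0::real)}"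
  proof (rule bounded_subset[OF 1], rule subsetI)
    fix v assume "v \<in> {v. f (lc u v) \<noteq> (0::real)}"
    then show "v \<in> (\<lambda>x. fst x - snd x) ` {x. f x \<noteq> 0}"
      by (intro image_eqI[of _ _ "lc u v"]) (auto simp: field_simps)
  qed
  show "bounded {u. f (lc u v) \<noteq> (0::real)}"
  proof (rule bounded_subset[OF 2], rule subsetI)
    fix u assume "u \<in> {u. f (lc u v) \<noteq> (0::real)}"
    then show "u \<in> (\<lambda>x. fst x + snd x) ` {x. f x \<noteq> 0}"
      by (intro image_eqI[of _ _ "lc u v"]) (auto simp: field_simps)
  qed
qed

lemma lightcone_derivs:
  assumes "smooth f"
  shows "((\<lambda>v. f (lc u v)) has_real_derivative (d0 f (lc u v) - d1 f (lc u v)) / 2) (at v)"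
    and "((\<lambda>u. f (lc u v)) has_real_derivative (d0 f (lc u v) + d1 f (lc u v)) / 2) (at u)"
proof -
  show "((\<lambda>v. f (lc u v)) has_real_derivative (d0 f (lc u v) - d1 f (lc u v)) / 2) (at v)"
    by (rule DERIV_cong[OF smooth_plane_chain[OF assms, of _ "1/2" _ _ _ "-1/2"]])
      (auto intro!: derivative_eq_intros simp: field_simps)
  show "((\<lambda>u. f (lc u v)) has_real_derivative (d0 f (lc u v) + d1 f (lc u v)) / 2) (at u)"
    by (rule DERIV_cong[OF smooth_plane_chain[OF assms, of _ "1/2" _ _ _ "1/2"]])
      (auto intro!: derivative_eq_intros simp: field_simps)
qed

lemma lightcone_continuous:
  fixes f :: "real \<times> real \<Rightarrow> real"
  assumes "continuous_on UNIV f"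
  shows "continuous_on S (\<lambda>v. f (lc u v))" "continuous_on S (\<lambda>u. f (lc u v))"
  by (auto intro!: continuous_on_compose2[OF assms] continuous_intros)

lemma compactly_supported_comb:
  assumes "compactly_supported f" "compactly_supported g"
  shows "compactly_supported (\<lambda>x. c * f x + d * g x)"
  using assms unfolding compactly_supported_alt
  by (rule_tac bounded_subset[of "{x. f x \<noteq> 0} \<union> {x. g x \<noteq> 0}"]) auto

lemma half_plane_borel: "{0..} \<times> UNIV \<in> sets (borel :: (real \<times> real) measure)"
  by (intro borel_closed closed_Times) auto

text \<open>The closed future light cone of \<open>(t, y)\<close>, a quadrant in \<open>u\<close>
  and \<open>v\<close>. Membership of \<open>x\<close> says that \<open>y\<close> lies in the
  interval of radius \<open>x0 - t\<close> about \<open>x1\<close>, the condition of the indicator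
  in Duhamel's formula.\<close>

definition future_cone :: "real \<Rightarrow> real \<Rightarrow> (real \<times> real) set" where
  "future_cone t y = {x. t + y \<le> fst x + snd x \<and> t - y \<le> fst x - snd x}"

lemma closed_future_cone: "closed (future_cone t y)"
  unfolding future_cone_def by (intro closed_Collect_conj closed_Collect_le continuous_intros)

section \<open>Pairing the wave operator with travelling waves and light cones\<close>

context
  fixes \<phi> :: "real \<times> real \<Rightarrow> real"
  assumes smooth: "smooth \<phi>" and comp: "compactly_supported \<phi>"
begin

text \<open>\<open>2 (d0 \<phi> + d1 \<phi>)\<close> is \<open>4 \<partial>_u \<phi>\<close>, and
  its derivative along \<open>v\<close> is \<open>wave_op \<phi>\<close>; one integration leaves
  only the boundary value at \<open>c\<close>.\<close>

lemma wave_op_half_line_v: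
  "(LINT v|lborel. indicator {c..} v * wave_op \<phi> (lc u v)) =
    - 2 * (d0 \<phi> ((u + c) / 2, (u - c) / 2) + d1 \<phi> ((u + c) / 2, (u - c) / 2))"
proof -
  let ?g = "\<lambda>v. 2 * d0 \<phi> (lc u v) + 2 * d1 \<phi> (lc u v)"
  have "(LINT v|lborel. indicator {c..} v * wave_op \<phi> (lc u v)) = - ?g c"
  proof (rule integral_half_line)
    show "(?g has_real_derivative wave_op \<phi> (lc u v)) (at v)" for v
      by (rule DERIV_cong[OF DERIV_add[OF DERIV_cmult DERIV_cmult]], rule lightcone_derivs(1)[OF smooth_d0[OF smooth]],
          rule lightcone_derivs(1)[OF smooth_d1[OF smooth]])
        (simp add: d0_d1_commute[OF smooth] wave_op_def field_simps)
    show "bounded {v. ?g v \<noteq> 0}"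
      using lightcone_curve_bounded(1)[OF compactly_supported_comb[OF compactly_supported_dderiv[OF comp] compactly_supported_dderiv[OF comp]]] .
    show "continuous_on UNIV (\<lambda>v. wave_op \<phi> (lc u v))"
      by (intro lightcone_continuous wave_op_continuous smooth)
  qed
  then show ?thesis by simp
qed

lemma wave_op_half_line_u:
  "(LINT u|lborel. indicator {c..} u * wave_op \<phi> (lc u v)) =
    - 2 * (d0 \<phi> ((c + v) / 2, (c - v) / 2) - d1 \<phi> ((c + v) / 2, (c - v) / 2))"
proof -
  let ?g = "\<lambda>u. 2 * d0 \<phi> (lc u v) + (- 2) * d1 \<phi> (lc u v)"
  have "(LINT u|lborel. indicator {c..} u * wave_op \<phi> (lc u v)) = - ?g c"
  proof (rule integral_half_line)
    show "(?g has_real_derivative wave_op \<phi> (lc u v)) (at u)" for u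
      by (rule DERIV_cong[OF DERIV_add[OF DERIV_cmult DERIV_cmult]], rule lightcone_derivs(2)[OF smooth_d0[OF smooth]],
          rule lightcone_derivs(2)[OF smooth_d1[OF smooth]])
        (simp add: d0_d1_commute[OF smooth] wave_op_def field_simps)
    show "bounded {u. ?g u \<noteq> 0}"
      using lightcone_curve_bounded(2)[OF compactly_supported_comb[OF compactly_supported_dderiv[OF comp] compactly_supported_dderiv[OF comp]]] .
    show "continuous_on UNIV (\<lambda>u. wave_op \<phi> (lc u v))"
      by (intro lightcone_continuous wave_op_continuous smooth)
  qed
  then show ?thesis by simp
qed

lemma gradient_half_line_u:
  "(LINT u|lborel. indicator {c..} u * (d0 \<phi> (lc u v) + d1 \<phi> (lc u v))) =
    - 2 * \<phi> ((c + v) / 2, (c - v) / 2)"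
proof -
  let ?g = "\<lambda>u. 2 * \<phi> (lc u v)"
  have "(LINT u|lborel. indicator {c..} u * (d0 \<phi> (lc u v) + d1 \<phi> (lc u v))) = - ?g c"
  proof (rule integral_half_line)
    show "(?g has_real_derivative d0 \<phi> (lc u v) + d1 \<phi> (lc u v)) (at u)" for u
      by (rule DERIV_cong[OF DERIV_cmult], rule lightcone_derivs(2)[OF smooth]) simp
    show "bounded {u. ?g u \<noteq> 0}"
      using lightcone_curve_bounded(2)[OF comp] by simp
    show "continuous_on UNIV (\<lambda>u. d0 \<phi> (lc u v) + d1 \<phi> (lc u v))"
      by (intro continuous_intros lightcone_continuous smooth_plane_continuous smooth_d0 smooth_d1 smooth)
  qed
  then show ?thesis by simp
qed

text \<open>A left-moving wave is constant on lines of fixed \<open>u\<close>, and the half-plane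
  meets such a line in \<open>v \<ge> -u\<close>. Integrating in \<open>v\<close> first leaves
  \<open>F\<close> undifferentiated, so profiles with a kink are covered.\<close>

lemma wave_op_left_mover:
  assumes F: "continuous_on UNIV F"
  shows "(LINT x:{0..} \<times> UNIV|lborel. F (fst x + snd x) * wave_op \<phi> x) =
    - (LINT y|lborel. F y * (d0 \<phi> (0, y) + d1 \<phi> (0, y)))"
proof -
  let ?f = "\<lambda>x. (indicator ({0..} \<times> UNIV) x * F (fst x + snd x)) * wave_op \<phi> x"
  have "bdd_supp ?f"
    by (intro bdd_supp_mult loc_bdd_mult loc_bdd_indicator half_plane_borel loc_bdd_continuous bdd_supp_wave_op smooth comp
        continuous_on_compose2[OF F] continuous_intros) auto
  then have "(LINT x|lborel. ?f x) = (LINT u|lborel. LINT v|lborel. ?f (lc u v)) / 2"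
    by (rule lightcone_integral)
  also have "\<dots> = (LINT u|lborel. F u * (LINT v|lborel. indicator {-u..} v * wave_op \<phi> (lc u v))) / 2"
  proof -
    have "?f (lc u v) = F u * (indicator {-u..} v * wave_op \<phi> (lc u v))" for u v
    proof -
      have "(u + v) / 2 + (u - v) / 2 = u" by (simp add: field_simps)
      moreover have "indicator ({0..} \<times> UNIV) (lc u v) = (indicator {-u..} v :: real)"
        by (auto simp: indicator_def)
      ultimately show ?thesis by simp
    qed
    then show ?thesis by (simp only: integral_mult_right_zero)
  qed
  also have "\<dots> = - (LINT y|lborel. F y * (d0 \<phi> (0, y) + d1 \<phi> (0, y)))"
  proof -
    have "F u * (LINT v|lborel. indicator {-u..} v * wave_op \<phi> (lc u v)) = (- 2) * (F u * (d0 \<phi> (0, u) + d1 \<phi> (0, u)))" for u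
      unfolding wave_op_half_line_v by (simp add: algebra_simps)
    then show ?thesis by simp
  qed
  finally show ?thesis by (simp add: set_lebesgue_integral_def mult.assoc)
qed

lemma wave_op_right_mover:
  assumes G: "continuous_on UNIV G"
  shows "(LINT x:{0..} \<times> UNIV|lborel. G (fst x - snd x) * wave_op \<phi> x) =
    - (LINT y|lborel. G (- y) * (d0 \<phi> (0, y) - d1 \<phi> (0, y)))"
proof -
  let ?f = "\<lambda>x. (indicator ({0..} \<times> UNIV) x * G (fst x - snd x)) * wave_op \<phi> x"
  have "bdd_supp ?f"
    by (intro bdd_supp_mult loc_bdd_mult loc_bdd_indicator half_plane_borel loc_bdd_continuous bdd_supp_wave_op smooth comp
        continuous_on_compose2[OF G] continuous_intros) auto
  then have "(LINT x|lborel. ?f x) = (LINT v|lborel. LINT u|lborel. ?f (lc u v)) / 2"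
    by (rule lightcone_integral')
  also have "\<dots> = (LINT v|lborel. G v * (LINT u|lborel. indicator {-v..} u * wave_op \<phi> (lc u v))) / 2"
  proof -
    have "?f (lc u v) = G v * (indicator {-v..} u * wave_op \<phi> (lc u v))" for u v
    proof -
      have "(u + v) / 2 - (u - v) / 2 = v" by (simp add: field_simps)
      moreover have "indicator ({0..} \<times> UNIV) (lc u v) = (indicator {-v..} u :: real)"
        by (auto simp: indicator_def)
      ultimately show ?thesis by simp
    qed
    then show ?thesis by (simp only: integral_mult_right_zero)
  qed
  also have "\<dots> = - (LINT v|lborel. G v * (d0 \<phi> (0, - v) - d1 \<phi> (0, - v)))"
  proof -
    have "G v * (LINT u|lborel. indicator {-v..} u * wave_op \<phi> (lc u v)) = (- 2) * (G v * (d0 \<phi> (0, - v) - d1 \<phi> (0, - v)))" for v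
      unfolding wave_op_half_line_u by (simp add: algebra_simps)
    then show ?thesis by simp
  qed
  also have "(LINT v|lborel. G v * (d0 \<phi> (0, - v) - d1 \<phi> (0, - v))) = (LINT y|lborel. G (- y) * (d0 \<phi> (0, y) - d1 \<phi> (0, y)))"
    using lborel_integral_real_affine[of "-1" "\<lambda>v. G v * (d0 \<phi> (0, - v) - d1 \<phi> (0, - v))" 0] by simp
  finally show ?thesis by (simp add: set_lebesgue_integral_def mult.assoc)
qed

text \<open>Half the indicator of the future light cone is the retarded fundamental solution of the
  wave operator in one space dimension: the half-line integrations in \<open>v\<close> and then in
  \<open>u\<close> leave the value at the apex.\<close>

lemma wave_op_cone: "(LINT x|lborel. indicator (future_cone t y) x * wave_op \<phi> x) = 2 * \<phi> (t, y)"
proof -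
  let ?f = "\<lambda>x. indicator (future_cone t y) x * wave_op \<phi> x"
  have "bdd_supp ?f"
    by (intro bdd_supp_mult loc_bdd_indicator borel_closed closed_future_cone bdd_supp_wave_op smooth comp)
  then have "(LINT x|lborel. ?f x) = (LINT u|lborel. LINT v|lborel. ?f (lc u v)) / 2"
    by (rule lightcone_integral)
  also have "\<dots> = (LINT u|lborel. indicator {t+y..} u * (LINT v|lborel. indicator {t-y..} v * wave_op \<phi> (lc u v))) / 2"
  proof -
    have "?f (lc u v) = indicator {t+y..} u * (indicator {t-y..} v * wave_op \<phi> (lc u v))" for u v
    proof -
      have "(u + v) / 2 + (u - v) / 2 = u" "(u + v) / 2 - (u - v) / 2 = v" by (simp_all add: field_simps)
      then show ?thesis by (auto simp: future_cone_def indicator_def)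
    qed
    then show ?thesis by (simp only: integral_mult_right_zero)
  qed
  also have "\<dots> = (LINT u|lborel. (-2) * (indicator {t+y..} u * (d0 \<phi> ((u + (t - y)) / 2, (u - (t - y)) / 2) + d1 \<phi> ((u + (t - y)) / 2, (u - (t - y)) / 2)))) / 2"
    unfolding wave_op_half_line_v by (simp only: mult.left_commute[of _ "- 2"])
  also have "\<dots> = - (LINT u|lborel. indicator {t+y..} u * (d0 \<phi> ((u + (t - y)) / 2, (u - (t - y)) / 2) + d1 \<phi> ((u + (t - y)) / 2, (u - (t - y)) / 2)))"
    by (subst integral_mult_right_zero) simp
  also have "\<dots> = 2 * \<phi> (t, y)"
    unfolding gradient_half_line_u by simp
  finally show ?thesis .
qed

end

section \<open>The distributional Cauchy problem\<close>

lemma bdd_supp_slice: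
  assumes "continuous_on UNIV f" "compactly_supported f"
  shows "bdd_supp (\<lambda>y. f (0::real, y::real))"
  unfolding bdd_supp_def
proof
  show "loc_bdd (\<lambda>y. f (0, y))"
    by (intro loc_bdd_continuous continuous_on_compose2[OF assms(1)] continuous_intros) auto
  have "bounded (snd ` {x. f x \<noteq> 0})"
    using assms(2) by (intro bounded_linear_image bounded_linear_snd) (simp add: compactly_supported_alt)
  then show "bounded {y. f (0, y) \<noteq> 0}"
    by (rule bounded_subset) (auto simp: image_iff)
qed

lemma integral_deriv_bounded_support:
  fixes g g' :: "real \<Rightarrow> real"
  assumes "\<And>x. (g has_real_derivative g' x) (at x)" "continuous_on UNIV g'" "bounded {x. g x \<noteq> 0}"
  shows "(LINT x|lborel. g' x) = 0"
proof -
  obtain R where R: "\<forall>x\<in>{x. g x \<noteq> 0}. norm x \<le> R"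
    using assms(3) unfolding bounded_iff by blast
  have g0: "g x = 0" if "x < - R" for x
    using that R by fastforce
  have g'0: "g' x = 0" if "x < - R" for x
  proof (rule DERIV_unique[OF assms(1)])
    have "((\<lambda>x. 0) has_real_derivative 0) (at x)" by simp
    then show "(g has_real_derivative 0) (at x)"
      by (rule has_field_derivative_transform_within_open[of _ _ _ "{..<-R}"]) (use that g0 in auto)
  qed
  have "(LINT x|lborel. g' x) = (LINT x|lborel. indicator {-R-1..} x * g' x)"
    by (rule Bochner_Integration.integral_cong) (auto simp: indicator_def intro!: g'0)
  also have "\<dots> = - g (- R - 1)"
    by (rule integral_half_line[OF assms])
  finally show ?thesis by (simp add: g0)
qed

text \<open>At \<open>x0 = 0\<close> the time derivative of the sum of the two movers is formally
  the \<open>y\<close>-derivative of \<open>F y - G (- y)\<close>. Asking differentiability of this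
  combination only lets kinks of \<open>F\<close> and \<open>G\<close> cancel, as they do for the
  static field.\<close>

lemma weak_free_wave:
  assumes "continuous_on UNIV F" "continuous_on UNIV G"
    and H: "\<And>y. ((\<lambda>y. F y - G (- y)) has_real_derivative U1 y) (at y)" and U1: "continuous_on UNIV U1"
    and \<phi>: "smooth \<phi>" "compactly_supported \<phi>"
  shows "(LINT x:{0..} \<times> UNIV|lborel. (F (fst x + snd x) + G (fst x - snd x)) * wave_op \<phi> x) =
    (LINT y|lborel. U1 y * \<phi> (0, y)) - (LINT y|lborel. (F y + G (- y)) * d0 \<phi> (0, y))"
proof -
  have G': "continuous_on UNIV (\<lambda>y. G (- y))"
    by (intro continuous_on_compose2[OF assms(2)] continuous_intros) auto
  have s: "bdd_supp (\<lambda>y. \<phi> (0, y))" "bdd_supp (\<lambda>y. d0 \<phi> (0, y))" "bdd_supp (\<lambda>y. d1 \<phi> (0, y))"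
    by (auto intro!: bdd_supp_slice smooth_plane_continuous smooth_d0 smooth_d1 \<phi> compactly_supported_dderiv)
  note int = bdd_supp_integrable[OF bdd_supp_mult[OF loc_bdd_continuous]]
  have i: "set_integrable lborel ({0..} \<times> UNIV) (\<lambda>x. F (fst x + snd x) * wave_op \<phi> x)"
    "set_integrable lborel ({0..} \<times> UNIV) (\<lambda>x. G (fst x - snd x) * wave_op \<phi> x)"
    unfolding set_integrable_def real_scaleR_def mult.assoc[symmetric]
    by (intro bdd_supp_integrable bdd_supp_mult loc_bdd_mult loc_bdd_indicator half_plane_borel
        loc_bdd_continuous bdd_supp_wave_op \<phi> continuous_on_compose2[OF assms(1)] continuous_on_compose2[OF assms(2)] continuous_intros; simp)+
  \<comment> \<open>The integral of a total derivative of a function with bounded support; it trades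
    the terms with \<open>d1 \<phi>\<close> in the boundary values for the one with
    \<open>U1\<close>.\<close>
  have 0: "(LINT y|lborel. U1 y * \<phi> (0, y) + d1 \<phi> (0, y) * (F y - G (- y))) = 0"
  proof (rule integral_deriv_bounded_support)
    show "((\<lambda>y. (F y - G (- y)) * \<phi> (0, y)) has_real_derivative U1 x * \<phi> (0, x) + d1 \<phi> (0, x) * (F x - G (- x))) (at x)" for x
      by (rule DERIV_mult[OF H smooth_plane_partials(2)[OF \<phi>(1)]])
    show "bounded {x. (F x - G (- x)) * \<phi> (0, x) \<noteq> 0}"
      by (rule bounded_subset[of "{y. \<phi> (0, y) \<noteq> 0}"]) (use s(1) in \<open>auto simp: bdd_supp_def\<close>)
    show "continuous_on UNIV (\<lambda>x. U1 x * \<phi> (0, x) + d1 \<phi> (0, x) * (F x - G (- x)))"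
      by (intro continuous_intros U1 assms(1) G' continuous_on_compose2[OF smooth_plane_continuous[OF \<phi>(1), of UNIV]]
          continuous_on_compose2[OF smooth_plane_continuous[OF smooth_d1[OF \<phi>(1)], of UNIV]]) auto
  qed
  have "(LINT x:{0..} \<times> UNIV|lborel. (F (fst x + snd x) + G (fst x - snd x)) * wave_op \<phi> x) =
      - (LINT y|lborel. F y * (d0 \<phi> (0, y) + d1 \<phi> (0, y))) - (LINT y|lborel. G (- y) * (d0 \<phi> (0, y) - d1 \<phi> (0, y)))"
    unfolding distrib_right set_integral_add(2)[OF i] wave_op_left_mover[OF \<phi> assms(1)] wave_op_right_mover[OF \<phi> assms(2)]
    by simp
  also have "\<dots> = (LINT y|lborel. U1 y * \<phi> (0, y)) - (LINT y|lborel. (F y + G (- y)) * d0 \<phi> (0, y))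
      - (LINT y|lborel. U1 y * \<phi> (0, y) + d1 \<phi> (0, y) * (F y - G (- y)))"
    by (simp add: distrib_left distrib_right right_diff_distrib left_diff_distrib int[OF assms(1) s(2)] int[OF assms(1) s(3)] int[OF G' s(2)] int[OF G' s(3)]
         int[OF U1 s(1)] int[OF assms(1) s(2)] int[OF assms(1) s(3)] mult.commute[of "d1 \<phi> _"])
  finally show ?thesis using 0 by simp
qed

section \<open>Duhamel's integral for a weighted world-line\<close>

definition source_field :: "(real \<Rightarrow> real) \<Rightarrow> (real \<Rightarrow> real) \<Rightarrow> real \<times> real \<Rightarrow> real" where
  "source_field w z x = (LINT t|lborel. w t * indicator (future_cone t (z t)) x)"

text \<open>The weight \<open>w\<close> stands for the rate of proper time. Its bound is a parameter
  \<open>W\<close>, because where a world-line has no derivative \<open>velocity\<close> is an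
  unspecified number.\<close>

locale source =
  fixes w z :: "real \<Rightarrow> real" and W :: real
  assumes w_borel [measurable]: "w \<in> borel_measurable borel"
    and z_borel [measurable]: "z \<in> borel_measurable borel"
    and w_bound: "\<bar>w t\<bar> \<le> W"
    and w_past: "t < 0 \<Longrightarrow> w t = 0"
begin

lemma W_nonneg: "W \<ge> 0"
  using w_bound[of 0] by linarith

lemma cone_indicator_borel [measurable]:
  "(\<lambda>(x, t). indicator (future_cone t (z t)) x :: real) \<in> borel_measurable (borel \<Otimes>\<^sub>M borel)"
proof -
  have [measurable]: "fst \<in> borel_measurable (borel :: (real \<times> real) measure)" "snd \<in> borel_measurable (borel :: (real \<times> real) measure)"
    by (auto intro!: borel_measurable_continuous_onI continuous_intros)
  have *: "(\<lambda>(x, t). indicator (future_cone t (z t)) x :: real) =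
      (\<lambda>(x, t). if t + z t \<le> fst x + snd x \<and> t - z t \<le> fst x - snd x then 1 else 0)"
    by (auto simp: future_cone_def indicator_def fun_eq_iff)
  show ?thesis
    unfolding * by measurable
qed

lemma integrand_supp:
  assumes "w t * indicator (future_cone t (z t)) x \<noteq> 0"
  shows "0 \<le> t" "t \<le> fst x"
proof -
  show "0 \<le> t" using assms w_past[of t] by (cases "t < 0") auto
  have "t + z t \<le> fst x + snd x" "t - z t \<le> fst x - snd x"
    using assms by (auto simp: future_cone_def indicator_def split: if_splits)
  then show "t \<le> fst x" by linarith
qed

lemma integrand_integrable: "integrable lborel (\<lambda>t. w t * indicator (future_cone t (z t)) x)"
proof (rule integrableI_bounded_set[where A = "{0..fst x}" and B = W])
  have "(\<lambda>t. (\<lambda>(x, t). indicator (future_cone t (z t)) x :: real) (x, t)) \<in> borel_measurable borel"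
    by measurable
  then show "(\<lambda>t. w t * indicator (future_cone t (z t)) x) \<in> borel_measurable lborel"
    by simp
  show "emeasure lborel {0..fst x} < \<infinity>"
    by (rule emeasure_bounded_finite) auto
  show "AE t in lborel. t \<in> {0..fst x} \<longrightarrow> norm (w t * indicator (future_cone t (z t)) x) \<le> W"
    using w_bound W_nonneg by (auto simp: indicator_def)
  show "AE t in lborel. t \<notin> {0..fst x} \<longrightarrow> w t * indicator (future_cone t (z t)) x = 0"
    using integrand_supp[of _ x] by (intro AE_I2) (metis atLeastAtMost_iff)
qed simp

lemma source_field_past: "fst x < 0 \<Longrightarrow> source_field w z x = 0"
proof -
  assume "fst x < 0"
  then have "w t * indicator (future_cone t (z t)) x = 0" for t
    using integrand_supp[of t x] by force
  then show ?thesis unfolding source_field_def by (simp only: Bochner_Integration.integral_zero)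
qed

lemma source_field_loc_bdd: "loc_bdd (source_field w z)"
  unfolding loc_bdd_def
proof (intro conjI allI impI)
  have "(\<lambda>x. LINT t|lborel. w t * indicator (future_cone t (z t)) x) \<in> borel_measurable borel"
    by (rule lborel.borel_measurable_lebesgue_integral) measurable
  then show "source_field w z \<in> borel_measurable borel"
    by (simp add: source_field_def[abs_def])
  fix S :: "(real \<times> real) set" assume "bounded S"
  then have "bounded (fst ` S)" by (intro bounded_linear_image bounded_linear_fst)
  then obtain R where R: "\<forall>t\<in>fst ` S. norm t \<le> R" unfolding bounded_iff by blast
  have "\<bar>source_field w z x\<bar> \<le> W * max 0 R" if "x \<in> S" for x
  proof -
    have "norm (source_field w z x) \<le> (LINT t|lborel. W * indicator {0..max 0 R} t)"
      unfolding source_field_def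
    proof (rule Bochner_Integration.integral_norm_bound[THEN order_trans], rule integral_mono)
      show "integrable lborel (\<lambda>t. norm (w t * indicator (future_cone t (z t)) x))"
        by (intro integrable_norm integrand_integrable)
      fix t
      have "t \<in> {0..max 0 R}" if "w t * indicator (future_cone t (z t)) x \<noteq> 0"
        using integrand_supp[OF that] R \<open>x \<in> S\<close> by fastforce
      moreover have "norm (w t * indicator (future_cone t (z t)) x) \<le> W"
        using w_bound W_nonneg by (auto simp: indicator_def)
      ultimately show "norm (w t * indicator (future_cone t (z t)) x) \<le> W * indicator {0..max 0 R} t"
        using W_nonneg by (cases "w t * indicator (future_cone t (z t)) x = 0") auto
    qed auto
    then show ?thesis by simp
  qed
  then show "\<exists>C. \<forall>x\<in>S. \<bar>source_field w z x\<bar> \<le> C" by blast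
qed

text \<open>Fubini reduces the pairing to single cones, each contributing twice the value of the
  test function at its apex. The restriction to the half-plane disappears since the field vanishes
  for \<open>x0 < 0\<close>.\<close>

lemma weak_source:
  assumes \<phi>: "smooth \<phi>" "compactly_supported \<phi>"
  shows "(LINT x:{0..} \<times> UNIV|lborel. source_field w z x * wave_op \<phi> x) = 2 * (LINT t|lborel. w t * \<phi> (t, z t))"
proof -
  let ?k = "\<lambda>x t. w t * indicator (future_cone t (z t)) x * wave_op \<phi> x"
  have [measurable]: "wave_op \<phi> \<in> borel_measurable borel"
    by (intro borel_measurable_continuous_onI wave_op_continuous \<phi>)
  have "(LINT x:{0..} \<times> UNIV|lborel. source_field w z x * wave_op \<phi> x) = (LINT x|lborel. source_field w z x * wave_op \<phi> x)"
    unfolding set_lebesgue_integral_def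
  proof (rule Bochner_Integration.integral_cong[OF refl])
    fix x
    show "indicator ({0..} \<times> UNIV) x *\<^sub>R (source_field w z x * wave_op \<phi> x) = source_field w z x * wave_op \<phi> x"
      using source_field_past[of x] by (cases "fst x < 0") (auto simp: indicator_def mem_Times_iff)
  qed
  also have "\<dots> = (LINT x|lborel. LINT t|lborel. ?k x t)"
    by (simp add: source_field_def)
  also have "\<dots> = (LINT t|lborel. LINT x|lborel. ?k x t)"
  proof (rule lborel_pair.Fubini_integral[symmetric])
    have "bdd_supp (\<lambda>(x, t). ?k x t)"
      unfolding bdd_supp_def loc_bdd_def
    proof (intro conjI allI impI)
      have "(\<lambda>(x, t). ?k x t) \<in> borel_measurable (borel \<Otimes>\<^sub>M borel)"
        by measurable
      then show "(\<lambda>(x, t). ?k x t) \<in> borel_measurable borel" by (simp add: borel_prod)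
      have b: "bounded {x. wave_op \<phi> x \<noteq> 0}"
        using compactly_supported_wave_op[OF \<phi>(2)] by (simp add: compactly_supported_alt)
      then have "bounded (fst ` {x. wave_op \<phi> x \<noteq> 0})" by (intro bounded_linear_image bounded_linear_fst)
      then obtain R where R: "\<forall>t\<in>fst ` {x. wave_op \<phi> x \<noteq> 0}. norm t \<le> R" unfolding bounded_iff by blast
      have "{p. (case p of (x, t) \<Rightarrow> ?k x t) \<noteq> 0} \<subseteq> {x. wave_op \<phi> x \<noteq> 0} \<times> {0..R}"
      proof safe
        fix x0 x1 t assume *: "w t * indicator (future_cone t (z t)) (x0, x1) * wave_op \<phi> (x0, x1) \<noteq> 0"
        then have "0 \<le> t" "t \<le> x0" using integrand_supp[of t "(x0, x1)"] by auto
        moreover have "x0 \<le> R" using R * by (force simp: image_iff)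
        ultimately show "t \<in> {0..R}" by auto
      qed auto
      then show "bounded {p. (case p of (x, t) \<Rightarrow> ?k x t) \<noteq> 0}"
        by (rule bounded_subset[OF bounded_Times[OF b bounded_closed_interval]])
      obtain C where C: "\<forall>x\<in>{x. wave_op \<phi> x \<noteq> 0}. \<bar>wave_op \<phi> x\<bar> \<le> C"
        using bdd_supp_wave_op[OF \<phi>] b by (auto simp: bdd_supp_def loc_bdd_def)
      have "\<bar>?k x t\<bar> \<le> W * max C 0" for x t
      proof -
        have "\<bar>w t * indicator (future_cone t (z t)) x\<bar> \<le> W"
          using w_bound W_nonneg by (auto simp: indicator_def)
        moreover have "\<bar>wave_op \<phi> x\<bar> \<le> max C 0"
          using bspec[OF C, of x] by (cases "wave_op \<phi> x = 0") auto
        ultimately show ?thesis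
          unfolding abs_mult[of _ "wave_op \<phi> x"] using W_nonneg by (intro mult_mono) auto
      qed
      then show "\<exists>C. \<forall>x\<in>S. \<bar>case x of (x, t) \<Rightarrow> ?k x t\<bar> \<le> C" for S
        by (intro exI[of _ "W * max C 0"]) auto
    qed
    then show "integrable (lborel \<Otimes>\<^sub>M lborel) (\<lambda>(x, t). ?k x t)"
      unfolding lborel_prod by (rule bdd_supp_integrable)
  qed
  also have "\<dots> = (LINT t|lborel. w t * (2 * \<phi> (t, z t)))"
    by (simp only: mult.assoc integral_mult_right_zero wave_op_cone[OF \<phi>])
  also have "\<dots> = (LINT t|lborel. 2 * (w t * \<phi> (t, z t)))"
    by (rule Bochner_Integration.integral_cong) auto
  finally show ?thesis by simp
qed

end

section \<open>Uniqueness of distributional solutions\<close>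

definition quadrant :: "real \<times> real \<Rightarrow> (real \<times> real) set" where
  "quadrant x = {y. fst x + snd x < fst y + snd y \<and> fst x - snd x < fst y - snd y}"

text \<open>Every cone that contains \<open>x\<close> contains \<open>quadrant x\<close>. Hence the
  integrand changes only at times with \<open>t + z t\<close> slightly above \<open>A\<close> or
  \<open>t - z t\<close> slightly above \<open>B\<close>, and these sets shrink to the empty set.
  From other directions the limit set could be the times at which the world-line is on a light ray
  through \<open>x\<close>, which may have positive measure.\<close>

lemma (in source) tendsto_source_field:
  "(source_field w z \<longlongrightarrow> source_field w z x) (at x within quadrant x)"
  unfolding Lim_within
proof (intro allI impI)
  fix e :: real assume e: "e > 0"
  define A where "A = fst x + snd x"
  define B where "B = fst x - snd x"
  \<comment> \<open>\<open>h n\<close> dominates the change of the integrand for points of the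
    quadrant within \<open>1 / Suc n\<close> of \<open>x\<close> in both light-cone
    coordinates.\<close>
  define h where "h n t = W * indicator {0..fst x + 1} t * ((if A < t + z t \<and> t + z t \<le> A + 1 / Suc n then 1 else 0) +
      (if B < t - z t \<and> t - z t \<le> B + 1 / Suc n then 1 else 0))" for n :: nat and t :: real
  have hm [measurable]: "h n \<in> borel_measurable borel" for n
    unfolding h_def[abs_def] by measurable
  have hb: "norm (h n t) \<le> 2 * W * indicator {0..fst x + 1} t" for n t
    using W_nonneg by (auto simp: h_def indicator_def)
  have "(\<lambda>n. LINT t|lborel. h n t) \<longlonglongrightarrow> (LINT t::real|lborel. (0::real))"
  proof (rule integral_dominated_convergence[where w = "\<lambda>t. 2 * W * indicator {0..fst x + 1} t"])
    have z: "(\<lambda>n. if c < s \<and> s \<le> c + 1 / Suc n then 1 else 0 :: real) \<longlonglongrightarrow> 0" for c s :: real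
    proof (cases "c < s")
      case True
      then have "\<forall>\<^sub>F n in sequentially. 1 / real (Suc n) < s - c"
        using order_tendstoD(2)[OF LIMSEQ_inverse_real_of_nat, of "s - c"] by (simp add: inverse_eq_divide)
      then have "\<forall>\<^sub>F n in sequentially. (if c < s \<and> s \<le> c + 1 / Suc n then 1 else 0 :: real) = 0"
        by eventually_elim auto
      then show ?thesis by (rule tendsto_eventually)
    qed auto
    show "AE t in lborel. (\<lambda>n. h n t) \<longlonglongrightarrow> 0"
    proof (intro AE_I2)
      fix t
      have "(\<lambda>n. h n t) \<longlonglongrightarrow> W * indicator {0..fst x + 1} t * (0 + 0)"
        unfolding h_def by (intro tendsto_intros z)
      then show "(\<lambda>n. h n t) \<longlonglongrightarrow> 0" by simp
    qed
    show "integrable lborel (\<lambda>t. 2 * W * indicator {0..fst x + 1} t)"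
      using emeasure_bounded_finite[of "{0..fst x + 1}"]
      by (intro integrable_mult_right integrable_real_indicator) auto
    show "AE t in lborel. norm (h n t) \<le> 2 * W * indicator {0..fst x + 1} t" for n
      using hb by simp
  qed auto
  then have "(\<lambda>n. LINT t|lborel. h n t) \<longlonglongrightarrow> 0" by simp
  then have "\<forall>\<^sub>F n in sequentially. (LINT t|lborel. h n t) < e"
    using e by (rule order_tendstoD)
  then obtain n where n: "(LINT t|lborel. h n t) < e"
    by (auto simp: eventually_sequentially)
  have hi: "integrable lborel (h n)"
  proof (rule integrableI_bounded_set[where A = "{0..fst x + 1}" and B = "2 * W"])
    show "AE t in lborel. t \<in> {0..fst x + 1} \<longrightarrow> norm (h n t) \<le> 2 * W"
    proof (intro AE_I2 impI)
      fix t assume "t \<in> {0..fst x + 1}"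
      then show "norm (h n t) \<le> 2 * W" using hb[of n t] by simp
    qed
    show "AE t in lborel. t \<notin> {0..fst x + 1} \<longrightarrow> h n t = 0"
      by (auto simp: h_def indicator_def)
  qed (use emeasure_bounded_finite[of "{0..fst x + 1}"] in auto)
  show "\<exists>d>0. \<forall>y\<in>quadrant x. 0 < dist y x \<and> dist y x < d \<longrightarrow> dist (source_field w z y) (source_field w z x) < e"
  proof (intro exI[of _ "1 / Suc n / 2"] conjI ballI impI)
    fix y assume q: "y \<in> quadrant x" and d: "0 < dist y x \<and> dist y x < 1 / Suc n / 2"
    define r where "r = 1 / real (Suc n)"
    \<comment> \<open>Each light-cone coordinate moves by at most twice the distance, hence the
      factor 1/2 in the radius.\<close>
    have "\<bar>fst y - fst x\<bar> \<le> dist y x" "\<bar>snd y - snd x\<bar> \<le> dist y x"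
      using dist_fst_le[of y x] dist_snd_le[of y x] by (auto simp: dist_real_def)
    then have y: "A < fst y + snd y" "fst y + snd y < A + 1 / Suc n" "B < fst y - snd y" "fst y - snd y < B + 1 / Suc n"
      using q d unfolding A_def B_def quadrant_def r_def[symmetric] by auto
    have n1: "1 / real (Suc n) \<le> 1" by simp
    have fy: "fst y \<le> fst x + 1" using y n1 unfolding A_def B_def by linarith
    have "\<bar>source_field w z y - source_field w z x\<bar> =
        norm (LINT t|lborel. w t * indicator (future_cone t (z t)) y - w t * indicator (future_cone t (z t)) x)"
      unfolding source_field_def by (simp add: integrand_integrable)
    also have "\<dots> \<le> (LINT t|lborel. h n t)"
    proof (rule Bochner_Integration.integral_norm_bound[THEN order_trans], rule integral_mono)
      show "integrable lborel (\<lambda>t. norm (w t * indicator (future_cone t (z t)) y - w t * indicator (future_cone t (z t)) x))"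
        by (intro integrable_norm Bochner_Integration.integrable_diff integrand_integrable)
      fix t
      have xy: "x \<in> future_cone t (z t) \<Longrightarrow> y \<in> future_cone t (z t)"
        using y by (auto simp: future_cone_def A_def B_def)
      show "norm (w t * indicator (future_cone t (z t)) y - w t * indicator (future_cone t (z t)) x) \<le> h n t"
      proof (cases "w t * indicator (future_cone t (z t)) y = 0 \<or> x \<in> future_cone t (z t)")
        case True
        then have "w t * indicator (future_cone t (z t)) y - w t * indicator (future_cone t (z t)) x = 0"
          using xy by (auto simp: indicator_def)
        then show ?thesis using W_nonneg by (auto simp: h_def indicator_def)
      next
        case False
        then have t: "0 \<le> t" "t \<le> fst x + 1" using integrand_supp[of t y] fy by auto
        have "y \<in> future_cone t (z t)" "x \<notin> future_cone t (z t)" using False by (auto simp: indicator_def)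
        then have "(A < t + z t \<and> t + z t \<le> A + 1 / Suc n) \<or> (B < t - z t \<and> t - z t \<le> B + 1 / Suc n)"
          using y unfolding future_cone_def A_def B_def by force
        then have "h n t \<ge> W"
          using t W_nonneg by (auto simp: h_def indicator_def)
        then show ?thesis using False w_bound[of t] by (auto simp: indicator_def)
      qed
    qed (rule hi)
    finally show "dist (source_field w z y) (source_field w z x) < e" using n by (simp add: dist_real_def)
  qed auto
qed

text \<open>The factors bound the support from all sides: the last two vanish for
  \<open>x0 + x1 \<ge> q\<close> and \<open>x0 - x1 \<ge> q'\<close>, the first for
  \<open>x0 \<le> -2\<close>. The first is constant for \<open>x0 \<ge> -1\<close>, so it
  contributes no derivatives on the half-plane.\<close>

lemma smooth_tail_product:
  assumes "p < q" "p' < q'"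
  shows "smooth (\<lambda>x::real \<times> real. tail 1 2 (- fst x) * tail p q (fst x + snd x) * tail p' q' (fst x - snd x))"
proof (rule smooth_ridge_alg, intro ridge_alg.mult)
  have "(\<lambda>x. tail 1 2 (inner (-1, 0) x)) \<in> (ridge_alg :: (real \<times> real \<Rightarrow> real) set)"
    by (rule ridge_alg.ridge) (simp add: smooth_tail)
  then show "(\<lambda>x. tail 1 2 (- fst x)) \<in> (ridge_alg :: (real \<times> real \<Rightarrow> real) set)"
    by (simp add: inner_prod_def)
  have "(\<lambda>x. tail p q (inner (1, 1) x)) \<in> (ridge_alg :: (real \<times> real \<Rightarrow> real) set)"
    by (rule ridge_alg.ridge) (simp add: smooth_tail assms)
  then show "(\<lambda>x. tail p q (fst x + snd x)) \<in> (ridge_alg :: (real \<times> real \<Rightarrow> real) set)"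
    by (simp add: inner_prod_def)
  have "(\<lambda>x. tail p' q' (inner (1, -1) x)) \<in> (ridge_alg :: (real \<times> real \<Rightarrow> real) set)"
    by (rule ridge_alg.ridge) (simp add: smooth_tail assms)
  then show "(\<lambda>x. tail p' q' (fst x - snd x)) \<in> (ridge_alg :: (real \<times> real \<Rightarrow> real) set)"
    by (simp add: inner_prod_def)
qed

lemma wave_op_tail_product:
  assumes "p < q" "p' < q'" "0 \<le> fst x"
  shows "wave_op (\<lambda>x. tail 1 2 (- fst x) * tail p q (fst x + snd x) * tail p' q' (fst x - snd x)) x =
    4 * tail 1 2 0 * bump p q (fst x + snd x) * bump p' q' (fst x - snd x)"
proof -
  define F where "F = tail p q"
  define G where "G = tail p' q'"
  define H where "H s = tail 1 2 (- s)" for s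
  define f where "f = bump p q"
  define g where "g = bump p' q'"
  define h where "h s = - bump 1 2 (- s)" for s
  note b' = smooth_real_deriv[OF smooth_bump]
  define f' where "f' = dderiv 1 f"
  define g' where "g' = dderiv 1 g"
  define h' where "h' s = dderiv 1 (bump 1 2) (- s)" for s
  have F: "(F has_real_derivative f s) (at s)" for s unfolding F_def f_def by (rule has_real_derivative_tail[OF assms(1)])
  have G: "(G has_real_derivative g s) (at s)" for s unfolding G_def g_def by (rule has_real_derivative_tail[OF assms(2)])
  have H: "(H has_real_derivative h s) (at s)" for s unfolding H_def h_def
    by (rule DERIV_cong[OF DERIV_chain2[OF has_real_derivative_tail]]) (auto intro!: derivative_eq_intros)
  have f: "(f has_real_derivative f' s) (at s)" for s unfolding f_def f'_def by (rule b')
  have g: "(g has_real_derivative g' s) (at s)" for s unfolding g_def g'_def by (rule b')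
  have h: "(h has_real_derivative h' s) (at s)" for s unfolding h_def h'_def
    by (rule DERIV_cong[OF DERIV_minus[OF DERIV_chain2[OF b']]]) (auto intro!: derivative_eq_intros)
  let ?\<phi> = "\<lambda>x. H (fst x) * F (fst x + snd x) * G (fst x - snd x)"
  have sm: "smooth ?\<phi>"
    using smooth_tail_product[OF assms(1,2)] by (simp add: F_def G_def H_def)
  have D0: "d0 ?\<phi> = (\<lambda>x. h (fst x) * F (fst x + snd x) * G (fst x - snd x)
      + H (fst x) * f (fst x + snd x) * G (fst x - snd x) + H (fst x) * F (fst x + snd x) * g (fst x - snd x))"
  proof
    fix x :: "real \<times> real"
    show "d0 ?\<phi> x = h (fst x) * F (fst x + snd x) * G (fst x - snd x)
      + H (fst x) * f (fst x + snd x) * G (fst x - snd x) + H (fst x) * F (fst x + snd x) * g (fst x - snd x)"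
      by (rule DERIV_unique[OF smooth_plane_partials(1)[OF sm, of "snd x" "fst x", simplified]])
        (auto intro!: derivative_eq_intros DERIV_chain2[OF F] DERIV_chain2[OF G] DERIV_chain2[OF H] simp: algebra_simps)
  qed
  have D1: "d1 ?\<phi> = (\<lambda>x. H (fst x) * f (fst x + snd x) * G (fst x - snd x) - H (fst x) * F (fst x + snd x) * g (fst x - snd x))"
  proof
    fix x :: "real \<times> real"
    show "d1 ?\<phi> x = H (fst x) * f (fst x + snd x) * G (fst x - snd x) - H (fst x) * F (fst x + snd x) * g (fst x - snd x)"
      by (rule DERIV_unique[OF smooth_plane_partials(2)[OF sm, of "fst x" "snd x", simplified]])
        (auto intro!: derivative_eq_intros DERIV_chain2[OF F] DERIV_chain2[OF G] simp: algebra_simps)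
  qed
  have h0: "h (fst x) = 0"
    using assms(3) by (simp add: h_def bump_eq_0)
  have h'0: "h' (fst x) = 0"
  proof -
    have "((\<lambda>s. 0) has_real_derivative 0) (at (- fst x))" by simp
    then have "(bump 1 2 has_real_derivative 0) (at (- fst x))"
      by (rule has_field_derivative_transform_within_open[of _ _ _ "{..<1}"]) (use assms(3) in \<open>auto simp: bump_eq_0\<close>)
    then show ?thesis unfolding h'_def by (rule dderiv_real_eq)
  qed
  have D00: "d0 (d0 ?\<phi>) x = H (fst x) * f' (fst x + snd x) * G (fst x - snd x) + 2 * H (fst x) * f (fst x + snd x) * g (fst x - snd x)
      + H (fst x) * F (fst x + snd x) * g' (fst x - snd x)"
    using smooth_plane_partials(1)[OF smooth_d0[OF sm], of "snd x" "fst x"] unfolding D0 fst_conv snd_conv prod.collapse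
    by (rule DERIV_unique)
      (auto intro!: derivative_eq_intros DERIV_chain2[OF F] DERIV_chain2[OF G] DERIV_chain2[OF H] DERIV_chain2[OF f] DERIV_chain2[OF g] DERIV_chain2[OF h] simp: h0 h'0 algebra_simps)
  have D11: "d1 (d1 ?\<phi>) x = H (fst x) * f' (fst x + snd x) * G (fst x - snd x) - 2 * H (fst x) * f (fst x + snd x) * g (fst x - snd x)
      + H (fst x) * F (fst x + snd x) * g' (fst x - snd x)"
    using smooth_plane_partials(2)[OF smooth_d1[OF sm], of "fst x" "snd x"] unfolding D1 fst_conv snd_conv prod.collapse
    by (rule DERIV_unique)
      (auto intro!: derivative_eq_intros DERIV_chain2[OF F] DERIV_chain2[OF G] DERIV_chain2[OF f] DERIV_chain2[OF g] simp: algebra_simps)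
  have "H (fst x) = tail 1 2 0"
    using assms(3) by (simp add: H_def tail_eq_const)
  then have "wave_op ?\<phi> x = 4 * tail 1 2 0 * f (fst x + snd x) * g (fst x - snd x)"
    unfolding wave_op_def D00 D11 by simp
  then show ?thesis by (simp add: F_def G_def H_def f_def g_def)
qed

lemma compactly_supported_tail_product:
  assumes "p < q" "p' < q'"
  shows "compactly_supported (\<lambda>x. tail 1 2 (- fst x) * tail p q (fst x + snd x) * tail p' q' (fst x - snd x))"
  unfolding compactly_supported_alt
proof (rule bounded_subset)
  \<comment> \<open>From \<open>x0 > -2\<close>, \<open>x0 + x1 < q\<close> and
    \<open>x0 - x1 < q'\<close> follow \<open>x0 < (q + q') / 2\<close>, \<open>x1 < q + 2\<close>
    and \<open>x1 > - q' - 2\<close>.\<close>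
  show "bounded ({-2..\<bar>q\<bar> + \<bar>q'\<bar>} \<times> {-\<bar>q'\<bar>-2..\<bar>q\<bar>+2})"
    by (intro bounded_Times bounded_closed_interval)
  show "{x. tail 1 2 (- fst x) * tail p q (fst x + snd x) * tail p' q' (fst x - snd x) \<noteq> 0} \<subseteq>
      {-2..\<bar>q\<bar> + \<bar>q'\<bar>} \<times> {-\<bar>q'\<bar>-2..\<bar>q\<bar>+2}"
  proof
    fix x assume "x \<in> {x. tail 1 2 (- fst x) * tail p q (fst x + snd x) * tail p' q' (fst x - snd x) \<noteq> 0}"
    then have "- fst x < 2" "fst x + snd x < q" "fst x - snd x < q'"
      using tail_eq_0[of 1 2] tail_eq_0[OF assms(1)] tail_eq_0[OF assms(2)] by (force simp: not_less[symmetric])+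
    then show "x \<in> {-2..\<bar>q\<bar> + \<bar>q'\<bar>} \<times> {-\<bar>q'\<bar>-2..\<bar>q\<bar>+2}"
      by (auto simp: mem_Times_iff)
  qed
qed

text \<open>The limit is asked of the difference alone, at the one point \<open>x\<close> and from
  the quadrant above it, so the conclusion is pointwise and applies to fields that may jump. The
  indicators express that values at \<open>x0 < 0\<close> carry no information.\<close>

lemma weak_wave_cauchy_unique:
  assumes U: "weak_wave_cauchy S U0 U1 U" "loc_bdd (\<lambda>x. indicator ({0..} \<times> UNIV) x * U x)"
    and U': "weak_wave_cauchy S U0 U1 U'" "loc_bdd (\<lambda>x. indicator ({0..} \<times> UNIV) x * U' x)"
    and x: "x \<in> {0..} \<times> UNIV" and lim: "((\<lambda>y. U y - U' y) \<longlongrightarrow> U x - U' x) (at x within quadrant x)"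
  shows "U x = U' x"
proof (rule ccontr)
  assume ne: "U x \<noteq> U' x"
  \<comment> \<open>The sign makes the difference positive at \<open>x\<close>, hence also at the
    points of \<open>quadrant x\<close> near \<open>x\<close>.\<close>
  define D where "D y = sgn (U x - U' x) * (U y - U' y)" for y
  have Dx: "D x > 0" using ne by (auto simp: D_def sgn_if)
  have "(D \<longlongrightarrow> D x) (at x within quadrant x)"
    unfolding D_def[abs_def] by (intro tendsto_intros lim)
  then have "\<forall>\<^sub>F y in at x within quadrant x. D y > 0"
    using Dx by (rule order_tendstoD)
  then obtain d where d: "d > 0" "\<And>y. y \<in> quadrant x \<Longrightarrow> y \<noteq> x \<Longrightarrow> dist y x < d \<Longrightarrow> D y > 0"
    unfolding eventually_at by auto
  define p where "p = fst x + snd x"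
  define p' where "p' = fst x - snd x"
  \<comment> \<open>Sides of length \<open>d / 2\<close> in \<open>u\<close> and \<open>v\<close>
    keep both coordinates within \<open>d / 2\<close> of those of \<open>x\<close>, hence the square
    within distance \<open>d\<close>.\<close>
  define q where "q = p + d / 2"
  define q' where "q' = p' + d / 2"
  have pq: "p < q" "p' < q'" using d by (auto simp: q_def q'_def)
  define \<phi> where "\<phi> = (\<lambda>x::real \<times> real. tail 1 2 (- fst x) * tail p q (fst x + snd x) * tail p' q' (fst x - snd x))"
  have \<phi>: "smooth \<phi>" "compactly_supported \<phi>"
    unfolding \<phi>_def using pq by (simp_all add: smooth_tail_product compactly_supported_tail_product)
  define h where "h y = (indicator ({0..} \<times> UNIV) y * D y) * (bump p q (fst y + snd y) * bump p' q' (fst y - snd y))" for y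
  have pos: "D y > 0" "y \<in> {0..} \<times> UNIV" if "bump p q (fst y + snd y) * bump p' q' (fst y - snd y) \<noteq> 0" for y
  proof -
    have "p < fst y + snd y" "fst y + snd y < q" "p' < fst y - snd y" "fst y - snd y < q'"
      using that bump_eq_0[of "fst y + snd y" p q] bump_eq_0[of "fst y - snd y" p' q'] by fastforce+
    then have *: "fst x + snd x < fst y + snd y" "fst y + snd y < fst x + snd x + d / 2"
      "fst x - snd x < fst y - snd y" "fst y - snd y < fst x - snd x + d / 2"
      by (auto simp: p_def p'_def q_def q'_def)
    then have "\<bar>fst y - fst x\<bar> < d / 2" "\<bar>snd y - snd x\<bar> < d / 2" by linarith+
    then have "dist y x < d"
      using sqrt_sum_squares_le_sum_abs[of "fst y - fst x" "snd y - snd x"] by (auto simp: dist_prod_def dist_real_def)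
    then show "D y > 0" using d(2)[of y] * by (auto simp: quadrant_def)
    show "y \<in> {0..} \<times> UNIV" using * x by (auto simp: mem_Times_iff)
  qed
  have h_nonneg: "h y \<ge> 0" for y
    using pos[of y] by (cases "bump p q (fst y + snd y) * bump p' q' (fst y - snd y) = 0")
      (auto simp: h_def indicator_def bump_nonneg)
  have i: "integrable lborel (\<lambda>y. indicator ({0..} \<times> UNIV) y * U y * wave_op \<phi> y)"
    "integrable lborel (\<lambda>y. indicator ({0..} \<times> UNIV) y * U' y * wave_op \<phi> y)"
    by (intro bdd_supp_integrable bdd_supp_mult U U' bdd_supp_wave_op \<phi>)+
  \<comment> \<open>\<open>c\<close> removes the factor \<open>4 * tail 1 2 0\<close> that
    \<open>wave_op \<phi>\<close> carries on the half-plane and inserts the sign.\<close>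
  define c where "c = sgn (U x - U' x) / (4 * tail 1 2 0)"
  have t0: "tail 1 2 0 \<noteq> 0" using integral_bump_pos[of 1 2] by (simp add: tail_eq_const)
  have h_eq: "h y = c * (indicator ({0..} \<times> UNIV) y * U y * wave_op \<phi> y - indicator ({0..} \<times> UNIV) y * U' y * wave_op \<phi> y)" for y
  proof (cases "y \<in> {0..} \<times> UNIV")
    case True
    then have "wave_op \<phi> y = 4 * tail 1 2 0 * bump p q (fst y + snd y) * bump p' q' (fst y - snd y)"
      unfolding \<phi>_def by (intro wave_op_tail_product pq) auto
    then show ?thesis using True t0 by (simp add: h_def D_def c_def field_simps)
  qed (simp add: h_def)
  have hi: "integrable lborel h"
    unfolding h_eq[abs_def] by (intro integrable_mult_right Bochner_Integration.integrable_diff i)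
  have "(LINT y|lborel. h y) = c * ((LINT y:{0..} \<times> UNIV|lborel. U y * wave_op \<phi> y) - (LINT y:{0..} \<times> UNIV|lborel. U' y * wave_op \<phi> y))"
    unfolding h_eq integral_mult_right_zero Bochner_Integration.integral_diff[OF i] by (simp add: set_lebesgue_integral_def mult.assoc)
  also have "\<dots> = 0"
    using U(1) U'(1) \<phi> unfolding weak_wave_cauchy_def by simp
  finally have "AE y in lborel. h y = 0"
    using integral_nonneg_eq_0_iff_AE[OF hi] h_nonneg by simp
  \<comment> \<open>The square on which both bumps are positive: \<open>h\<close> vanishes almost
    everywhere, yet nowhere on this nonempty open set.\<close>
  moreover define O' where "O' = {y::real \<times> real. p < fst y + snd y \<and> fst y + snd y < q \<and> p' < fst y - snd y \<and> fst y - snd y < q'}"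
  have "h y \<noteq> 0" if "y \<in> O'" for y
  proof -
    have "bump p q (fst y + snd y) > 0" "bump p' q' (fst y - snd y) > 0"
      using that by (auto simp: O'_def bump_pos)
    then have "bump p q (fst y + snd y) * bump p' q' (fst y - snd y) \<noteq> 0" by simp
    from pos[OF this] this show ?thesis by (simp add: h_def)
  qed
  ultimately have "AE y in lborel. y \<notin> O'" by (auto elim: eventually_mono)
  moreover have O': "open O'"
    unfolding O'_def by (intro open_Collect_conj open_Collect_less continuous_intros)
  ultimately have "O' \<in> null_sets lborel"
    using AE_iff_null_sets[of O' lborel] by simp
  then have "negligible O'"
    by (simp add: negligible_iff_null_sets null_sets_completionI)
  moreover have "((q + p + q' + p') / 4, (q + p - q' - p') / 4) \<in> O'"
    using pq by (auto simp: O'_def field_simps)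
  ultimately show False
    using open_not_negligible[OF O'] by blast
qed

lemma (in source) weak_wave_cauchy_explicit:
  assumes F: "continuous_on UNIV F" and G: "continuous_on UNIV G"
    and H: "\<And>y. ((\<lambda>y. F y - G (- y)) has_real_derivative U1 y) (at y)" and U1: "continuous_on UNIV U1"
  shows "weak_wave_cauchy (\<lambda>\<phi>. a * (LINT t|lborel. w t * \<phi> (t, z t))) (\<lambda>y. F y + G (- y)) U1
    (\<lambda>x. F (fst x + snd x) + G (fst x - snd x) + a / 2 * source_field w z x)"
  unfolding weak_wave_cauchy_def
proof (intro allI impI)
  fix \<phi> :: "real \<times> real \<Rightarrow> real" assume "smooth \<phi> \<and> compactly_supported \<phi>"
  then have \<phi>: "smooth \<phi>" "compactly_supported \<phi>" by auto
  have 1: "set_integrable lborel ({0..} \<times> UNIV) (\<lambda>x. (F (fst x + snd x) + G (fst x - snd x)) * wave_op \<phi> x)"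
    unfolding set_integrable_def real_scaleR_def mult.assoc[symmetric]
    by (intro bdd_supp_integrable bdd_supp_mult loc_bdd_mult loc_bdd_indicator half_plane_borel
        loc_bdd_continuous bdd_supp_wave_op \<phi> continuous_on_compose2[OF F] continuous_on_compose2[OF G] continuous_intros; simp)
  have 2: "set_integrable lborel ({0..} \<times> UNIV) (\<lambda>x. a / 2 * (source_field w z x * wave_op \<phi> x))"
    unfolding set_integrable_def real_scaleR_def mult.left_commute[of "indicator _ _"] mult.assoc[symmetric]
    by (intro bdd_supp_integrable bdd_supp_mult loc_bdd_mult loc_bdd_indicator half_plane_borel source_field_loc_bdd
        loc_bdd_continuous bdd_supp_wave_op \<phi> continuous_intros)
  have "(LINT x:{0..} \<times> UNIV|lborel. (F (fst x + snd x) + G (fst x - snd x) + a / 2 * source_field w z x) * wave_op \<phi> x)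
      = (LINT x:{0..} \<times> UNIV|lborel. (F (fst x + snd x) + G (fst x - snd x)) * wave_op \<phi> x + a / 2 * (source_field w z x * wave_op \<phi> x))"
    by (simp add: algebra_simps)
  also have "\<dots> = (LINT x:{0..} \<times> UNIV|lborel. (F (fst x + snd x) + G (fst x - snd x)) * wave_op \<phi> x)
      + a / 2 * (LINT x:{0..} \<times> UNIV|lborel. source_field w z x * wave_op \<phi> x)"
    unfolding set_integral_add(2)[OF 1 2] by simp
  also have "\<dots> = a * (LINT t|lborel. w t * \<phi> (t, z t)) + (LINT y|lborel. U1 y * \<phi> (0, y)) - (LINT y|lborel. (F y + G (- y)) * d0 \<phi> (0, y))"
    unfolding weak_free_wave[OF F G H U1 \<phi>] weak_source[OF \<phi>] by simp
  finally show "(LINT x:{0..} \<times> UNIV|lborel. (F (fst x + snd x) + G (fst x - snd x) + a / 2 * source_field w z x) * wave_op \<phi> x)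
      = a * (LINT t|lborel. w t * \<phi> (t, z t)) + (LINT y|lborel. U1 y * \<phi> (0, y)) - (LINT y|lborel. (F y + G (- y)) * d0 \<phi> (0, y))" .
qed

section \<open>The free field\<close>

lemma continuous_has_antiderivative:
  fixes f :: "real \<Rightarrow> real"
  assumes "continuous_on UNIV f"
  obtains F where "\<And>x. (F has_real_derivative f x) (at x)"
proof
  fix x
  have "((\<lambda>u. LBINT y=ereal 0..ereal u. f y) has_vector_derivative (f x)) (at x within {-\<bar>x\<bar>-1..\<bar>x\<bar>+1})"
    by (rule interval_integral_FTC2) (auto intro: continuous_on_subset[OF assms])
  moreover have "at x within {-\<bar>x\<bar>-1..\<bar>x\<bar>+1} = at x"
    by (rule at_within_interior) (simp; linarith)
  ultimately show "((\<lambda>u. LBINT y=ereal 0..ereal u. f y) has_real_derivative f x) (at x)"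
    by (simp only: has_real_derivative_iff_has_vector_derivative)
qed

context
  fixes V0 V1 :: "real \<Rightarrow> real" and V :: "real \<times> real \<Rightarrow> real"
  assumes free: "free_wave V0 V1 V"
begin

lemma free_smooth: "smooth V"
  and free_wave_eq: "d0 (d0 V) x = d1 (d1 V) x"
  and free_init: "V (0, y) = V0 y" "d0 V (0, y) = V1 y"
  using free unfolding free_wave_def wave_op_def by (auto simp del: split_paired_All)

text \<open>\<open>d0 V + d1 V\<close> is annihilated by \<open>\<partial>_0 - \<partial>_1\<close>
  and \<open>d0 V - d1 V\<close> by \<open>\<partial>_0 + \<partial>_1\<close>, so each is constant
  along its characteristics and can be read off from the data.\<close>

lemma free_characteristics:
  "d0 V x + d1 V x = V1 (fst x + snd x) + dderiv 1 V0 (fst x + snd x)"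
  "d0 V x - d1 V x = V1 (snd x - fst x) - dderiv 1 V0 (snd x - fst x)"
proof -
  have V0': "d1 V (0, y) = dderiv 1 V0 y" for y
    using smooth_plane_partials(2)[OF free_smooth, of 0 y] by (simp add: free_init dderiv_real_eq)
  note chain = smooth_plane_chain[OF smooth_d0[OF free_smooth]] smooth_plane_chain[OF smooth_d1[OF free_smooth]]
  define c where "c = fst x + snd x"
  define gc where "gc s = d0 V (s, c - s) + d1 V (s, c - s)" for s
  have "(gc has_real_derivative 0) (at s)" for s
    unfolding gc_def
    by (rule DERIV_cong[OF DERIV_add[OF chain(1)[of _ 1 _ _ _ "-1"] chain(2)[of _ 1 _ _ _ "-1"]]])
      (auto intro!: derivative_eq_intros simp: free_wave_eq d0_d1_commute[OF free_smooth])
  then have "gc (fst x) = gc 0"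
    using DERIV_isconst_all by blast
  then show "d0 V x + d1 V x = V1 (fst x + snd x) + dderiv 1 V0 (fst x + snd x)"
    by (simp add: gc_def c_def free_init V0')
  define b where "b = snd x - fst x"
  define gb where "gb s = d0 V (s, b + s) - d1 V (s, b + s)" for s
  have "(gb has_real_derivative 0) (at s)" for s
    unfolding gb_def
    by (rule DERIV_cong[OF DERIV_diff[OF chain(1)[of _ 1 _ _ _ 1] chain(2)[of _ 1 _ _ _ 1]]])
      (auto intro!: derivative_eq_intros simp: free_wave_eq d0_d1_commute[OF free_smooth])
  then have "gb (fst x) = gb 0"
    using DERIV_isconst_all by blast
  then show "d0 V x - d1 V x = V1 (snd x - fst x) - dderiv 1 V0 (snd x - fst x)"
    by (simp add: gb_def b_def free_init V0')
qed

lemma free_d0: "d0 V x = (V1 (fst x + snd x) + dderiv 1 V0 (fst x + snd x) + V1 (snd x - fst x) - dderiv 1 V0 (snd x - fst x)) / 2"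
  and free_d1: "d1 V x = (V1 (fst x + snd x) + dderiv 1 V0 (fst x + snd x) - V1 (snd x - fst x) + dderiv 1 V0 (snd x - fst x)) / 2"
  using free_characteristics[of x] by simp_all

lemma dalembert:
  assumes "smooth V0" and I: "\<And>y. (I has_real_derivative V1 y) (at y)"
  shows "V x = (V0 (fst x + snd x) + I (fst x + snd x)) / 2 + (V0 (snd x - fst x) - I (snd x - fst x)) / 2"
proof -
  define E where "E s = V (s, snd x) - (V0 (s + snd x) + I (s + snd x)) / 2 - (V0 (snd x - s) - I (snd x - s)) / 2" for s
  have "(E has_real_derivative 0) (at s)" for s
    unfolding E_def
    by (auto intro!: derivative_eq_intros smooth_plane_partials(1)[OF free_smooth] DERIV_chain2[OF smooth_real_deriv[OF assms(1)]] DERIV_chain2[OF I]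
        simp: free_d0 field_simps)
  then have "E (fst x) = E 0" using DERIV_isconst_all by blast
  then show ?thesis by (simp add: E_def free_init field_simps)
qed

text \<open>In d'Alembert's formula the antiderivative enters as half the integral of
  \<open>V1\<close> over an interval, at most half the \<open>L^1\<close> norm; this is the
  combination of norms in the smallness assumption.\<close>

lemma free_bound:
  assumes V0: "smooth V0" and V1: "smooth V1" "compactly_supported V1" and B: "\<And>y. \<bar>V0 y\<bar> \<le> B"
  shows "\<bar>V x\<bar> \<le> B + 1 / 2 * (LINT y|lborel. \<bar>V1 y\<bar>)"
proof -
  have c: "continuous_on UNIV V1" by (rule smooth_real_continuous[OF V1(1)])
  then obtain I where I: "\<And>x. (I has_real_derivative V1 x) (at x)"
    using continuous_has_antiderivative by blast
  have "bdd_supp V1"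
    using V1 c by (simp add: bdd_supp_def loc_bdd_continuous compactly_supported_alt)
  then have int: "integrable lborel (\<lambda>y. \<bar>V1 y\<bar>)"
    by (intro integrable_abs bdd_supp_integrable)
  have le: "\<bar>I r - I l\<bar> \<le> (LINT y|lborel. \<bar>V1 y\<bar>)" if "l \<le> r" for l r
  proof -
    have i: "integrable lborel (\<lambda>y. V1 y * indicator {l..r} y)"
      using \<open>bdd_supp V1\<close>
      by (subst mult.commute) (intro bdd_supp_integrable bdd_supp_mult loc_bdd_indicator; simp)
    have "I r - I l = (LINT y|lborel. V1 y * indicator {l..r} y)"
      using integral_FTC_Icc_real[of l r I V1] that I c by (simp add: continuous_on_eq_continuous_at)
    also have "\<bar>\<dots>\<bar> \<le> (LINT y|lborel. \<bar>V1 y * indicator {l..r} y\<bar>)"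
      by (rule integral_abs_bound)
    also have "\<dots> \<le> (LINT y|lborel. \<bar>V1 y\<bar>)"
      by (rule integral_mono[OF integrable_abs[OF i] int]) (auto simp: indicator_def)
    finally show ?thesis .
  qed
  have I_le: "\<bar>I (fst x + snd x) - I (snd x - fst x)\<bar> \<le> (LINT y|lborel. \<bar>V1 y\<bar>)"
    using le[of "fst x + snd x" "snd x - fst x"] le[of "snd x - fst x" "fst x + snd x"] by (cases "fst x \<ge> 0") auto
  have half_sum: "\<bar>(p + i) / 2 + (q - j) / 2\<bar> \<le> B + 1 / 2 * J" if "\<bar>i - j\<bar> \<le> J" "\<bar>p\<bar> \<le> B" "\<bar>q\<bar> \<le> B" for p q i j J :: real
    using that by argo
  show ?thesis
    unfolding dalembert[OF V0 I] by (rule half_sum[OF I_le B B])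
qed

end

text \<open>An essential bound of a continuous function holds everywhere, since a nonempty open
  superlevel set has positive measure. The bound on the mass along the world-line needs it
  pointwise.\<close>

lemma continuous_le_esssup:
  fixes f :: "real \<Rightarrow> real"
  assumes "continuous_on UNIV f" "esssup lborel (\<lambda>y. ereal (f y)) = ereal e"
  shows "f y \<le> e"
proof (rule ccontr)
  assume "\<not> f y \<le> e"
  then have "y \<in> f -` {e<..}" by simp
  then have ne: "f -` {e<..} \<noteq> {}" by blast
  have op: "open (f -` {e<..})"
    by (rule open_vimage[OF _ assms(1)]) simp
  have "AE y in lborel. ereal (f y) \<le> ereal e"
    using esssup_AE[of "\<lambda>y. ereal (f y)" lborel] assms(2) by simp
  then have "AE y in lborel. y \<notin> f -` {e<..}" by (auto elim: eventually_mono)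
  then have "f -` {e<..} \<in> null_sets lborel"
    using AE_iff_null_sets[of "f -` {e<..}" lborel] op by simp
  then show False
    using open_not_negligible[OF op ne] by (simp add: negligible_iff_null_sets null_sets_completionI)
qed

lemma esssup_abs_nonneg:
  fixes f :: "real \<Rightarrow> real"
  shows "esssup lborel (\<lambda>y. ereal \<bar>f y\<bar>) \<ge> 0"
proof (rule ccontr)
  assume "\<not> 0 \<le> esssup lborel (\<lambda>y. ereal \<bar>f y\<bar>)"
  then have "AE y in (lborel :: real measure). False"
    using esssup_AE[of "\<lambda>y. ereal \<bar>f y\<bar>" lborel]
    by (elim eventually_mono) (metis abs_ge_zero ereal_less_eq(5) order_trans)
  then show False
    by (simp add: eventually_False ae_filter_eq_bot_iff)
qed

lemma small_data_bound:
  assumes "a \<noteq> 0" "free_wave V0 V1 V" "smooth V0" "smooth V1" "compactly_supported V1"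
    and small: "esssup lborel (\<lambda>y. ereal \<bar>V0 y\<bar>) + ereal (1 / 2 * (LINT y|lborel. \<bar>V1 y\<bar>)) < ereal (mb / \<bar>a\<bar>)"
  obtains b where "b < mb" "\<And>x. \<bar>a * V x\<bar> \<le> b"
proof -
  \<comment> \<open>Smallness excludes the value infinity, nonnegativity excludes minus
    infinity.\<close>
  obtain e where e: "esssup lborel (\<lambda>y. ereal \<bar>V0 y\<bar>) = ereal e"
    using small esssup_abs_nonneg[of V0] by (cases "esssup lborel (\<lambda>y. ereal \<bar>V0 y\<bar>)") auto
  have "continuous_on UNIV (\<lambda>y. \<bar>V0 y\<bar>)"
    by (intro continuous_intros smooth_real_continuous assms)
  then have "\<bar>V0 y\<bar> \<le> e" for y
    using e by (rule continuous_le_esssup)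
  then have V: "\<bar>V x\<bar> \<le> e + 1 / 2 * (LINT y|lborel. \<bar>V1 y\<bar>)" for x
    by (rule free_bound[OF assms(2-5)])
  show ?thesis
  proof
    show "\<bar>a\<bar> * (e + 1 / 2 * (LINT y|lborel. \<bar>V1 y\<bar>)) < mb"
      using small assms(1) by (simp add: e field_simps)
    show "\<bar>a * V x\<bar> \<le> \<bar>a\<bar> * (e + 1 / 2 * (LINT y|lborel. \<bar>V1 y\<bar>))" for x
      unfolding abs_mult by (intro mult_left_mono V) auto
  qed
qed

section \<open>The field of a Lipschitz world-line\<close>

text \<open>The Cauchy criterion for difference quotients; rational increments suffice because
  \<open>f\<close> is continuous. The quantifiers range over countable sets, so the points of
  differentiability form a Borel set.\<close>

lemma differentiable_iff_rational_quotients: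
  fixes f :: "real \<Rightarrow> real"
  assumes cont: "continuous_on UNIV f"
  shows "(\<exists>l. (f has_real_derivative l) (at t)) \<longleftrightarrow>
    (\<forall>n::nat. \<exists>m::nat. \<forall>r s::rat. r \<noteq> 0 \<and> \<bar>of_rat r\<bar> < 1 / real (Suc m) \<and> s \<noteq> 0 \<and> \<bar>of_rat s\<bar> < 1 / real (Suc m) \<longrightarrow>
      \<bar>(f (t + of_rat r) - f t) / of_rat r - (f (t + of_rat s) - f t) / of_rat s\<bar> \<le> 1 / real (Suc n))"
    (is "?L \<longleftrightarrow> ?R")
proof
  assume ?L
  then obtain l where l: "((\<lambda>h. (f (t + h) - f t) / h) \<longlongrightarrow> l) (at 0)"
    by (auto simp: DERIV_def)
  show ?R
  proof
    fix n :: nat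
    have "1 / real (Suc n) / 2 > 0" by simp
    then obtain d where d: "d > 0" "\<And>h. h \<noteq> 0 \<Longrightarrow> \<bar>h\<bar> < d \<Longrightarrow> \<bar>(f (t + h) - f t) / h - l\<bar> < 1 / real (Suc n) / 2"
      using l unfolding Lim_at dist_real_def by (metis abs_0_eq abs_of_pos diff_zero zero_less_abs_iff)
    obtain m where m: "1 / real (Suc m) < d"
      using nat_approx_posE[OF d(1)] by blast
    have "\<bar>(f (t + of_rat r) - f t) / of_rat r - (f (t + of_rat s) - f t) / of_rat s\<bar> \<le> 1 / real (Suc n)"
      if "r \<noteq> 0 \<and> \<bar>of_rat r\<bar> < 1 / real (Suc m) \<and> s \<noteq> 0 \<and> \<bar>of_rat s\<bar> < 1 / real (Suc m)" for r s :: rat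
    proof -
      have "\<bar>of_rat r\<bar> < d" "\<bar>of_rat s\<bar> < d" using that m by linarith+
      moreover have "of_rat r \<noteq> (0::real)" "of_rat s \<noteq> (0::real)" using that by simp_all
      ultimately have "\<bar>(f (t + of_rat r) - f t) / of_rat r - l\<bar> < 1 / real (Suc n) / 2"
        "\<bar>(f (t + of_rat s) - f t) / of_rat s - l\<bar> < 1 / real (Suc n) / 2"
        using d(2) by blast+
      then show ?thesis by (simp only: abs_less_iff abs_le_iff; linarith)
    qed
    then show "\<exists>m::nat. \<forall>r s::rat. r \<noteq> 0 \<and> \<bar>of_rat r\<bar> < 1 / real (Suc m) \<and> s \<noteq> 0 \<and> \<bar>of_rat s\<bar> < 1 / real (Suc m) \<longrightarrow>
      \<bar>(f (t + of_rat r) - f t) / of_rat r - (f (t + of_rat s) - f t) / of_rat s\<bar> \<le> 1 / real (Suc n)"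
      by blast
  qed
next
  assume R: ?R
  define q where "q h = (f (t + h) - f t) / h" for h
  have R': "\<exists>d>0. \<forall>h k. h \<noteq> 0 \<and> \<bar>h\<bar> < d \<and> k \<noteq> 0 \<and> \<bar>k\<bar> < d \<longrightarrow> \<bar>q h - q k\<bar> \<le> e" if e: "e > 0" for e
  proof -
    obtain n where n: "1 / real (Suc n) < e" using nat_approx_posE[OF e] by blast
    obtain m where m: "\<And>r s::rat. r \<noteq> 0 \<Longrightarrow> \<bar>of_rat r\<bar> < 1 / real (Suc m) \<Longrightarrow> s \<noteq> 0 \<Longrightarrow> \<bar>of_rat s\<bar> < 1 / real (Suc m) \<Longrightarrow>
        \<bar>q (of_rat r) - q (of_rat s)\<bar> \<le> 1 / real (Suc n)"
      using R unfolding q_def by blast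
    define d where "d = 1 / real (Suc m)"
    have d: "d > 0" by (simp add: d_def)
    have seq: "\<exists>r. (\<forall>i. r i \<noteq> 0 \<and> \<bar>of_rat (r i)\<bar> < d) \<and> (\<lambda>i. q (of_rat (r i))) \<longlonglongrightarrow> q h"
      if h: "h \<noteq> 0" "\<bar>h\<bar> < d" for h
    proof -
      \<comment> \<open>The rationals approach the modulus of \<open>h\<close> from below and stay
        positive, so the quotients make sense and the increments remain under \<open>d\<close>; the
        sign is put back in \<open>r'\<close>.\<close>
      have "\<exists>r::rat. \<bar>h\<bar> - min (\<bar>h\<bar>) (1 / real (Suc i)) < of_rat r \<and> of_rat r < \<bar>h\<bar>" for i
        using h by (intro of_rat_dense) auto
      then obtain r :: "nat \<Rightarrow> rat" where r: "\<And>i. \<bar>h\<bar> - min (\<bar>h\<bar>) (1 / real (Suc i)) < of_rat (r i)" "\<And>i. of_rat (r i) < \<bar>h\<bar>"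
        by metis
      have pos: "of_rat (r i) > (0::real)" for i
        using r(1)[of i] by linarith
      have lim: "(\<lambda>i. of_rat (r i)) \<longlonglongrightarrow> \<bar>h\<bar>"
      proof (rule tendsto_sandwich)
        show "(\<lambda>i. \<bar>h\<bar> - inverse (real (Suc i))) \<longlonglongrightarrow> \<bar>h\<bar>"
          using tendsto_diff[OF tendsto_const LIMSEQ_inverse_real_of_nat, of "\<bar>h\<bar>"] by simp
        show "\<forall>\<^sub>F i in sequentially. \<bar>h\<bar> - inverse (real (Suc i)) \<le> of_rat (r i)"
          using r(1) by (intro always_eventually allI) (smt (verit, best) inverse_eq_divide)
        show "\<forall>\<^sub>F i in sequentially. of_rat (r i) \<le> \<bar>h\<bar>"
          using r(2) by (intro always_eventually allI) (simp add: less_imp_le)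
      qed auto
      define r' where "r' i = (if h > 0 then r i else - r i)" for i
      have lim': "(\<lambda>i. of_rat (r' i)) \<longlonglongrightarrow> h"
      proof (cases "h > 0")
        case True
        then show ?thesis using lim by (simp add: r'_def)
      next
        case False
        then show ?thesis using tendsto_minus[OF lim] by (simp add: r'_def of_rat_minus)
      qed
      have "isCont f (t + h)"
        using cont by (simp add: continuous_on_eq_continuous_at)
      then have "(\<lambda>i. q (of_rat (r' i))) \<longlonglongrightarrow> q h"
        unfolding q_def using h by (intro tendsto_intros isCont_tendsto_compose[of _ f] lim') auto
      moreover have "r' i \<noteq> 0 \<and> \<bar>of_rat (r' i)\<bar> < d" for i
        using pos[of i] r(2)[of i] h by (auto simp: r'_def of_rat_minus)
      ultimately show ?thesis by blast
    qed
    have "\<bar>q h - q k\<bar> \<le> e" if hk: "h \<noteq> 0" "\<bar>h\<bar> < d" "k \<noteq> 0" "\<bar>k\<bar> < d" for h k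
    proof -
      obtain r where r: "\<And>i. r i \<noteq> 0" "\<And>i. \<bar>of_rat (r i)\<bar> < d" "(\<lambda>i. q (of_rat (r i))) \<longlonglongrightarrow> q h" using seq[OF hk(1,2)] by blast
      obtain s where s: "\<And>i. s i \<noteq> 0" "\<And>i. \<bar>of_rat (s i)\<bar> < d" "(\<lambda>i. q (of_rat (s i))) \<longlonglongrightarrow> q k" using seq[OF hk(3,4)] by blast
      have "(\<lambda>i. \<bar>q (of_rat (r i)) - q (of_rat (s i))\<bar>) \<longlonglongrightarrow> \<bar>q h - q k\<bar>"
        by (intro tendsto_intros r s)
      then have "\<bar>q h - q k\<bar> \<le> 1 / real (Suc n)"
        by (rule LIMSEQ_le_const2) (use m r s in \<open>auto simp: d_def\<close>)
      then show ?thesis using n by simp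
    qed
    then show ?thesis using d by blast
  qed
  define x where "x i = q (inverse (real (Suc i)))" for i
  have ev: "\<forall>\<^sub>F i in sequentially. inverse (real (Suc i)) < d" if "d > 0" for d
    using order_tendstoD(2)[OF LIMSEQ_inverse_real_of_nat that] .
  have "Cauchy x"
    unfolding Cauchy_altdef2
  proof (intro allI impI)
    fix e :: real assume "e > 0"
    then obtain d where d: "d > 0" "\<And>h k. h \<noteq> 0 \<and> \<bar>h\<bar> < d \<and> k \<noteq> 0 \<and> \<bar>k\<bar> < d \<Longrightarrow> \<bar>q h - q k\<bar> \<le> e / 2"
      using R'[of "e / 2"] by auto
    obtain N where N: "\<And>i. i \<ge> N \<Longrightarrow> inverse (real (Suc i)) < d"
      using ev[OF d(1)] by (auto simp: eventually_sequentially)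
    have "dist (x i) (x N) < e" if "i \<ge> N" for i
      using d(2)[of "inverse (real (Suc i))" "inverse (real (Suc N))"] N[OF that] N[of N] \<open>e > 0\<close>
      by (simp add: x_def dist_real_def)
    then show "\<exists>N. \<forall>n\<ge>N. dist (x n) (x N) < e" by blast
  qed
  then obtain l where l: "x \<longlonglongrightarrow> l"
    using Cauchy_convergent_iff convergent_def by blast
  have "(q \<longlongrightarrow> l) (at 0)"
    unfolding Lim_at
  proof (intro allI impI)
    fix e :: real assume "e > 0"
    then obtain d where d: "d > 0" "\<And>h k. h \<noteq> 0 \<and> \<bar>h\<bar> < d \<and> k \<noteq> 0 \<and> \<bar>k\<bar> < d \<Longrightarrow> \<bar>q h - q k\<bar> \<le> e / 2"
      using R'[of "e / 2"] by auto
    have "\<bar>q h - l\<bar> \<le> e / 2" if "h \<noteq> 0" "\<bar>h\<bar> < d" for h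
    proof (rule tendsto_le[OF sequentially_bot tendsto_const])
      show "(\<lambda>i. \<bar>q h - x i\<bar>) \<longlonglongrightarrow> \<bar>q h - l\<bar>" by (intro tendsto_intros l)
      show "\<forall>\<^sub>F i in sequentially. \<bar>q h - x i\<bar> \<le> e / 2"
        using ev[OF d(1)] by eventually_elim (use that d(2) in \<open>auto simp: x_def\<close>)
    qed
    then show "\<exists>d>0. \<forall>x. 0 < dist x 0 \<and> dist x 0 < d \<longrightarrow> dist (q x) l < e"
      using d(1) \<open>e > 0\<close> by (intro exI[of _ d]) (force simp: dist_real_def)
  qed
  then show ?L
    by (auto simp: DERIV_def q_def[abs_def])
qed

text \<open>Where the derivative exists it is a sequential limit of difference quotients. Elsewhere
  \<open>vector_derivative\<close> is a choice from the predicate that is false everywhere, hence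
  one fixed constant.\<close>

lemma borel_measurable_vector_derivative:
  fixes f :: "real \<Rightarrow> real"
  assumes cont: "continuous_on UNIV f"
  shows "(\<lambda>t. vector_derivative f (at t)) \<in> borel_measurable borel"
proof -
  define D where "D = {t. \<exists>l. (f has_real_derivative l) (at t)}"
  have [measurable]: "f \<in> borel_measurable borel"
    using cont by (rule borel_measurable_continuous_onI)
  have [measurable]: "D \<in> sets borel"
    unfolding D_def differentiable_iff_rational_quotients[OF cont] by measurable
  define q where "q i t = (f (t + inverse (real (Suc i))) - f t) / inverse (real (Suc i))" for i t
  have q [measurable]: "q i \<in> borel_measurable borel" for i
    unfolding q_def[abs_def] by measurable
  have "vector_derivative f (at t) = (if t \<in> D then lim (\<lambda>i. q i t) else (SOME l. False))" for t
  proof (cases "t \<in> D")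
    case True
    then obtain l where l: "(f has_real_derivative l) (at t)" by (auto simp: D_def)
    then have "((\<lambda>h. (f (t + h) - f t) / h) \<longlongrightarrow> l) (at 0)" by (simp add: DERIV_def)
    moreover have "filterlim (\<lambda>i. inverse (real (Suc i))) (at 0) sequentially"
      using LIMSEQ_inverse_real_of_nat by (auto simp: filterlim_at)
    ultimately have "(\<lambda>i. q i t) \<longlonglongrightarrow> l"
      unfolding q_def by (rule filterlim_compose)
    then have "lim (\<lambda>i. q i t) = l" by (rule limI)
    moreover have "vector_derivative f (at t) = l"
      using l by (intro vector_derivative_at) (simp add: has_real_derivative_iff_has_vector_derivative)
    ultimately show ?thesis using True by simp
  next
    case False
    then show ?thesis
      by (simp add: vector_derivative_def D_def has_real_derivative_iff_has_vector_derivative)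
  qed
  then have "(\<lambda>t. vector_derivative f (at t)) = (\<lambda>t. if t \<in> D then lim (\<lambda>i. q i t) else (SOME l. False))"
    by blast
  moreover have "(\<lambda>t. if t \<in> D then lim (\<lambda>i. q i t) else (SOME l. False)) \<in> borel_measurable borel"
    by measurable
  ultimately show ?thesis by simp
qed

lemma at_within_Ici_neq_bot:
  assumes "a \<le> t"
  shows "at t within {a..} \<noteq> (bot :: real filter)"
proof -
  have "{t<..} \<subseteq> {a..}" using assms by auto
  then have "at_right t \<le> at t within {a..}" by (rule at_le)
  then show ?thesis using trivial_limit_at_right_real[of t] by (auto simp: bot_unique)
qed

section \<open>Proper time and the field of a causal world-line\<close>

definition proper_rate :: "(real \<Rightarrow> real) \<Rightarrow> real \<Rightarrow> real" where
  "proper_rate z t = indicator {0..} t * sqrt (1 - (velocity z t)\<^sup>2)"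

text \<open>The second term is d'Alembert's solution for the static data
  \<open>- (a / 2) |y|\<close>. The argument \<open>max 0 t\<close> continues the world-line to
  negative times, where the weight vanishes.\<close>

definition full_field :: "real \<Rightarrow> (real \<times> real \<Rightarrow> real) \<Rightarrow> (real \<Rightarrow> real) \<Rightarrow> real \<times> real \<Rightarrow> real" where
  "full_field a V z x = V x - a / 4 * (\<bar>fst x + snd x\<bar> + \<bar>fst x - snd x\<bar>)
     + a / 2 * source_field (proper_rate z) (\<lambda>t. z (max 0 t)) x"

text \<open>The square root is monotone on all reals, with negative values at negative arguments, so
  the bound holds even where \<open>velocity\<close> is unspecified.\<close>

lemma proper_rate_le_1: "proper_rate z t \<le> 1"
  by (simp add: proper_rate_def indicator_def)

locale worldline =
  fixes z :: "real \<Rightarrow> real"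
  assumes start: "z 0 = 0" and lipschitz: "1-lipschitz_on {0..} z"
begin

lemma cont: "continuous_on {0..} z"
  using lipschitz by (rule lipschitz_on_continuous_on)

lemma cont_ext: "continuous_on UNIV (\<lambda>t. z (max 0 t))"
  by (rule continuous_on_compose2[OF cont]) (auto intro!: continuous_intros)

lemma dist_le: "0 \<le> s \<Longrightarrow> 0 \<le> t \<Longrightarrow> \<bar>z t - z s\<bar> \<le> \<bar>t - s\<bar>"
  using lipschitz_onD[OF lipschitz, of t s] by (simp add: dist_real_def)

text \<open>For positive times only: at 0 the constant continuation may have a kink although
  \<open>z\<close> has a one-sided derivative there.\<close>

lemma velocity_eq:
  assumes "t > 0"
  shows "velocity z t = vector_derivative (\<lambda>t. z (max 0 t)) (at t)"
proof -
  have "at t within {0..} = at t"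
    using assms by (intro at_within_interior) simp
  moreover have "(z has_vector_derivative l) (at t) \<longleftrightarrow> ((\<lambda>t. z (max 0 t)) has_vector_derivative l) (at t)" for l
  proof
    assume "(z has_vector_derivative l) (at t)"
    then show "((\<lambda>t. z (max 0 t)) has_vector_derivative l) (at t)"
      by (rule has_vector_derivative_transform_within_open[where S = "{0<..}"]) (use assms in auto)
  next
    assume "((\<lambda>t. z (max 0 t)) has_vector_derivative l) (at t)"
    then show "(z has_vector_derivative l) (at t)"
      by (rule has_vector_derivative_transform_within_open[where S = "{0<..}"]) (use assms in auto)
  qed
  ultimately show ?thesis
    by (simp add: velocity_def vector_derivative_def)
qed

lemma proper_rate_borel: "proper_rate z \<in> borel_measurable borel"
proof -
  note [measurable] = borel_measurable_vector_derivative[OF cont_ext]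
  have "proper_rate z = (\<lambda>t. if t = 0 then proper_rate z 0 else
      indicator {0..} t * sqrt (1 - (vector_derivative (\<lambda>t. z (max 0 t)) (at t))\<^sup>2))"
    by (auto simp: fun_eq_iff proper_rate_def indicator_def velocity_eq)
  also have "\<dots> \<in> borel_measurable borel"
    by measurable
  finally show ?thesis .
qed

lemma velocity_bound:
  assumes "(z has_vector_derivative l) (at t within {0..})" "t \<ge> 0"
  shows "\<bar>l\<bar> \<le> 1"
proof -
  have lim: "((\<lambda>s. (z s - z t) / (s - t)) \<longlongrightarrow> l) (at t within {0..})"
    using assms(1) by (simp add: has_real_derivative_iff_has_vector_derivative[symmetric] has_field_derivative_iff)
  have "\<forall>\<^sub>F s in at t within {0..}. \<bar>(z s - z t) / (s - t)\<bar> \<le> 1"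
    unfolding eventually_at_filter using dist_le[OF assms(2)]
    by (intro always_eventually) (auto simp: divide_le_eq_1)
  moreover have "at t within {0..} \<noteq> bot"
    using assms(2) by (rule at_within_Ici_neq_bot)
  ultimately show ?thesis
    using tendsto_upperbound[OF tendsto_rabs[OF lim]] by blast
qed

lemma source_proper_rate: "\<exists>W. source (proper_rate z) (\<lambda>t. z (max 0 t)) W"
proof
  \<comment> \<open>the value of \<open>velocity\<close> where \<open>z\<close> is not differentiable; nothing is known about it\<close>
  define c where "c = (SOME l::real. False)"
  show "source (proper_rate z) (\<lambda>t. z (max 0 t)) (max 1 \<bar>sqrt (1 - c\<^sup>2)\<bar>)"
  proof
    show "proper_rate z \<in> borel_measurable borel" by (rule proper_rate_borel)
    show "(\<lambda>t. z (max 0 t)) \<in> borel_measurable borel"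
      by (rule borel_measurable_continuous_onI[OF cont_ext])
    show "proper_rate z t = 0" if "t < 0" for t using that by (simp add: proper_rate_def)
    show "\<bar>proper_rate z t\<bar> \<le> max 1 \<bar>sqrt (1 - c\<^sup>2)\<bar>" for t
    proof (cases "t \<ge> 0 \<and> (\<exists>l. (z has_vector_derivative l) (at t within {0..}))")
      case True
      then have "(z has_vector_derivative velocity z t) (at t within {0..})"
        unfolding velocity_def vector_derivative_def by (metis someI_ex)
      then have "\<bar>velocity z t\<bar> \<le> 1"
        using velocity_bound True by blast
      then have "(velocity z t)\<^sup>2 \<le> 1" by (simp add: abs_square_le_1)
      then have "\<bar>proper_rate z t\<bar> \<le> 1" by (simp add: proper_rate_def indicator_def)
      then show ?thesis by simp
    next
      case False
      then have "t < 0 \<or> velocity z t = c"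
        by (auto simp: velocity_def vector_derivative_def c_def)
      then show ?thesis by (auto simp: proper_rate_def indicator_def)
    qed
  qed
qed

lemma full_field_weak:
  assumes V: "free_wave V0 V1 V" "smooth V0" "smooth V1"
  shows "weak_wave_cauchy (\<lambda>\<phi>. a * worldline_delta z \<phi>) (\<lambda>y. - (a / 2) * \<bar>y\<bar> + V0 y) V1 (full_field a V z)"
proof -
  obtain W where W: "source (proper_rate z) (\<lambda>t. z (max 0 t)) W"
    using source_proper_rate by blast
  obtain I where I: "\<And>x. (I has_real_derivative V1 x) (at x)"
    using continuous_has_antiderivative[OF smooth_real_continuous[OF V(3)]] by blast
  have cI: "continuous_on UNIV I"
    using I by (meson DERIV_isCont continuous_at_imp_continuous_on)
  have cV: "continuous_on UNIV V0" by (rule smooth_real_continuous[OF V(2)])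
  \<comment> \<open>d'Alembert's formula split into its two movers, with half of the static field in
    each. The moduli cancel in \<open>F y - G (- y)\<close>, which is the antiderivative
    \<open>I\<close>.\<close>
  define F where "F u = (V0 u + I u) / 2 - a / 4 * \<bar>u\<bar>" for u
  define G where "G v = (V0 (- v) - I (- v)) / 2 - a / 4 * \<bar>v\<bar>" for v
  have "weak_wave_cauchy (\<lambda>\<phi>. a * (LINT t|lborel. proper_rate z t * \<phi> (t, z (max 0 t)))) (\<lambda>y. F y + G (- y)) V1
    (\<lambda>x. F (fst x + snd x) + G (fst x - snd x) + a / 2 * source_field (proper_rate z) (\<lambda>t. z (max 0 t)) x)"
  proof (rule source.weak_wave_cauchy_explicit[OF W])
    show "continuous_on UNIV F" unfolding F_def by (intro continuous_intros cI cV) auto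
    show "continuous_on UNIV G" unfolding G_def
      by (intro continuous_intros continuous_on_compose2[OF cI] continuous_on_compose2[OF cV]) auto
    have "(\<lambda>y. F y - G (- y)) = I" by (auto simp: F_def G_def field_simps)
    then show "((\<lambda>y. F y - G (- y)) has_real_derivative V1 y) (at y)" for y
      using I by simp
  qed (rule smooth_real_continuous[OF V(3)])
  moreover have "(LINT t|lborel. proper_rate z t * \<phi> (t, z (max 0 t))) = worldline_delta z \<phi>" for \<phi>
    unfolding worldline_delta_def set_lebesgue_integral_def
    by (rule Bochner_Integration.integral_cong) (auto simp: proper_rate_def indicator_def)
  moreover have "(\<lambda>y. F y + G (- y)) = (\<lambda>y. - (a / 2) * \<bar>y\<bar> + V0 y)"
    by (auto simp: F_def G_def field_simps)
  moreover have "(\<lambda>x. F (fst x + snd x) + G (fst x - snd x) + a / 2 * source_field (proper_rate z) (\<lambda>t. z (max 0 t)) x) = full_field a V z"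
    by (auto simp: F_def G_def full_field_def dalembert[OF V(1,2) I] algebra_simps)
  ultimately show ?thesis by simp
qed

lemma full_field_unique:
  assumes V: "free_wave V0 V1 V" "smooth V0" "smooth V1"
    and U: "continuous_on ({0..} \<times> UNIV) U"
      "weak_wave_cauchy (\<lambda>\<phi>. a * worldline_delta z \<phi>) (\<lambda>y. - (a / 2) * \<bar>y\<bar> + V0 y) V1 U"
    and x: "x \<in> {0..} \<times> UNIV"
  shows "U x = full_field a V z x"
proof -
  obtain W where W: "source (proper_rate z) (\<lambda>t. z (max 0 t)) W"
    using source_proper_rate by blast
  have cV: "continuous_on UNIV V"
    using V(1) by (auto simp: free_wave_def intro: smooth_plane_continuous)
  have c: "continuous_on UNIV (\<lambda>x. V x - a / 4 * (\<bar>fst x + snd x\<bar> + \<bar>fst x - snd x\<bar>))"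
    by (intro continuous_intros cV)
  show ?thesis
  proof (rule weak_wave_cauchy_unique[OF U(2) _ full_field_weak[OF V] _ x])
    show "loc_bdd (\<lambda>x. indicator ({0..} \<times> UNIV) x * U x)"
      unfolding loc_bdd_def
    proof (intro conjI allI impI)
      show "(\<lambda>x. indicator ({0..} \<times> UNIV) x * U x) \<in> borel_measurable borel"
        using borel_measurable_continuous_on_indicator[OF half_plane_borel U(1)] by simp
      fix S :: "(real \<times> real) set" assume "bounded S"
      have "closed ({0..} \<times> UNIV :: (real \<times> real) set)" by (intro closed_Times) auto
      then have "compact (closure S \<inter> ({0..} \<times> UNIV))"
        using \<open>bounded S\<close> by (intro compact_Int_closed) (auto simp: compact_closure)
      then have "compact (U ` (closure S \<inter> ({0..} \<times> UNIV)))"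
        by (intro compact_continuous_image continuous_on_subset[OF U(1)]) auto
      then obtain C where C: "\<forall>y\<in>U ` (closure S \<inter> ({0..} \<times> UNIV)). norm y \<le> C"
        using compact_imp_bounded bounded_iff by metis
      have "\<bar>indicator ({0..} \<times> UNIV) y * U y\<bar> \<le> max C 0" if "y \<in> S" for y
      proof (cases "y \<in> {0..} \<times> UNIV")
        case True
        then have "norm (U y) \<le> C" using C that closure_subset[of S] by blast
        then show ?thesis using True by simp
      qed simp
      then show "\<exists>C. \<forall>x\<in>S. \<bar>indicator ({0..} \<times> UNIV) x * U x\<bar> \<le> C" by blast
    qed
    show "loc_bdd (\<lambda>x. indicator ({0..} \<times> UNIV) x * full_field a V z x)"
      unfolding full_field_def
      by (intro loc_bdd_mult loc_bdd_add loc_bdd_indicator half_plane_borel source.source_field_loc_bdd[OF W]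
          loc_bdd_continuous c continuous_intros)
    \<comment> \<open>For \<open>x\<close> in the half-plane the quadrant above it stays there, so
      continuity of \<open>U\<close> on the half-plane yields the one-sided limit.\<close>
    have sub: "quadrant x \<subseteq> {0..} \<times> UNIV"
      using x by (auto simp: quadrant_def mem_Times_iff)
    have "(U \<longlongrightarrow> U x) (at x within {0..} \<times> UNIV)"
      using U(1) x by (auto simp: continuous_on_def)
    then have 1: "(U \<longlongrightarrow> U x) (at x within quadrant x)"
      using sub by (rule tendsto_within_subset)
    have "((\<lambda>x. V x - a / 4 * (\<bar>fst x + snd x\<bar> + \<bar>fst x - snd x\<bar>)) \<longlongrightarrow>
        V x - a / 4 * (\<bar>fst x + snd x\<bar> + \<bar>fst x - snd x\<bar>)) (at x within UNIV)"
      using c unfolding continuous_on_def by blast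
    then have 2: "((\<lambda>x. V x - a / 4 * (\<bar>fst x + snd x\<bar> + \<bar>fst x - snd x\<bar>)) \<longlongrightarrow>
        V x - a / 4 * (\<bar>fst x + snd x\<bar> + \<bar>fst x - snd x\<bar>)) (at x within quadrant x)"
      by (rule tendsto_within_subset) simp
    show "((\<lambda>y. U y - full_field a V z y) \<longlongrightarrow> U x - full_field a V z x) (at x within quadrant x)"
      unfolding full_field_def by (intro tendsto_intros 1 2 source.tendsto_source_field[OF W])
  qed
qed

text \<open>By the 1-Lipschitz condition \<open>(t, z t)\<close> lies in the cone of
  \<open>(s, z s)\<close> whenever \<open>s \<le> t\<close>, so the indicator merely cuts the
  integral down to \<open>{0..t}\<close> and the elapsed proper time remains.\<close>

lemma proper_rate_integral:
  assumes "t \<ge> 0"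
  shows "proper_rate z integrable_on {0..t}"
    and "source_field (proper_rate z) (\<lambda>t. z (max 0 t)) (t, z t) = integral {0..t} (proper_rate z)"
proof -
  obtain W where W: "source (proper_rate z) (\<lambda>t. z (max 0 t)) W"
    using source_proper_rate by blast
  have eq: "proper_rate z s * indicator (future_cone s (z (max 0 s))) (t, z t) = indicator {0..t} s *\<^sub>R proper_rate z s" for s
  proof (cases "0 \<le> s")
    case True
    have "(t, z t) \<in> future_cone s (z s) \<longleftrightarrow> s \<le> t"
    proof
      assume "s \<le> t"
      then show "(t, z t) \<in> future_cone s (z s)"
        using dist_le[OF True assms] by (auto simp: future_cone_def abs_le_iff)
    qed (auto simp: future_cone_def)
    then show ?thesis using True by (auto simp: indicator_def)
  qed (simp add: proper_rate_def)
  have int: "set_integrable lborel {0..t} (proper_rate z)"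
    using source.integrand_integrable[OF W, of "(t, z t)"] unfolding eq set_integrable_def .
  show "proper_rate z integrable_on {0..t}"
    using set_borel_integral_eq_integral(1)[OF int] .
  show "source_field (proper_rate z) (\<lambda>t. z (max 0 t)) (t, z t) = integral {0..t} (proper_rate z)"
    using set_borel_integral_eq_integral(2)[OF int] unfolding source_field_def eq set_lebesgue_integral_def .
qed

lemma full_field_worldline:
  assumes "t \<ge> 0"
  shows "full_field a V z (t, z t) = V (t, z t) - a / 2 * integral {0..t} (\<lambda>s. 1 - proper_rate z s)"
proof -
  \<comment> \<open>The world-line starts at the origin and stays in its cone, so neither modulus
    changes sign and the static field becomes \<open>- (a / 2) t\<close>.\<close>
  have "\<bar>z t\<bar> \<le> t" using dist_le[of 0 t] assms by (simp add: start)
  then have "\<bar>t + z t\<bar> + \<bar>t - z t\<bar> = 2 * t" by (simp add: abs_le_iff)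
  moreover have I: "integral {0..t} (\<lambda>s. 1 - proper_rate z s) = t - integral {0..t} (proper_rate z)"
    using assms by (subst Henstock_Kurzweil_Integration.integral_diff) (auto simp: proper_rate_integral)
  ultimately show ?thesis
    unfolding I full_field_def using proper_rate_integral(2)[OF assms] by (simp add: algebra_simps)
qed

end

section \<open>Global solutions of Lipschitz differential equations\<close>

text \<open>The initial value 0 is built in, since the integral over \<open>{0..0}\<close>
  vanishes.\<close>

definition integral_curve :: "(real \<Rightarrow> 'a \<Rightarrow> 'a) \<Rightarrow> (real \<Rightarrow> 'a::euclidean_space) \<Rightarrow> bool" where
  "integral_curve f y \<longleftrightarrow> continuous_on {0..} y \<and> (\<forall>t\<ge>0. ((\<lambda>s. f s (y s)) has_integral y t) {0..t})"

lemma integral_exp_mult: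
  assumes "K > 0" "0 \<le> (t::real)"
  shows "((\<lambda>s. exp (K * s)) has_integral ((exp (K * t) - 1) / K)) {0..t}"
proof -
  have "((\<lambda>s. exp (K * s)) has_integral (exp (K * t) / K - exp (K * 0) / K)) {0..t}"
    by (rule fundamental_theorem_of_calculus[OF assms(2)])
      (use assms(1) in \<open>auto intro!: derivative_eq_intros simp: has_real_derivative_iff_has_vector_derivative[symmetric]\<close>)
  then show ?thesis by (simp add: diff_divide_distrib)
qed

locale lipschitz_ode =
  fixes f :: "real \<Rightarrow> 'a::euclidean_space \<Rightarrow> 'a" and C L :: real
  assumes cont: "continuous_on ({0..} \<times> UNIV) (\<lambda>(t, y). f t y)"
    and bound: "t \<ge> 0 \<Longrightarrow> norm (f t y) \<le> C"
    and lip: "t \<ge> 0 \<Longrightarrow> norm (f t x - f t y) \<le> L * norm (x - y)"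
    and L: "L \<ge> 0"
begin

lemma C_nonneg: "C \<ge> 0"
  using bound[of 0] norm_ge_zero order_trans by blast

lemma cont_comp:
  assumes "continuous_on {0..} y"
  shows "continuous_on {0..} (\<lambda>s. f s (y s))"
  using continuous_on_compose2[OF cont continuous_on_Pair[OF continuous_on_id assms]] by auto

text \<open>Any weight above \<open>L\<close> makes \<open>L / K < 1\<close>; adding 1 also covers
  \<open>L = 0\<close>.\<close>

definition K :: real where "K = L + 1"

lemma K: "K > 0" "L / K < 1" "0 \<le> L / K"
  using L by (auto simp: K_def)

text \<open>Picard's map conjugated with the weight \<open>exp (- K t)\<close>, for which it contracts on the whole half-line.\<close>

definition picard :: "(real \<Rightarrow> 'a) \<Rightarrow> real \<Rightarrow> 'a" where
  "picard g t = exp (- K * max 0 t) *\<^sub>R integral {0..max 0 t} (\<lambda>s. f s (exp (K * s) *\<^sub>R g s))"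

lemma picard_integrable:
  assumes "continuous_on UNIV g"
  shows "(\<lambda>s. f s (exp (K * s) *\<^sub>R g s)) integrable_on {0..t}"
proof (rule integrable_continuous_real)
  have "continuous_on {0..} (\<lambda>s. f s (exp (K * s) *\<^sub>R g s))"
    by (intro cont_comp continuous_intros continuous_on_subset[OF assms]) auto
  then show "continuous_on {0..t} (\<lambda>s. f s (exp (K * s) *\<^sub>R g s))"
    by (rule continuous_on_subset) auto
qed

text \<open>The integral of a field bounded by \<open>C\<close> grows at most like
  \<open>C t\<close>, which the weight \<open>exp (- K t)\<close> keeps below \<open>C / K\<close>.
  Boundedness of \<open>g\<close> itself is not assumed, which lets the lemma apply to curves of
  unknown growth.\<close>

lemma picard_bcontfun:
  assumes g: "continuous_on UNIV g"
  shows "picard g \<in> bcontfun"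
proof (rule bcontfun_normI)
  let ?h = "\<lambda>s. f s (exp (K * s) *\<^sub>R g s)"
  have "continuous_on {0..} (\<lambda>t. integral {0..t} ?h)"
    unfolding continuous_on_eq_continuous_within
  proof
    fix t :: real assume t: "t \<in> {0..}"
    have "continuous_on {0..t+1} (\<lambda>t. integral {0..t} ?h)"
      by (rule indefinite_integral_continuous_1[OF picard_integrable[OF g]])
    then have "continuous (at t within {0..t+1}) (\<lambda>t. integral {0..t} ?h)"
      using t by (auto simp: continuous_on_eq_continuous_within)
    moreover have "at t within {0..t+1} = at t within {0..}"
      by (rule at_within_nhd[of t "{..<t+1}"]) auto
    ultimately show "continuous (at t within {0..}) (\<lambda>t. integral {0..t} ?h)" by simp
  qed
  then have "continuous_on UNIV (\<lambda>t. integral {0..max 0 t} ?h)"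
    by (rule continuous_on_compose2) (auto intro!: continuous_intros)
  then show "continuous_on UNIV (picard g)"
    unfolding picard_def[abs_def] by (intro continuous_intros)
  fix t
  have "norm (integral {0..max 0 t} ?h) \<le> C * (max 0 t - 0)"
  proof (rule integral_bound)
    show "continuous_on {0..max 0 t} ?h"
      by (rule continuous_on_subset[of "{0..}"], rule cont_comp) (auto intro!: continuous_intros continuous_on_subset[OF g])
  qed (use bound in auto)
  then have "norm (picard g t) \<le> exp (- K * max 0 t) * (C * max 0 t)"
    by (simp add: picard_def mult_left_mono)
  also have "\<dots> = C * (exp (- K * max 0 t) * (K * max 0 t)) / K"
    using K(1) by simp
  also have "\<dots> \<le> C * 1 / K"
  proof (intro divide_right_mono mult_left_mono C_nonneg)
    have "K * max 0 t \<le> exp (K * max 0 t)"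
      using exp_ge_add_one_self[of "K * max 0 t"] by linarith
    then show "exp (- K * max 0 t) * (K * max 0 t) \<le> 1"
      by (simp add: exp_minus divide_simps)
  qed (use K(1) in simp)
  finally show "norm (picard g t) \<le> C / K" by simp
qed

text \<open>The weight turns the Lipschitz estimate into \<open>exp (- K t)\<close> times the
  integral of \<open>L exp (K s)\<close> over \<open>{0..t}\<close>, which is at most
  \<open>L / K\<close> uniformly in \<open>t\<close>.\<close>

lemma picard_contraction:
  fixes g h :: "real \<Rightarrow>\<^sub>C 'a"
  shows "norm (picard g t - picard h t) \<le> L / K * dist g h"
proof -
  define \<tau> where "\<tau> = max 0 t"
  have \<tau>: "\<tau> \<ge> 0" by (simp add: \<tau>_def)
  have cg: "continuous_on UNIV (apply_bcontfun g)" and ch: "continuous_on UNIV (apply_bcontfun h)" by auto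
  have "norm (integral {0..\<tau>} (\<lambda>s. f s (exp (K * s) *\<^sub>R g s)) - integral {0..\<tau>} (\<lambda>s. f s (exp (K * s) *\<^sub>R h s))) =
      norm (integral {0..\<tau>} (\<lambda>s. f s (exp (K * s) *\<^sub>R g s) - f s (exp (K * s) *\<^sub>R h s)))"
    by (simp add: Henstock_Kurzweil_Integration.integral_diff picard_integrable cg ch)
  also have "\<dots> \<le> integral {0..\<tau>} (\<lambda>s. L * dist g h * exp (K * s))"
  proof (rule integral_norm_bound_integral)
    show "(\<lambda>s. f s (exp (K * s) *\<^sub>R g s) - f s (exp (K * s) *\<^sub>R h s)) integrable_on {0..\<tau>}"
      by (intro integrable_diff picard_integrable cg ch)
    show "(\<lambda>s. L * dist g h * exp (K * s)) integrable_on {0..\<tau>}"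
      by (intro integrable_continuous_real continuous_intros)
    fix s assume "s \<in> {0..\<tau>}"
    then have "norm (f s (exp (K * s) *\<^sub>R g s) - f s (exp (K * s) *\<^sub>R h s)) \<le> L * norm (exp (K * s) *\<^sub>R g s - exp (K * s) *\<^sub>R h s)"
      by (intro lip) auto
    also have "\<dots> = L * (exp (K * s) * norm (g s - h s))"
      by (simp add: scaleR_diff_right[symmetric])
    also have "\<dots> \<le> L * (exp (K * s) * dist g h)"
      using dist_bounded[of g s h] L by (intro mult_left_mono) (auto simp: dist_norm)
    finally show "norm (f s (exp (K * s) *\<^sub>R g s) - f s (exp (K * s) *\<^sub>R h s)) \<le> L * dist g h * exp (K * s)"
      by (simp add: mult_ac)
  qed
  also have "\<dots> = L * dist g h * ((exp (K * \<tau>) - 1) / K)"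
    using integral_unique[OF integral_exp_mult[OF K(1) \<tau>]] by simp
  finally have le: "norm (integral {0..\<tau>} (\<lambda>s. f s (exp (K * s) *\<^sub>R g s)) - integral {0..\<tau>} (\<lambda>s. f s (exp (K * s) *\<^sub>R h s)))
      \<le> L * dist g h * ((exp (K * \<tau>) - 1) / K)" .
  have "norm (picard g t - picard h t) = exp (- K * \<tau>) * norm (integral {0..\<tau>} (\<lambda>s. f s (exp (K * s) *\<^sub>R g s)) - integral {0..\<tau>} (\<lambda>s. f s (exp (K * s) *\<^sub>R h s)))"
    by (simp add: picard_def \<tau>_def scaleR_diff_right[symmetric])
  also have "\<dots> \<le> exp (- K * \<tau>) * (L * dist g h * ((exp (K * \<tau>) - 1) / K))"
    by (intro mult_left_mono le) simp
  also have "\<dots> = L / K * dist g h * (1 - exp (- K * \<tau>))"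
    by (simp add: exp_minus field_simps)
  also have "\<dots> \<le> L / K * dist g h * 1"
    by (intro mult_left_mono mult_nonneg_nonneg K(3)) auto
  finally show ?thesis by simp
qed

definition picard_op :: "(real \<Rightarrow>\<^sub>C 'a) \<Rightarrow> (real \<Rightarrow>\<^sub>C 'a)" where
  "picard_op g = Bcontfun (picard g)"

lemma picard_op: "apply_bcontfun (picard_op g) = picard g"
  unfolding picard_op_def by (rule Bcontfun_inverse[OF picard_bcontfun]) simp

lemma picard_fixed_point: "\<exists>!g. picard_op g = g"
proof (rule banach_fix_type[of "L / K"])
  show "\<forall>g h. dist (picard_op g) (picard_op h) \<le> L / K * dist g h"
  proof (intro allI, rule dist_bound)
    fix g h :: "real \<Rightarrow>\<^sub>C 'a" and x
    show "dist (picard_op g x) (picard_op h x) \<le> L / K * dist g h"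
      unfolding picard_op by (subst dist_norm) (rule picard_contraction)
  qed
qed (use K in auto)

lemma integral_curve_exists: "\<exists>y. integral_curve f y"
proof -
  obtain g where g: "picard_op g = g" using picard_fixed_point by blast
  define y where "y s = exp (K * s) *\<^sub>R g s" for s
  have cy: "continuous_on {0..} y"
    unfolding y_def by (intro continuous_intros continuous_on_apply_bcontfun)
  have "((\<lambda>s. f s (y s)) has_integral y t) {0..t}" if "t \<ge> 0" for t
  proof -
    have "apply_bcontfun g t = picard g t" using picard_op[of g] g by simp
    then have "y t = integral {0..t} (\<lambda>s. f s (y s))"
      using that by (simp add: y_def picard_def exp_minus max_absorb2)
    then show ?thesis
      using picard_integrable[of g t] by (simp add: y_def has_integral_integral)
  qed
  then show ?thesis using cy by (auto simp: integral_curve_def)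
qed

text \<open>A weighted integral curve is a fixed point of \<open>picard\<close>, and images of
  continuous functions under \<open>picard\<close> are bounded. So every integral curve corresponds
  to a fixed point among bounded functions, whatever its growth.\<close>

lemma integral_curve_weighted:
  assumes "integral_curve f y"
  obtains g where "picard_op g = g" "\<And>t. t \<ge> 0 \<Longrightarrow> y t = exp (K * t) *\<^sub>R g t"
proof -
  define g where "g t = exp (- K * max 0 t) *\<^sub>R y (max 0 t)" for t
  have cy: "continuous_on {0..} y" and int: "\<And>t. t \<ge> 0 \<Longrightarrow> ((\<lambda>s. f s (y s)) has_integral y t) {0..t}"
    using assms by (auto simp: integral_curve_def)
  have yg: "y t = exp (K * t) *\<^sub>R g t" if "t \<ge> 0" for t
    using that by (simp add: g_def max_absorb2 exp_minus)
  have cg: "continuous_on UNIV g"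
    unfolding g_def[abs_def] by (intro continuous_intros continuous_on_compose2[OF cy]) auto
  have pg: "picard g = g"
  proof
    fix t
    have "integral {0..max 0 t} (\<lambda>s. f s (exp (K * s) *\<^sub>R g s)) = integral {0..max 0 t} (\<lambda>s. f s (y s))"
      by (rule integral_cong) (auto simp: yg)
    also have "\<dots> = y (max 0 t)"
      by (rule integral_unique[OF int]) simp
    finally show "picard g t = g t"
      by (simp add: picard_def g_def)
  qed
  have gb: "g \<in> bcontfun"
    using picard_bcontfun[OF cg] by (simp add: pg)
  have "picard_op (Bcontfun g) = Bcontfun g"
    unfolding picard_op_def by (simp add: Bcontfun_inverse[OF gb] pg)
  moreover have "y t = exp (K * t) *\<^sub>R Bcontfun g t" if "t \<ge> 0" for t
    using yg[OF that] by (simp add: Bcontfun_inverse[OF gb])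
  ultimately show ?thesis by (rule that)
qed

lemma integral_curve_unique:
  assumes "integral_curve f y" "integral_curve f y'" "t \<ge> 0"
  shows "y t = y' t"
proof -
  obtain g where g: "picard_op g = g" "\<And>t. t \<ge> 0 \<Longrightarrow> y t = exp (K * t) *\<^sub>R g t"
    using integral_curve_weighted[OF assms(1)] by blast
  obtain g' where g': "picard_op g' = g'" "\<And>t. t \<ge> 0 \<Longrightarrow> y' t = exp (K * t) *\<^sub>R g' t"
    using integral_curve_weighted[OF assms(2)] by blast
  have "g = g'" using picard_fixed_point g(1) g'(1) by blast
  then show ?thesis using g(2) g'(2) assms(3) by simp
qed

end

section \<open>Indefinite integrals on the half-line\<close>

lemma indefinite_integral_continuous:
  fixes F g :: "real \<Rightarrow> real"
  assumes "\<And>t. t \<ge> 0 \<Longrightarrow> (g has_integral F t) {0..t}"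
  shows "continuous_on {0..} F"
  unfolding continuous_on_eq_continuous_within
proof
  fix t :: real assume t: "t \<in> {0..}"
  have "continuous_on {0..t+1} (\<lambda>t. integral {0..t} g)"
    by (rule indefinite_integral_continuous_1) (use assms[of "t + 1"] t in auto)
  then have "continuous_on {0..t+1} F"
    by (rule continuous_on_eq) (use assms in auto)
  then have "continuous (at t within {0..t+1}) F"
    using t by (auto simp: continuous_on_eq_continuous_within)
  moreover have "at t within {0..t+1} = at t within {0..}"
    by (rule at_within_nhd[of t "{..<t+1}"]) auto
  ultimately show "continuous (at t within {0..}) F" by simp
qed

lemma indefinite_integral_deriv:
  fixes F g :: "real \<Rightarrow> real"
  assumes F: "\<And>t. t \<ge> 0 \<Longrightarrow> (g has_integral F t) {0..t}" and g: "continuous_on {0..} g" and t: "t \<ge> 0"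
  shows "(F has_real_derivative g t) (at t within {0..})"
proof -
  have "((\<lambda>u. integral {0..u} g) has_vector_derivative g t) (at t within {0..t+1})"
    by (rule integral_has_vector_derivative) (use t in \<open>auto intro: continuous_on_subset[OF g]\<close>)
  moreover have "at t within {0..t+1} = at t within {0..}"
    by (rule at_within_nhd[of t "{..<t+1}"]) auto
  ultimately have "((\<lambda>u. integral {0..u} g) has_real_derivative g t) (at t within {0..})"
    by (simp add: has_real_derivative_iff_has_vector_derivative)
  then show ?thesis
    by (rule has_field_derivative_transform_within[OF _ zero_less_one]) (use F t in auto)
qed

lemma indefinite_integral_lipschitz:
  fixes F g :: "real \<Rightarrow> real"
  assumes F: "\<And>t. t \<ge> 0 \<Longrightarrow> (g has_integral F t) {0..t}" and g: "\<And>s. s \<ge> 0 \<Longrightarrow> \<bar>g s\<bar> \<le> B" and "B \<ge> 0"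
  shows "B-lipschitz_on {0..} F"
proof -
  have le: "\<bar>F t - F s\<bar> \<le> B * (t - s)" if "0 \<le> s" "s \<le> t" for s t
  proof -
    have "g integrable_on {0..t}" using F[of t] that by auto
    then have "integral {0..s} g + integral {s..t} g = integral {0..t} g" and i: "g integrable_on {s..t}"
      using that by (auto intro!: Henstock_Kurzweil_Integration.integral_combine intro: integrable_on_subinterval)
    then have "integral {s..t} g = F t - F s"
      using F[of s] F[of t] that by (simp add: integral_unique)
    then have "(g has_integral (F t - F s)) (cbox s t)"
      using i by (simp add: has_integral_integral)
    then have "norm (F t - F s) \<le> B * measure lborel (cbox s t)"
      by (rule has_integral_bound[OF assms(3)]) (use g that in auto)
    then show ?thesis using that by simp
  qed
  show ?thesis
  proof (rule lipschitz_onI[OF _ assms(3)])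
    fix s t :: real assume st: "s \<in> {0..}" "t \<in> {0..}"
    show "dist (F s) (F t) \<le> B * dist s t"
    proof (cases "s \<le> t")
      case True
      then show ?thesis using le[of s t] st by (simp add: dist_real_def abs_minus_commute)
    next
      case False
      then show ?thesis using le[of t s] st by (simp add: dist_real_def abs_minus_commute)
    qed
  qed
qed

section \<open>Relativistic velocities\<close>

text \<open>For \<open>m = p = 0\<close> the quotients are 0 by convention, so the sign of the mass
  does not enter. This bounds the speed of a solution whose field is still unknown.\<close>

lemma abs_le_hypot: "\<bar>m / sqrt (m\<^sup>2 + p\<^sup>2)\<bar> \<le> 1" "\<bar>p / sqrt (m\<^sup>2 + p\<^sup>2)\<bar> \<le> 1" for m p :: real
proof -
  have "\<bar>m\<bar> \<le> sqrt (m\<^sup>2 + p\<^sup>2)" "\<bar>p\<bar> \<le> sqrt (m\<^sup>2 + p\<^sup>2)"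
    by (simp_all add: real_le_rsqrt)
  moreover have "\<bar>x / s\<bar> \<le> 1" if "\<bar>x\<bar> \<le> s" for x s :: real
    using that by (cases "s = 0") (auto simp: abs_divide)
  ultimately show "\<bar>m / sqrt (m\<^sup>2 + p\<^sup>2)\<bar> \<le> 1" "\<bar>p / sqrt (m\<^sup>2 + p\<^sup>2)\<bar> \<le> 1"
    by blast+
qed

lemma hypot_pos: "m > 0 \<Longrightarrow> m\<^sup>2 + p\<^sup>2 > (0::real)"
  by (simp add: add_pos_nonneg)

lemma sqrt_one_minus_velocity:
  assumes "m > 0"
  shows "sqrt (1 - (p / sqrt (m\<^sup>2 + p\<^sup>2))\<^sup>2) = m / sqrt (m\<^sup>2 + p\<^sup>2)"
proof -
  have "m\<^sup>2 / (m\<^sup>2 + p\<^sup>2) + p\<^sup>2 / (m\<^sup>2 + p\<^sup>2) = 1"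
    unfolding add_divide_distrib[symmetric] using hypot_pos[OF assms, of p] by auto
  then have "1 - (p / sqrt (m\<^sup>2 + p\<^sup>2))\<^sup>2 = (m / sqrt (m\<^sup>2 + p\<^sup>2))\<^sup>2"
    using hypot_pos[OF assms, of p] by (simp add: power_divide)
  then show ?thesis using assms by simp
qed

lemma normalize_diff_le:
  fixes x y :: "'a::real_normed_vector"
  assumes "x \<noteq> 0" "y \<noteq> 0"
  shows "norm (x /\<^sub>R norm x - y /\<^sub>R norm y) \<le> 2 * norm (x - y) / norm x"
proof -
  have "x /\<^sub>R norm x - y /\<^sub>R norm y = (x - y) /\<^sub>R norm x + (1 / norm x - 1 / norm y) *\<^sub>R y"
    by (simp add: algebra_simps divide_inverse)
  then have "norm (x /\<^sub>R norm x - y /\<^sub>R norm y) \<le> norm ((x - y) /\<^sub>R norm x) + norm ((1 / norm x - 1 / norm y) *\<^sub>R y)"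
    by (metis norm_triangle_ineq)
  moreover have "norm ((1 / norm x - 1 / norm y) *\<^sub>R y) = \<bar>norm y - norm x\<bar> / norm x"
  proof -
    have "1 / norm x - 1 / norm y = (norm y - norm x) / (norm x * norm y)"
      using assms by (simp add: field_simps)
    then show ?thesis using assms by (simp add: abs_divide abs_mult)
  qed
  moreover have "\<bar>norm y - norm x\<bar> / norm x \<le> norm (x - y) / norm x"
    by (intro divide_right_mono) (metis norm_minus_commute norm_triangle_ineq3, simp)
  moreover have "norm ((x - y) /\<^sub>R norm x) = norm (x - y) / norm x"
    by (simp add: divide_inverse mult.commute)
  ultimately show ?thesis by simp
qed

text \<open>The quotients are the real and imaginary parts of \<open>Complex m p\<close> divided by
  its modulus, and normalisation is Lipschitz away from the disc of radius
  \<open>m0\<close>.\<close>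

lemma velocity_diff_le:
  fixes m m' p p' :: real
  assumes "m \<ge> m0" "m' \<ge> m0" "m0 > 0"
  shows "\<bar>m / sqrt (m\<^sup>2 + p\<^sup>2) - m' / sqrt (m'\<^sup>2 + p'\<^sup>2)\<bar> \<le> 2 / m0 * (\<bar>m - m'\<bar> + \<bar>p - p'\<bar>)"
    and "\<bar>p / sqrt (m\<^sup>2 + p\<^sup>2) - p' / sqrt (m'\<^sup>2 + p'\<^sup>2)\<bar> \<le> 2 / m0 * (\<bar>m - m'\<bar> + \<bar>p - p'\<bar>)"
proof -
  let ?x = "Complex m p" and ?y = "Complex m' p'"
  have nz: "?x \<noteq> 0" "?y \<noteq> 0" using assms by (auto simp: complex_eq_iff)
  have "m0 \<le> norm ?x"
    using assms abs_Re_le_cmod[of ?x] by simp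
  then have "2 * norm (?x - ?y) / norm ?x \<le> 2 * norm (?x - ?y) / m0"
    using assms nz by (intro divide_left_mono mult_pos_pos) auto
  then have "norm (?x /\<^sub>R norm ?x - ?y /\<^sub>R norm ?y) \<le> 2 * norm (?x - ?y) / m0"
    using normalize_diff_le[OF nz] by linarith
  also have "\<dots> \<le> 2 / m0 * (\<bar>m - m'\<bar> + \<bar>p - p'\<bar>)"
    using cmod_le[of "?x - ?y"] assms by (simp add: divide_right_mono)
  finally have *: "norm (?x /\<^sub>R norm ?x - ?y /\<^sub>R norm ?y) \<le> 2 / m0 * (\<bar>m - m'\<bar> + \<bar>p - p'\<bar>)" .
  have "Re (?x /\<^sub>R norm ?x - ?y /\<^sub>R norm ?y) = m / sqrt (m\<^sup>2 + p\<^sup>2) - m' / sqrt (m'\<^sup>2 + p'\<^sup>2)"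
    "Im (?x /\<^sub>R norm ?x - ?y /\<^sub>R norm ?y) = p / sqrt (m\<^sup>2 + p\<^sup>2) - p' / sqrt (m'\<^sup>2 + p'\<^sup>2)"
    by (simp_all add: complex_norm divide_inverse_commute)
  then show "\<bar>m / sqrt (m\<^sup>2 + p\<^sup>2) - m' / sqrt (m'\<^sup>2 + p'\<^sup>2)\<bar> \<le> 2 / m0 * (\<bar>m - m'\<bar> + \<bar>p - p'\<bar>)"
    "\<bar>p / sqrt (m\<^sup>2 + p\<^sup>2) - p' / sqrt (m'\<^sup>2 + p'\<^sup>2)\<bar> \<le> 2 / m0 * (\<bar>m - m'\<bar> + \<bar>p - p'\<bar>)"
    using * abs_Re_le_cmod[of "?x /\<^sub>R norm ?x - ?y /\<^sub>R norm ?y"] abs_Im_le_cmod[of "?x /\<^sub>R norm ?x - ?y /\<^sub>R norm ?y"]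
    by simp_all
qed

text \<open>A continuous integrand makes the integrated equation classical at every time, at 0 from
  the right. The positive sign of \<open>m\<close> makes the rate of proper time equal to the
  quotient and not to its modulus.\<close>

lemma velocity_integral_curve:
  fixes m p z :: "real \<Rightarrow> real"
  assumes m: "continuous_on {0..} m" and p: "continuous_on {0..} p" and pos: "\<And>t. t \<ge> 0 \<Longrightarrow> m t > 0"
    and z: "\<And>t. t \<ge> 0 \<Longrightarrow> ((\<lambda>s. p s / sqrt ((m s)\<^sup>2 + (p s)\<^sup>2)) has_integral z t) {0..t}"
    and t: "t \<ge> 0"
  shows "(z has_real_derivative p t / sqrt ((m t)\<^sup>2 + (p t)\<^sup>2)) (at t within {0..})"
    and "proper_rate z t = m t / sqrt ((m t)\<^sup>2 + (p t)\<^sup>2)"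
proof -
  have "continuous_on {0..} (\<lambda>s. p s / sqrt ((m s)\<^sup>2 + (p s)\<^sup>2))"
    using hypot_pos[OF pos] by (intro continuous_intros m p) force
  from indefinite_integral_deriv[OF z this t]
  show d: "(z has_real_derivative p t / sqrt ((m t)\<^sup>2 + (p t)\<^sup>2)) (at t within {0..})" .
  have "velocity z t = p t / sqrt ((m t)\<^sup>2 + (p t)\<^sup>2)"
    unfolding velocity_def
    by (rule vector_derivative_within[OF at_within_Ici_neq_bot[OF t]])
      (use d in \<open>simp add: has_real_derivative_iff_has_vector_derivative\<close>)
  then show "proper_rate z t = m t / sqrt ((m t)\<^sup>2 + (p t)\<^sup>2)"
    using t sqrt_one_minus_velocity[OF pos[OF t], of "p t"] by (simp add: proper_rate_def)
qed

lemma velocity_cong: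
  assumes "\<And>t. t \<ge> 0 \<Longrightarrow> z t = z' t" "t \<ge> 0"
  shows "velocity z t = velocity z' t"
proof -
  have "(z has_vector_derivative l) (at t within {0..}) \<longleftrightarrow> (z' has_vector_derivative l) (at t within {0..})" for l
    using assms by (auto elim!: has_vector_derivative_transform[rotated 2])
  then show ?thesis by (simp add: velocity_def vector_derivative_def)
qed

lemma full_field_cong:
  assumes "\<And>t. t \<ge> 0 \<Longrightarrow> z t = z' t"
  shows "full_field a V z = full_field a V z'"
proof -
  have "proper_rate z = proper_rate z'"
    using velocity_cong[of z z'] assms by (auto simp: proper_rate_def fun_eq_iff indicator_def)
  moreover have "(\<lambda>t. z (max 0 t)) = (\<lambda>t. z' (max 0 t))"
    using assms by auto
  ultimately show ?thesis by (simp add: full_field_def[abs_def])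
qed

section \<open>Lipschitz continuity of the source field\<close>

text \<open>Two times at which \<open>g\<close> lies between \<open>A\<close> and \<open>B\<close>
  are at most \<open>|A - B| / c\<close> apart, so \<open>r\<close> can be any such time; if there
  is none, the claim is vacuous.\<close>

lemma slow_level_set:
  fixes g :: "real \<Rightarrow> real"
  assumes "\<And>s t. 0 \<le> s \<Longrightarrow> 0 \<le> t \<Longrightarrow> c * \<bar>t - s\<bar> \<le> \<bar>g t - g s\<bar>" "c > 0"
  obtains r where "\<And>t. t \<ge> 0 \<Longrightarrow> min A B \<le> g t \<Longrightarrow> g t \<le> max A B \<Longrightarrow> t \<in> {r - \<bar>A - B\<bar> / c..r + \<bar>A - B\<bar> / c}"
proof (cases "\<exists>r\<ge>0. min A B \<le> g r \<and> g r \<le> max A B")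
  case True
  then obtain r where r: "r \<ge> 0" "min A B \<le> g r" "g r \<le> max A B" by blast
  have "t \<in> {r - \<bar>A - B\<bar> / c..r + \<bar>A - B\<bar> / c}" if "t \<ge> 0" "min A B \<le> g t" "g t \<le> max A B" for t
  proof -
    have "c * \<bar>t - r\<bar> \<le> \<bar>A - B\<bar>"
      using assms(1)[OF r(1) that(1)] r that by (simp add: min_def max_def abs_if split: if_splits)
    then have "\<bar>t - r\<bar> \<le> \<bar>A - B\<bar> / c"
      using assms(2) by (simp add: field_simps)
    then show ?thesis by (auto simp: abs_le_iff)
  qed
  then show ?thesis by (rule that)
next
  case False
  then show ?thesis by (intro that) blast
qed

text \<open>At speed at most \<open>\<nu> < 1\<close> both \<open>t + z t\<close> and
  \<open>t - z t\<close> change at rate at least \<open>1 - \<nu>\<close>. A time whose cone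
  contains just one of \<open>x\<close> and \<open>y\<close> has one of these values between the
  corresponding coordinates of the two points, so such times lie in two short intervals.\<close>

lemma (in source) source_field_lipschitz:
  assumes slow: "\<And>s t. 0 \<le> s \<Longrightarrow> 0 \<le> t \<Longrightarrow> \<bar>z t - z s\<bar> \<le> \<nu> * \<bar>t - s\<bar>" and \<nu>: "\<nu> < 1"
  shows "\<bar>source_field w z x - source_field w z y\<bar> \<le>
    2 * W / (1 - \<nu>) * (\<bar>(fst x + snd x) - (fst y + snd y)\<bar> + \<bar>(fst x - snd x) - (fst y - snd y)\<bar>)"
proof -
  define d where "d = \<bar>(fst x + snd x) - (fst y + snd y)\<bar> / (1 - \<nu>)"
  define d' where "d' = \<bar>(fst x - snd x) - (fst y - snd y)\<bar> / (1 - \<nu>)"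
  have d: "d \<ge> 0" "d' \<ge> 0" using \<nu> by (auto simp: d_def d'_def)
  have 1: "(1 - \<nu>) * \<bar>t - s\<bar> \<le> \<bar>(t + z t) - (s + z s)\<bar>" if "0 \<le> s" "0 \<le> t" for s t
    using slow[OF that] by (simp add: algebra_simps)
  have 2: "(1 - \<nu>) * \<bar>t - s\<bar> \<le> \<bar>(t - z t) - (s - z s)\<bar>" if "0 \<le> s" "0 \<le> t" for s t
    using slow[OF that] by (simp add: algebra_simps)
  have \<nu>': "1 - \<nu> > 0" using \<nu> by simp
  obtain r where r: "\<And>t. t \<ge> 0 \<Longrightarrow> min (fst x + snd x) (fst y + snd y) \<le> t + z t \<Longrightarrow> t + z t \<le> max (fst x + snd x) (fst y + snd y) \<Longrightarrow> t \<in> {r - d..r + d}"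
    unfolding d_def using slow_level_set[where g = "\<lambda>t. t + z t", OF 1 \<nu>'] by metis
  obtain r' where r': "\<And>t. t \<ge> 0 \<Longrightarrow> min (fst x - snd x) (fst y - snd y) \<le> t - z t \<Longrightarrow> t - z t \<le> max (fst x - snd x) (fst y - snd y) \<Longrightarrow> t \<in> {r' - d'..r' + d'}"
    unfolding d'_def using slow_level_set[where g = "\<lambda>t. t - z t", OF 2 \<nu>'] by metis
  have "\<bar>source_field w z x - source_field w z y\<bar> = norm (LINT t|lborel. w t * indicator (future_cone t (z t)) x - w t * indicator (future_cone t (z t)) y)"
    unfolding source_field_def by (simp add: integrand_integrable)
  also have "\<dots> \<le> (LINT t|lborel. W * indicator {r - d..r + d} t + W * indicator {r' - d'..r' + d'} t)"
  proof (rule Bochner_Integration.integral_norm_bound[THEN order_trans], rule integral_mono)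
    show "integrable lborel (\<lambda>t. norm (w t * indicator (future_cone t (z t)) x - w t * indicator (future_cone t (z t)) y))"
      by (intro integrable_norm Bochner_Integration.integrable_diff integrand_integrable)
    show "integrable lborel (\<lambda>t. W * indicator {r - d..r + d} t + W * indicator {r' - d'..r' + d'} t)"
      using emeasure_bounded_finite[of "{r - d..r + d}"] emeasure_bounded_finite[of "{r' - d'..r' + d'}"]
      by (intro Bochner_Integration.integrable_add integrable_mult_right integrable_real_indicator) auto
    fix t
    show "norm (w t * indicator (future_cone t (z t)) x - w t * indicator (future_cone t (z t)) y) \<le>
        W * indicator {r - d..r + d} t + W * indicator {r' - d'..r' + d'} t"
    proof (cases "t < 0 \<or> (x \<in> future_cone t (z t) \<longleftrightarrow> y \<in> future_cone t (z t))")
      case True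
      then have *: "w t * indicator (future_cone t (z t)) x - w t * indicator (future_cone t (z t)) y = 0"
        using w_past by (auto simp: indicator_def)
      show ?thesis unfolding * using W_nonneg by simp
    next
      case False
      then have "(min (fst x + snd x) (fst y + snd y) \<le> t + z t \<and> t + z t \<le> max (fst x + snd x) (fst y + snd y)) \<or>
          (min (fst x - snd x) (fst y - snd y) \<le> t - z t \<and> t - z t \<le> max (fst x - snd x) (fst y - snd y))"
        by (auto simp: future_cone_def min_def max_def)
      then have "t \<in> {r - d..r + d} \<or> t \<in> {r' - d'..r' + d'}"
        using False r r' by (metis not_less)
      then have "W \<le> W * indicator {r - d..r + d} t + W * indicator {r' - d'..r' + d'} t"
        using W_nonneg by (auto simp: indicator_def)
      moreover have "norm (w t * indicator (future_cone t (z t)) x - w t * indicator (future_cone t (z t)) y) \<le> W"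
        using w_bound[of t] W_nonneg by (auto simp: indicator_def)
      ultimately show ?thesis by linarith
    qed
  qed
  also have "\<dots> = W * (2 * d) + W * (2 * d')"
    using d by (simp add: emeasure_bounded_finite)
  also have "\<dots> = 2 * W / (1 - \<nu>) * (\<bar>(fst x + snd x) - (fst y + snd y)\<bar> + \<bar>(fst x - snd x) - (fst y - snd y)\<bar>)"
    by (simp add: d_def d'_def distrib_left)
  finally show ?thesis .
qed

section \<open>The particle dynamics\<close>

lemma has_integral_triple:
  fixes f g h :: "real \<Rightarrow> real"
  shows "((\<lambda>s. (f s, g s, h s)) has_integral (x, y, z)) S \<longleftrightarrow>
    (f has_integral x) S \<and> (g has_integral y) S \<and> (h has_integral z) S"
  by (subst has_integral_componentwise_iff) (auto simp: Basis_prod_def ball_Un)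

lemma continuous_on_triple:
  fixes f g h :: "real \<Rightarrow> real"
  shows "continuous_on S (\<lambda>s. (f s, g s, h s)) \<longleftrightarrow> continuous_on S f \<and> continuous_on S g \<and> continuous_on S h"
proof
  assume *: "continuous_on S (\<lambda>s. (f s, g s, h s))"
  show "continuous_on S f \<and> continuous_on S g \<and> continuous_on S h"
    using continuous_on_fst[OF *] continuous_on_fst[OF continuous_on_snd[OF *]] continuous_on_snd[OF continuous_on_snd[OF *]]
    by simp
qed (intro continuous_on_Pair; simp)

text \<open>What the particle equation uses of the free field. Smallness of the data appears as
  \<open>b < mb\<close>; one constant \<open>C\<close> serves both derivatives and the Lipschitz
  modulus of \<open>d1 V\<close>.\<close>

locale dynamics =
  fixes mb a b C :: real and V :: "real \<times> real \<Rightarrow> real"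
  assumes a: "a \<noteq> 0" and V_smooth: "smooth V" and b: "b < mb" and V_b: "\<bar>a * V x\<bar> \<le> b"
    and d0_b: "\<bar>d0 V x\<bar> \<le> C" and d1_b: "\<bar>d1 V x\<bar> \<le> C"
    and d1_lip: "\<bar>d1 V (t, y) - d1 V (t, y')\<bar> \<le> C * \<bar>y - y'\<bar>"
begin

lemma C_nonneg: "C \<ge> 0"
  using d0_b[of 0] by linarith

lemma V_lip: "\<bar>V (t, y) - V (t, y')\<bar> \<le> C * \<bar>y - y'\<bar>" "\<bar>V (t, y) - V (t', y)\<bar> \<le> C * \<bar>t - t'\<bar>"
proof -
  have "norm (V (t, y) - V (t, y')) \<le> C * norm (y - y')"
    by (rule field_differentiable_bound[of UNIV _ "\<lambda>y. d1 V (t, y)"])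
      (auto simp: d1_b intro: smooth_plane_partials[OF V_smooth])
  then show "\<bar>V (t, y) - V (t, y')\<bar> \<le> C * \<bar>y - y'\<bar>" by simp
  have "norm (V (t, y) - V (t', y)) \<le> C * norm (t - t')"
    by (rule field_differentiable_bound[of UNIV _ "\<lambda>t. d0 V (t, y)"])
      (auto simp: d0_b intro: smooth_plane_partials[OF V_smooth])
  then show "\<bar>V (t, y) - V (t', y)\<bar> \<le> C * \<bar>t - t'\<bar>" by simp
qed

text \<open>Along a world-line the mass depends on the field only through \<open>V\<close> and the accumulated
  difference \<open>i\<close> of coordinate time and proper time.\<close>

definition mass :: "real \<Rightarrow> real \<Rightarrow> real \<Rightarrow> real" where
  "mass t z i = mb - a * V (t, z) + a\<^sup>2 / 2 * i"

definition m0 :: real where "m0 = mb - b"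

lemma m0_pos: "m0 > 0"
  using b by (simp add: m0_def)

text \<open>The self-field enters with the square of \<open>a\<close>, so it can only raise the
  mass, whatever the sign of the charge; \<open>V\<close> lowers it by at most
  \<open>b\<close>.\<close>

lemma mass_ge:
  assumes "i \<ge> 0"
  shows "mass t z i \<ge> m0"
proof -
  have "a\<^sup>2 / 2 * i \<ge> 0" using assms by simp
  then show ?thesis using V_b[of "(t, z)"] unfolding mass_def m0_def by linarith
qed

lemma mass_continuous [continuous_intros]:
  assumes "continuous_on S f" "continuous_on S g" "continuous_on S h"
  shows "continuous_on S (\<lambda>x. mass (f x) (g x) (h x))"
  unfolding mass_def
  by (intro continuous_intros assms continuous_on_compose2[OF smooth_plane_continuous[OF V_smooth, of UNIV]]) auto

lemma mass_diff: "\<bar>mass t z i - mass t z' i'\<bar> \<le> \<bar>a\<bar> * C * \<bar>z - z'\<bar> + a\<^sup>2 / 2 * \<bar>i - i'\<bar>"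
proof -
  have "mass t z i - mass t z' i' = a * (V (t, z') - V (t, z)) + a\<^sup>2 / 2 * (i - i')"
    by (simp add: mass_def algebra_simps diff_divide_distrib)
  also have "\<bar>\<dots>\<bar> \<le> \<bar>a * (V (t, z') - V (t, z))\<bar> + \<bar>a\<^sup>2 / 2 * (i - i')\<bar>"
    by (rule abs_triangle_ineq)
  also have "\<bar>a * (V (t, z') - V (t, z))\<bar> \<le> \<bar>a\<bar> * (C * \<bar>z - z'\<bar>)"
    unfolding abs_mult using V_lip(1)[of t z' z] by (intro mult_left_mono) (auto simp: abs_minus_commute)
  finally show ?thesis by (simp add: abs_mult)
qed

definition velo :: "real \<Rightarrow> real \<Rightarrow> real" where
  "velo m p = p / sqrt (m\<^sup>2 + p\<^sup>2)"

definition rate :: "real \<Rightarrow> real \<Rightarrow> real" where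
  "rate m p = m / sqrt (m\<^sup>2 + p\<^sup>2)"

text \<open>The truncation of the mass at \<open>m0\<close> makes the vector field globally Lipschitz; it is inactive
  along solutions by \<open>mass_ge\<close>.\<close>

definition rhs :: "real \<Rightarrow> real \<times> real \<times> real \<Rightarrow> real \<times> real \<times> real" where
  "rhs t = (\<lambda>(z, p, i). (velo (max m0 (mass t z i)) p,
     - (a\<^sup>2 / 2) * velo (max m0 (mass t z i)) p + a * rate (max m0 (mass t z i)) p * d1 V (t, z),
     1 - rate (max m0 (mass t z i)) p))"

lemma velo_rate_le: "\<bar>velo m p\<bar> \<le> 1" "\<bar>rate m p\<bar> \<le> 1"
  using abs_le_hypot by (simp_all add: velo_def rate_def)

lemma velo_rate_square:
  assumes "m > 0"
  shows "(rate m p)\<^sup>2 + (velo m p)\<^sup>2 = 1"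
proof -
  have "m\<^sup>2 / (m\<^sup>2 + p\<^sup>2) + p\<^sup>2 / (m\<^sup>2 + p\<^sup>2) = 1"
    unfolding add_divide_distrib[symmetric] using hypot_pos[OF assms, of p] by auto
  then show ?thesis
    using hypot_pos[OF assms, of p] by (simp add: rate_def velo_def power_divide)
qed

lemma velo_rate_continuous [continuous_intros]:
  assumes "continuous_on S f" "continuous_on S g" "\<And>x. x \<in> S \<Longrightarrow> f x > 0"
  shows "continuous_on S (\<lambda>x. velo (f x) (g x))" "continuous_on S (\<lambda>x. rate (f x) (g x))"
  unfolding velo_def rate_def using hypot_pos[OF assms(3)]
  by (intro continuous_intros assms; force)+

lemma rhs_bound: "norm (rhs t y) \<le> 1 + (a\<^sup>2 / 2 + \<bar>a\<bar> * C) + 2"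
proof -
  obtain z p i where y: "y = (z, p, i)" by (cases y)
  define m where "m = max m0 (mass t z i)"
  have 1: "\<bar>velo m p\<bar> \<le> 1" "\<bar>rate m p\<bar> \<le> 1" by (rule velo_rate_le)+
  have "\<bar>- (a\<^sup>2 / 2) * velo m p + a * rate m p * d1 V (t, z)\<bar> \<le> \<bar>- (a\<^sup>2 / 2) * velo m p\<bar> + \<bar>a * rate m p * d1 V (t, z)\<bar>"
    by (rule abs_triangle_ineq)
  also have "\<dots> = a\<^sup>2 / 2 * \<bar>velo m p\<bar> + \<bar>a\<bar> * (\<bar>rate m p\<bar> * \<bar>d1 V (t, z)\<bar>)"
    by (simp add: abs_mult)
  also have "\<dots> \<le> a\<^sup>2 / 2 * 1 + \<bar>a\<bar> * (1 * C)"
    using C_nonneg by (intro add_mono mult_left_mono mult_mono 1 d1_b) auto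
  finally have 2: "\<bar>- (a\<^sup>2 / 2) * velo m p + a * rate m p * d1 V (t, z)\<bar> \<le> a\<^sup>2 / 2 + \<bar>a\<bar> * C" by simp
  have "norm (rhs t y) \<le> \<bar>velo m p\<bar> + (\<bar>- (a\<^sup>2 / 2) * velo m p + a * rate m p * d1 V (t, z)\<bar> + \<bar>1 - rate m p\<bar>)"
    unfolding rhs_def y m_def[symmetric] prod.case
    by (rule order_trans[OF norm_Pair_le]) (auto intro: order_trans[OF norm_Pair_le])
  then show ?thesis using 1 2 by linarith
qed

text \<open>\<open>A\<close> bounds the change of mass and momentum per unit of
  \<open>norm (y - y')\<close>, \<open>Q\<close> is the resulting Lipschitz constant of
  \<open>velo\<close> and \<open>rate\<close>, and \<open>Q * C + C\<close> comes from the product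
  of \<open>rate\<close> and \<open>d1 V\<close> in the force.\<close>

lemma rhs_lipschitz:
  defines "A \<equiv> \<bar>a\<bar> * C + a\<^sup>2 / 2 + 1"
  defines "Q \<equiv> 2 / m0 * A"
  shows "norm (rhs t y - rhs t y') \<le> (Q + (a\<^sup>2 / 2 * Q + \<bar>a\<bar> * (Q * C + C)) + Q) * norm (y - y')"
proof -
  obtain z p i where y: "y = (z, p, i)" by (cases y)
  obtain z' p' i' where y': "y' = (z', p', i')" by (cases y')
  define D where "D = norm (y - y')"
  define m where "m = max m0 (mass t z i)"
  define m' where "m' = max m0 (mass t z' i')"
  have D: "\<bar>z - z'\<bar> \<le> D" "\<bar>p - p'\<bar> \<le> D" "\<bar>i - i'\<bar> \<le> D"
  proof -
    have "norm (p - p', i - i') \<le> D"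
      unfolding D_def y y' by (simp add: norm_snd_le)
    then show "\<bar>p - p'\<bar> \<le> D" "\<bar>i - i'\<bar> \<le> D"
      using norm_fst_le[of "p - p'" "i - i'"] norm_snd_le[of "i - i'" "p - p'"] by auto
    show "\<bar>z - z'\<bar> \<le> D"
      unfolding D_def y y' using norm_fst_le[of "z - z'" "(p - p', i - i')"] by simp
  qed
  have D0: "D \<ge> 0" by (simp add: D_def)
  have "\<bar>m - m'\<bar> \<le> \<bar>mass t z i - mass t z' i'\<bar>"
    by (auto simp: m_def m'_def max_def abs_if)
  also have "\<dots> \<le> \<bar>a\<bar> * C * D + a\<^sup>2 / 2 * D"
    using C_nonneg by (intro order_trans[OF mass_diff] add_mono mult_left_mono D) auto
  finally have "2 / m0 * (\<bar>m - m'\<bar> + \<bar>p - p'\<bar>) \<le> 2 / m0 * (\<bar>a\<bar> * C * D + a\<^sup>2 / 2 * D + D)"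
    using D(2) m0_pos by (intro mult_left_mono) auto
  also have "\<dots> = Q * D" by (simp add: Q_def A_def algebra_simps)
  finally have Q: "2 / m0 * (\<bar>m - m'\<bar> + \<bar>p - p'\<bar>) \<le> Q * D" .
  have mm: "m0 \<le> m" "m0 \<le> m'" by (auto simp: m_def m'_def)
  have v: "\<bar>velo m p - velo m' p'\<bar> \<le> Q * D" and w: "\<bar>rate m p - rate m' p'\<bar> \<le> Q * D"
    using velocity_diff_le[OF mm m0_pos, of p p'] Q unfolding velo_def rate_def by linarith+
  have "rate m p * d1 V (t, z) - rate m' p' * d1 V (t, z') =
      (rate m p - rate m' p') * d1 V (t, z) + rate m' p' * (d1 V (t, z) - d1 V (t, z'))"
    by (simp add: algebra_simps)
  also have "\<bar>\<dots>\<bar> \<le> \<bar>rate m p - rate m' p'\<bar> * \<bar>d1 V (t, z)\<bar> + \<bar>rate m' p'\<bar> * \<bar>d1 V (t, z) - d1 V (t, z')\<bar>"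
    unfolding abs_mult[symmetric] by (rule abs_triangle_ineq)
  also have "\<dots> \<le> (Q * D) * C + 1 * (C * D)"
  proof (intro add_mono mult_mono w d1_b velo_rate_le)
    show "\<bar>d1 V (t, z) - d1 V (t, z')\<bar> \<le> C * D"
      using d1_lip[of t z z'] mult_left_mono[OF D(1) C_nonneg] by linarith
    show "0 \<le> Q * D" using w by linarith
  qed auto
  finally have f: "\<bar>rate m p * d1 V (t, z) - rate m' p' * d1 V (t, z')\<bar> \<le> (Q * C + C) * D" by (simp add: algebra_simps)
  have "- (a\<^sup>2 / 2) * velo m p + a * rate m p * d1 V (t, z) - (- (a\<^sup>2 / 2) * velo m' p' + a * rate m' p' * d1 V (t, z'))
      = (- (a\<^sup>2 / 2)) * (velo m p - velo m' p') + a * (rate m p * d1 V (t, z) - rate m' p' * d1 V (t, z'))"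
    by (simp add: field_simps)
  also have "\<bar>\<dots>\<bar> \<le> a\<^sup>2 / 2 * \<bar>velo m p - velo m' p'\<bar> + \<bar>a\<bar> * \<bar>rate m p * d1 V (t, z) - rate m' p' * d1 V (t, z')\<bar>"
    by (rule order_trans[OF abs_triangle_ineq]) (simp add: abs_mult)
  also have "\<dots> \<le> a\<^sup>2 / 2 * (Q * D) + \<bar>a\<bar> * ((Q * C + C) * D)"
    by (intro add_mono mult_left_mono v f) auto
  finally have 2: "\<bar>- (a\<^sup>2 / 2) * velo m p + a * rate m p * d1 V (t, z) - (- (a\<^sup>2 / 2) * velo m' p' + a * rate m' p' * d1 V (t, z'))\<bar>
      \<le> a\<^sup>2 / 2 * (Q * D) + \<bar>a\<bar> * ((Q * C + C) * D)" .
  have "norm (rhs t y - rhs t y') \<le> \<bar>velo m p - velo m' p'\<bar> +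
      (\<bar>- (a\<^sup>2 / 2) * velo m p + a * rate m p * d1 V (t, z) - (- (a\<^sup>2 / 2) * velo m' p' + a * rate m' p' * d1 V (t, z'))\<bar>
      + \<bar>(1 - rate m p) - (1 - rate m' p')\<bar>)"
    unfolding rhs_def y y' m_def[symmetric] m'_def[symmetric] prod.case diff_Pair
    by (rule order_trans[OF norm_Pair_le], rule add_mono) (auto simp del: diff_diff_eq2 intro: order_trans[OF norm_Pair_le])
  also have "\<dots> \<le> Q * D + ((a\<^sup>2 / 2 * (Q * D) + \<bar>a\<bar> * ((Q * C + C) * D)) + Q * D)"
    using v w 2 by (intro add_mono) auto
  also have "\<dots> = (Q + (a\<^sup>2 / 2 * Q + \<bar>a\<bar> * (Q * C + C)) + Q) * D"
    by (simp add: algebra_simps)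
  finally show ?thesis by (simp add: D_def)
qed

lemma rhs_continuous: "continuous_on UNIV (\<lambda>(t, y). rhs t y)"
proof -
  have pos: "max m0 (mass t z i) > 0" for t z i using m0_pos by simp
  show ?thesis
    unfolding rhs_def case_prod_beta
    by (intro continuous_intros pos continuous_on_compose2[OF smooth_plane_continuous[OF smooth_d1[OF V_smooth], of UNIV]]) auto
qed

lemma lipschitz_ode_rhs: "\<exists>C L. lipschitz_ode rhs C L"
proof -
  define Q where "Q = 2 / m0 * (\<bar>a\<bar> * C + a\<^sup>2 / 2 + 1)"
  have Q: "Q \<ge> 0" unfolding Q_def using m0_pos C_nonneg by (intro mult_nonneg_nonneg add_nonneg_nonneg) auto
  have "lipschitz_ode rhs (1 + (a\<^sup>2 / 2 + \<bar>a\<bar> * C) + 2) (Q + (a\<^sup>2 / 2 * Q + \<bar>a\<bar> * (Q * C + C)) + Q)"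
  proof
    show "continuous_on ({0..} \<times> UNIV) (\<lambda>(t, y). rhs t y)"
      by (rule continuous_on_subset[OF rhs_continuous]) simp
    show "norm (rhs t x - rhs t y) \<le> (Q + (a\<^sup>2 / 2 * Q + \<bar>a\<bar> * (Q * C + C)) + Q) * norm (x - y)" for t x y
      using rhs_lipschitz unfolding Q_def .
    show "0 \<le> Q + (a\<^sup>2 / 2 * Q + \<bar>a\<bar> * (Q * C + C)) + Q"
      using Q C_nonneg by (intro add_nonneg_nonneg mult_nonneg_nonneg) auto
  qed (rule rhs_bound)
  then show ?thesis by blast
qed

end

text \<open>Solutions of the particle system with the true mass instead of the truncated one. The
  third unknown \<open>i\<close> takes the place of the field.\<close>

locale trajectory = dynamics +
  fixes z p i m :: "real \<Rightarrow> real"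
  assumes m_eq: "m = (\<lambda>s. mass s (z s) (i s))"
    and z_cont: "continuous_on {0..} z" and p_cont: "continuous_on {0..} p" and i_cont: "continuous_on {0..} i"
    and z_int: "t \<ge> 0 \<Longrightarrow> ((\<lambda>s. velo (m s) (p s)) has_integral z t) {0..t}"
    and p_int: "t \<ge> 0 \<Longrightarrow> ((\<lambda>s. - (a\<^sup>2 / 2) * velo (m s) (p s) + a * rate (m s) (p s) * d1 V (s, z s)) has_integral p t) {0..t}"
    and i_int: "t \<ge> 0 \<Longrightarrow> ((\<lambda>s. 1 - rate (m s) (p s)) has_integral i t) {0..t}"
begin

lemma i_nonneg: "t \<ge> 0 \<Longrightarrow> i t \<ge> 0"
  by (rule has_integral_nonneg[OF i_int]) (use velo_rate_le(2) in \<open>auto simp: abs_le_iff\<close>)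

lemma m_ge: "t \<ge> 0 \<Longrightarrow> m t \<ge> m0"
  by (simp add: m_eq mass_ge i_nonneg)

lemma m_pos: "t \<ge> 0 \<Longrightarrow> m t > 0"
  using m_ge[of t] m0_pos by linarith

lemma m_cont: "continuous_on {0..} m"
  unfolding m_eq by (intro continuous_intros z_cont i_cont)

lemma integral_curve_trajectory: "integral_curve rhs (\<lambda>t. (z t, p t, i t))"
  unfolding integral_curve_def continuous_on_triple
proof (intro conjI z_cont p_cont i_cont allI impI)
  fix t :: real assume t: "t \<ge> 0"
  have "((\<lambda>s. (velo (m s) (p s), - (a\<^sup>2 / 2) * velo (m s) (p s) + a * rate (m s) (p s) * d1 V (s, z s),
      1 - rate (m s) (p s))) has_integral (z t, p t, i t)) {0..t}"
    unfolding has_integral_triple using z_int p_int i_int t by blast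
  then show "((\<lambda>s. rhs s (z s, p s, i s)) has_integral (z t, p t, i t)) {0..t}"
    by (rule has_integral_eq[rotated]) (use m_ge in \<open>simp add: rhs_def m_eq max_absorb2\<close>)
qed

lemma z_deriv: "t \<ge> 0 \<Longrightarrow> (z has_real_derivative velo (m t) (p t)) (at t within {0..})"
  and rate_eq: "t \<ge> 0 \<Longrightarrow> proper_rate z t = rate (m t) (p t)"
  using velocity_integral_curve[OF m_cont p_cont m_pos] z_int by (auto simp: velo_def rate_def)

lemma rate_pos: "t \<ge> 0 \<Longrightarrow> rate (m t) (p t) > 0"
  using m_pos[of t] hypot_pos[OF m_pos, of t "p t"] by (simp add: rate_def)

lemma worldline_z: "worldline z"
proof
  show "z 0 = 0" using has_integral_unique[OF z_int[of 0, simplified] has_integral_refl(2)] by simp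
  show "1-lipschitz_on {0..} z"
    by (rule indefinite_integral_lipschitz[OF z_int]) (auto simp: velo_rate_le)
qed

section \<open>Energy balance and the bound on the speed\<close>

definition E :: "real \<Rightarrow> real" where
  "E t = sqrt ((m t)\<^sup>2 + (p t)\<^sup>2)"

lemma E_pos: "t \<ge> 0 \<Longrightarrow> E t > 0"
  unfolding E_def using hypot_pos[OF m_pos] by simp

lemma E_cont: "continuous_on {0..} E"
  unfolding E_def by (intro continuous_intros m_cont p_cont)

lemma E_deriv:
  assumes t: "t > 0"
  shows "(E has_real_derivative - (a\<^sup>2 / 2) * (1 - rate (m t) (p t)) - a * rate (m t) (p t) * d0 V (t, z t)) (at t)"
proof -
  define v where "v = velo (m t) (p t)"
  define w where "w = rate (m t) (p t)"
  have at: "at t within {0..} = at t"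
    using t by (intro at_within_interior) simp
  have t0: "t \<ge> 0" using t by simp
  have m_pos': "\<And>s. s \<in> {0..} \<Longrightarrow> m s > 0" using m_pos by simp
  have z: "(z has_real_derivative v) (at t)"
    using z_deriv[OF t0] by (simp add: at v_def)
  have "continuous_on {0..} (\<lambda>s. 1 - rate (m s) (p s))"
    by (intro continuous_intros m_cont p_cont m_pos')
  from indefinite_integral_deriv[OF i_int this t0]
  have i: "(i has_real_derivative 1 - w) (at t)" by (simp add: at w_def)
  have "continuous_on {0..} (\<lambda>s. - (a\<^sup>2 / 2) * velo (m s) (p s) + a * rate (m s) (p s) * d1 V (s, z s))"
    by (intro continuous_intros m_cont p_cont m_pos' continuous_on_compose2[OF smooth_plane_continuous[OF smooth_d1[OF V_smooth], of UNIV]] z_cont) auto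
  from indefinite_integral_deriv[OF p_int this t0]
  have p: "(p has_real_derivative - (a\<^sup>2 / 2) * v + a * w * d1 V (t, z t)) (at t)"
    by (simp add: at v_def w_def)
  have "((\<lambda>s. V (s, z s)) has_real_derivative 1 * d0 V (t, z t) + v * d1 V (t, z t)) (at t)"
    by (rule smooth_plane_chain[OF V_smooth _ z]) auto
  then have m: "(m has_real_derivative - a * (d0 V (t, z t) + v * d1 V (t, z t)) + a\<^sup>2 / 2 * (1 - w)) (at t)"
    unfolding m_eq mass_def by (auto intro!: derivative_eq_intros i)
  have "(E has_real_derivative (inverse (E t) / 2) * (2 * m t * (- a * (d0 V (t, z t) + v * d1 V (t, z t)) + a\<^sup>2 / 2 * (1 - w)) +
      2 * p t * (- (a\<^sup>2 / 2) * v + a * w * d1 V (t, z t)))) (at t)"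
    unfolding E_def
    by (rule DERIV_chain2[OF DERIV_real_sqrt])
      (use hypot_pos[OF m_pos[OF t0], of "p t"] in \<open>auto intro!: derivative_eq_intros m p\<close>)
  also have "(inverse (E t) / 2) * (2 * m t * (- a * (d0 V (t, z t) + v * d1 V (t, z t)) + a\<^sup>2 / 2 * (1 - w)) +
      2 * p t * (- (a\<^sup>2 / 2) * v + a * w * d1 V (t, z t)))
      = (m t / E t) * (- a * (d0 V (t, z t) + v * d1 V (t, z t)) + a\<^sup>2 / 2 * (1 - w)) + (p t / E t) * (- (a\<^sup>2 / 2) * v + a * w * d1 V (t, z t))"
    using E_pos[OF t0] by (simp add: field_simps)
  also have "\<dots> = w * (- a * (d0 V (t, z t) + v * d1 V (t, z t)) + a\<^sup>2 / 2 * (1 - w)) + v * (- (a\<^sup>2 / 2) * v + a * w * d1 V (t, z t))"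
    by (simp add: v_def w_def E_def velo_def rate_def)
  \<comment> \<open>The terms with \<open>d1 V\<close> cancel: the contribution
    \<open>v * (a * w * d1 V)\<close> of the force is offset by that of the changing mass.\<close>
  also have "\<dots> = - a * w * d0 V (t, z t) + a\<^sup>2 / 2 * (w - (w\<^sup>2 + v\<^sup>2))"
    by (simp add: field_simps power2_eq_square)
  also have "w\<^sup>2 + v\<^sup>2 = 1"
    unfolding v_def w_def by (rule velo_rate_square[OF m_pos[OF t0]])
  also have "- a * w * d0 V (t, z t) + a\<^sup>2 / 2 * (w - 1) = - (a\<^sup>2 / 2) * (1 - w) - a * w * d0 V (t, z t)"
    by (simp add: field_simps)
  finally show ?thesis by (simp only: w_def)
qed

end

context trajectory
begin

lemma i_mono:
  assumes "0 \<le> s" "s \<le> t"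
  shows "i s \<le> i t"
proof -
  have "integral {0..s} (\<lambda>s. 1 - rate (m s) (p s)) \<le> integral {0..t} (\<lambda>s. 1 - rate (m s) (p s))"
    using assms i_int[of s] i_int[of t] velo_rate_le(2)
    by (intro integral_subset_le) (auto simp: abs_le_iff)
  then show ?thesis
    using assms i_int[of s] i_int[of t] by (simp add: integral_unique)
qed

text \<open>With \<open>M = mb + a\<^sup>2 / 2 * i s\<close> the later mass is at least
  \<open>M - b\<close> and the earlier one at most \<open>M + b\<close>. The quotient of these
  increases with \<open>M \<ge> mb\<close>, so its value at \<open>mb\<close> is a bound uniform in
  time, even if the mass grows without limit.\<close>

lemma mass_ratio:
  assumes "0 \<le> s" "s \<le> t"
  shows "m t \<ge> m0 / (mb + b) * m s"
proof -
  have b0: "b \<ge> 0" using V_b[of 0] by linarith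
  have "a\<^sup>2 / 2 * i s \<ge> 0" using i_nonneg[OF assms(1)] by simp
  moreover have "a\<^sup>2 / 2 * i s \<le> a\<^sup>2 / 2 * i t"
    by (intro mult_left_mono i_mono assms) simp
  moreover define M where "M = mb + a\<^sup>2 / 2 * i s"
  ultimately have *: "m t \<ge> M - b" "m s \<le> M + b" "M \<ge> mb"
    using V_b[of "(t, z t)"] V_b[of "(s, z s)"] unfolding m_eq mass_def by linarith+
  have "m0 * m s \<le> m0 * (M + b)"
    using * m0_pos by (intro mult_left_mono) auto
  also have "\<dots> \<le> (M - b) * (mb + b)"
    using mult_left_mono[OF *(3) b0] by (simp add: m0_def algebra_simps)
  also have "\<dots> \<le> m t * (mb + b)"
    using * b b0 by (intro mult_right_mono) auto
  finally show ?thesis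
    using b b0 by (simp add: field_simps)
qed

text \<open>As long as \<open>rate\<close> stays below the threshold \<open>k / (k + D)\<close>, friction dominates and the energy
  \<open>E\<close> does not increase; since \<open>rate = m / E\<close> and \<open>m\<close> cannot drop by more than a fixed factor,
  \<open>rate\<close> cannot drop much further.\<close>

lemma rate_lower_bound: "\<exists>c>0. \<forall>t\<ge>0. c \<le> rate (m t) (p t)"
proof -
  define k where "k = a\<^sup>2 / 2"
  define D where "D = \<bar>a\<bar> * C"
  have k: "k > 0" and D: "D \<ge> 0"
    using a C_nonneg by (auto simp: k_def D_def)
  \<comment> \<open>Chosen so that \<open>w * (k + D) = k\<close>: at rate \<open>q\<close> the
    energy satisfies \<open>E' \<le> q * (k + D) - k\<close>, and this bound changes sign at
    \<open>w\<close>.\<close>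
  define w where "w = k / (k + D)"
  have w: "w > 0" "w \<le> 1" "w * (k + D) = k"
    using k D by (auto simp: w_def field_simps)
  define \<kappa> where "\<kappa> = m0 / (mb + b)"
  have b0: "b \<ge> 0" using V_b[of 0] by linarith
  have \<kappa>: "\<kappa> > 0" "\<kappa> \<le> 1"
    using b b0 m0_pos by (auto simp: \<kappa>_def m0_def)
  have m_pos': "\<And>s. s \<in> {0..} \<Longrightarrow> m s > 0" using m_pos by simp
  have cont: "continuous_on {0..} (\<lambda>s. rate (m s) (p s))"
    by (intro continuous_intros m_cont p_cont m_pos')
  have "\<kappa> * w \<le> rate (m t) (p t)" if t: "t \<ge> 0" for t
  proof (cases "w \<le> rate (m t) (p t)")
    case True
    have "\<kappa> * w \<le> 1 * w" using \<kappa> w by (intro mult_right_mono) auto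
    then show ?thesis using True by simp
  next
    case False
    \<comment> \<open>Its maximum \<open>r\<close> is the last time up to \<open>t\<close> at which
      the rate is at least \<open>w\<close>; the set is nonempty because the particle starts at
      rest, with rate 1.\<close>
    define S where "S = {0..t} \<inter> (\<lambda>s. rate (m s) (p s)) -` {w..}"
    have "compact S"
      unfolding S_def compact_eq_bounded_closed
      by (intro conjI continuous_closed_preimage bounded_Int disjI1) (auto intro: continuous_on_subset[OF cont])
    moreover have "0 \<in> S"
    proof -
      have "p 0 = 0" using has_integral_unique[OF p_int[of 0, simplified] has_integral_refl(2)] by simp
      then show ?thesis using m_pos[of 0] t w by (simp add: S_def rate_def)
    qed
    ultimately obtain r where r: "r \<in> S" "\<And>s. s \<in> S \<Longrightarrow> s \<le> r"
      using compact_attains_sup[of S] by blast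
    have r0: "0 \<le> r" "r \<le> t" "w \<le> rate (m r) (p r)" using r(1) by (auto simp: S_def)
    have below: "rate (m s) (p s) < w" if "r < s" "s \<le> t" for s
      using r(2)[of s] that r0(1) by (force simp: S_def)
    have "E t \<le> E r"
    proof (rule DERIV_nonpos_imp_decreasing_open[OF r0(2)])
      show "continuous_on {r..t} E"
        by (rule continuous_on_subset[OF E_cont]) (use r0 in auto)
      fix s assume s: "r < s" "s < t"
      then have s0: "s > 0" using r0 by simp
      define q where "q = rate (m s) (p s)"
      have q: "q > 0" "q \<le> w"
        using rate_pos[of s] below[of s] s s0 by (auto simp: q_def)
      have "\<bar>a * q * d0 V (s, z s)\<bar> = q * (\<bar>a\<bar> * \<bar>d0 V (s, z s)\<bar>)"
        using q by (simp add: abs_mult)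
      also have "\<dots> \<le> q * D"
        unfolding D_def using q by (intro mult_left_mono d0_b) auto
      finally have "- k * (1 - q) - a * q * d0 V (s, z s) \<le> q * (k + D) - k"
        by (simp add: algebra_simps abs_le_iff)
      also have "\<dots> \<le> w * (k + D) - k"
        using q k D by (intro diff_right_mono mult_right_mono) auto
      finally have "- k * (1 - q) - a * q * d0 V (s, z s) \<le> 0" using w by simp
      then show "\<exists>y. (E has_real_derivative y) (at s) \<and> y \<le> 0"
        using E_deriv[OF s0] by (auto simp: k_def q_def)
    qed
    moreover have "E r * w \<le> m r"
    proof -
      have "E r * w \<le> E r * rate (m r) (p r)"
        using r0 E_pos[of r] by (intro mult_left_mono) auto
      then show ?thesis using E_pos[OF r0(1)] unfolding rate_def E_def[symmetric] by simp
    qed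
    ultimately have "E t * w \<le> m r"
      using w mult_right_mono[of "E t" "E r" w] by linarith
    then have "\<kappa> * (E t * w) \<le> \<kappa> * m r"
      using \<kappa> by (intro mult_left_mono) auto
    also have "\<dots> \<le> m t"
      using mass_ratio[OF r0(1,2)] by (simp add: \<kappa>_def)
    finally show ?thesis
      using E_pos[OF t] by (simp add: rate_def E_def field_simps)
  qed
  then show ?thesis
    using \<kappa> w by (intro exI[of _ "\<kappa> * w"]) auto
qed

lemma subluminal:
  obtains \<nu> where "\<nu> < 1" "\<And>s t. 0 \<le> s \<Longrightarrow> 0 \<le> t \<Longrightarrow> \<bar>z t - z s\<bar> \<le> \<nu> * \<bar>t - s\<bar>"
proof -
  obtain c where c: "c > 0" "\<And>t. t \<ge> 0 \<Longrightarrow> c \<le> rate (m t) (p t)"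
    using rate_lower_bound by blast
  have c1: "c\<^sup>2 \<le> 1"
    using c(2)[of 0] velo_rate_le(2)[of "m 0" "p 0"] c(1) by (simp add: abs_square_le_1)
  define \<nu> where "\<nu> = sqrt (1 - c\<^sup>2)"
  have \<nu>: "\<nu> < 1" "\<nu> \<ge> 0" using c c1 by (auto simp: \<nu>_def)
  have "\<bar>velo (m t) (p t)\<bar> \<le> \<nu>" if t: "t \<ge> 0" for t
  proof -
    have "(velo (m t) (p t))\<^sup>2 = 1 - (rate (m t) (p t))\<^sup>2"
      using velo_rate_square[OF m_pos[OF t], of "p t"] by simp
    also have "\<dots> \<le> 1 - c\<^sup>2"
      using c(1) c(2)[OF t] by (simp add: power_mono)
    finally show ?thesis
      unfolding \<nu>_def by (metis real_sqrt_abs real_sqrt_le_mono)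
  qed
  then have "\<nu>-lipschitz_on {0..} z"
    using indefinite_integral_lipschitz[OF z_int] \<nu>(2) by blast
  then have "\<bar>z t - z s\<bar> \<le> \<nu> * \<bar>t - s\<bar>" if "0 \<le> s" "0 \<le> t" for s t
    using lipschitz_onD[of \<nu> "{0..}" z t s] that by (simp add: dist_real_def)
  then show ?thesis using \<nu>(1) that by blast
qed

lemma full_field_lipschitz: "\<exists>K. K-lipschitz_on ({0..} \<times> UNIV) (full_field a V z)"
proof -
  obtain W where W: "source (proper_rate z) (\<lambda>t. z (max 0 t)) W"
    using worldline.source_proper_rate[OF worldline_z] by blast
  obtain \<nu> where \<nu>: "\<nu> < 1" "\<And>s t. 0 \<le> s \<Longrightarrow> 0 \<le> t \<Longrightarrow> \<bar>z t - z s\<bar> \<le> \<nu> * \<bar>t - s\<bar>"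
    using subluminal by blast
  define S where "S = source_field (proper_rate z) (\<lambda>t. z (max 0 t))"
  define B where "B = 2 * W / (1 - \<nu>)"
  have B: "B \<ge> 0" using source.W_nonneg[OF W] \<nu>(1) by (simp add: B_def)
  \<comment> \<open>The summands come from \<open>V\<close>, the static field and the source field;
    both light-cone coordinates change by at most twice the distance, which accounts for the factors
    4.\<close>
  define K where "K = 2 * C + \<bar>a\<bar> / 4 * 4 + \<bar>a\<bar> / 2 * (B * 4)"
  show ?thesis
  proof (intro exI lipschitz_onI)
    show "K \<ge> 0" unfolding K_def using C_nonneg B by (intro add_nonneg_nonneg mult_nonneg_nonneg) auto
    fix x y :: "real \<times> real"
    define d where "d = dist x y"
    have d: "\<bar>fst x - fst y\<bar> \<le> d" "\<bar>snd x - snd y\<bar> \<le> d"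
      using dist_fst_le[of x y] dist_snd_le[of x y] by (auto simp: d_def dist_real_def)
    then have uv: "\<bar>(fst x + snd x) - (fst y + snd y)\<bar> \<le> 2 * d" "\<bar>(fst x - snd x) - (fst y - snd y)\<bar> \<le> 2 * d"
      by linarith+
    have V: "\<bar>V x - V y\<bar> \<le> 2 * C * d"
    proof -
      have "\<bar>V x - V y\<bar> \<le> C * \<bar>fst x - fst y\<bar> + C * \<bar>snd x - snd y\<bar>"
        using V_lip(2)[of "fst x" "snd x" "fst y"] V_lip(1)[of "fst y" "snd x" "snd y"] by simp
      also have "\<dots> \<le> C * d + C * d"
        using C_nonneg d by (intro add_mono mult_left_mono) auto
      finally show ?thesis by simp
    qed
    have "\<bar>S x - S y\<bar> \<le> B * (\<bar>(fst x + snd x) - (fst y + snd y)\<bar> + \<bar>(fst x - snd x) - (fst y - snd y)\<bar>)"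
      unfolding S_def B_def using \<nu> by (intro source.source_field_lipschitz[OF W]) (auto simp: max_absorb2)
    also have "\<dots> \<le> B * (4 * d)"
      using uv B by (intro mult_left_mono) auto
    finally have S_le: "\<bar>a / 2 * (S x - S y)\<bar> \<le> \<bar>a\<bar> / 2 * (B * (4 * d))"
      unfolding abs_mult by (intro mult_mono) auto
    have stat_le: "\<bar>a / 4 * ((\<bar>fst x + snd x\<bar> + \<bar>fst x - snd x\<bar>) - (\<bar>fst y + snd y\<bar> + \<bar>fst y - snd y\<bar>))\<bar> \<le> \<bar>a\<bar> / 4 * (4 * d)"
      unfolding abs_mult using uv by (intro mult_mono) auto
    have diff_eq: "full_field a V z x - full_field a V z y = (V x - V y)
        - a / 4 * ((\<bar>fst x + snd x\<bar> + \<bar>fst x - snd x\<bar>) - (\<bar>fst y + snd y\<bar> + \<bar>fst y - snd y\<bar>)) + a / 2 * (S x - S y)"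
      by (simp add: full_field_def S_def algebra_simps)
    have triangle: "\<bar>r - s + t\<bar> \<le> r' + s' + t'" if "\<bar>r\<bar> \<le> r'" "\<bar>s\<bar> \<le> s'" "\<bar>t\<bar> \<le> t'" for r s t r' s' t' :: real
      using that by linarith
    have "\<bar>full_field a V z x - full_field a V z y\<bar> \<le> 2 * C * d + \<bar>a\<bar> / 4 * (4 * d) + \<bar>a\<bar> / 2 * (B * (4 * d))"
      unfolding diff_eq by (rule triangle[OF V stat_le S_le])
    then show "dist (full_field a V z x) (full_field a V z y) \<le> K * dist x y"
      by (simp add: dist_real_def K_def d_def[symmetric] algebra_simps)
  qed
qed

text \<open>Here the loop closes: the mass prescribed in the particle system is the one that the
  field of the resulting world-line generates.\<close>

lemma dyn_mass_full_field:
  assumes "t \<ge> 0"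
  shows "dyn_mass mb a (full_field a V z) z t = m t"
proof -
  have "((\<lambda>s. 1 - proper_rate z s) has_integral i t) {0..t}"
    by (rule has_integral_eq[OF _ i_int[OF assms]]) (simp add: rate_eq)
  then show ?thesis
    unfolding dyn_mass_def worldline.full_field_worldline[OF worldline_z assms]
    by (simp add: integral_unique m_eq mass_def power2_eq_square algebra_simps)
qed

lemma joint_solution_trajectory:
  assumes "free_wave V0 V1 V" "smooth V0" "smooth V1"
  shows "joint_solution mb a V0 V1 V (full_field a V z) z p"
  unfolding joint_solution_def
proof (intro conjI full_field_lipschitz worldline.full_field_weak[OF worldline_z assms])
  show "\<exists>L. L-lipschitz_on {0..} z"
    using worldline.lipschitz[OF worldline_z] by blast
  have 0: "z 0 = 0" "p 0 = 0"
    using worldline.start[OF worldline_z] has_integral_unique[OF p_int[of 0, simplified] has_integral_refl(2)] by auto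
  show "particle_motion mb a V (full_field a V z) z p"
    unfolding particle_motion_def Let_def 0 diff_zero
  proof (intro conjI allI impI refl)
    fix t :: real assume t: "t \<ge> 0"
    show "((\<lambda>s. p s / sqrt ((dyn_mass mb a (full_field a V z) z s)\<^sup>2 + (p s)\<^sup>2)) has_integral z t) {0..t}"
      by (rule has_integral_eq[OF _ z_int[OF t]]) (simp add: dyn_mass_full_field velo_def)
    show "((\<lambda>s. - (a\<^sup>2 / 2) * (p s / sqrt ((dyn_mass mb a (full_field a V z) z s)\<^sup>2 + (p s)\<^sup>2)) +
        a * (dyn_mass mb a (full_field a V z) z s / sqrt ((dyn_mass mb a (full_field a V z) z s)\<^sup>2 + (p s)\<^sup>2)) * d1 V (s, z s))
        has_integral p t) {0..t}"
      by (rule has_integral_eq[OF _ p_int[OF t]]) (simp add: dyn_mass_full_field velo_def rate_def)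
  qed
qed

end

section \<open>Existence and uniqueness for the joint problem\<close>

context dynamics
begin

lemma trajectory_exists: "\<exists>z p i. trajectory mb a b C V z p i (\<lambda>s. mass s (z s) (i s))"
proof -
  obtain B L where "lipschitz_ode rhs B L" using lipschitz_ode_rhs by blast
  then obtain y where y: "integral_curve rhs y"
    using lipschitz_ode.integral_curve_exists by blast
  define z where "z t = fst (y t)" for t
  define p where "p t = fst (snd (y t))" for t
  define i where "i t = snd (snd (y t))" for t
  have y_eq: "y = (\<lambda>t. (z t, p t, i t))" by (simp add: z_def p_def i_def)
  let ?M = "\<lambda>s. max m0 (mass s (z s) (i s))"
  have cont: "continuous_on {0..} z" "continuous_on {0..} p" "continuous_on {0..} i"
    using y unfolding y_eq integral_curve_def continuous_on_triple by auto
  have "((\<lambda>s. (velo (?M s) (p s), - (a\<^sup>2 / 2) * velo (?M s) (p s) + a * rate (?M s) (p s) * d1 V (s, z s),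
      1 - rate (?M s) (p s))) has_integral (z t, p t, i t)) {0..t}" if "t \<ge> 0" for t
    using y that unfolding y_eq integral_curve_def rhs_def prod.case by blast
  then have int: "((\<lambda>s. velo (?M s) (p s)) has_integral z t) {0..t}"
    "((\<lambda>s. - (a\<^sup>2 / 2) * velo (?M s) (p s) + a * rate (?M s) (p s) * d1 V (s, z s)) has_integral p t) {0..t}"
    "((\<lambda>s. 1 - rate (?M s) (p s)) has_integral i t) {0..t}" if "t \<ge> 0" for t
    using that unfolding has_integral_triple by blast+
  \<comment> \<open>This follows from \<open>rate \<le> 1\<close> for the truncated system already,
    so the truncation can be removed without circularity.\<close>
  have "i t \<ge> 0" if "t \<ge> 0" for t
    by (rule has_integral_nonneg[OF int(3)[OF that]]) (use velo_rate_le(2) in \<open>auto simp: abs_le_iff\<close>)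
  then have M: "?M s = mass s (z s) (i s)" if "s \<ge> 0" for s
    using mass_ge that by (simp add: max_absorb2)
  have "trajectory mb a b C V z p i (\<lambda>s. mass s (z s) (i s))"
  proof
    fix t :: real assume t: "t \<ge> 0"
    show "((\<lambda>s. velo (mass s (z s) (i s)) (p s)) has_integral z t) {0..t}"
      by (rule has_integral_eq[OF _ int(1)[OF t]]) (simp add: M)
    show "((\<lambda>s. - (a\<^sup>2 / 2) * velo (mass s (z s) (i s)) (p s) + a * rate (mass s (z s) (i s)) (p s) * d1 V (s, z s)) has_integral p t) {0..t}"
      by (rule has_integral_eq[OF _ int(2)[OF t]]) (simp add: M)
    show "((\<lambda>s. 1 - rate (mass s (z s) (i s)) (p s)) has_integral i t) {0..t}"
      by (rule has_integral_eq[OF _ int(3)[OF t]]) (simp add: M)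
  qed (use cont in auto)
  then show ?thesis by blast
qed

lemma trajectory_unique:
  assumes "trajectory mb a b C V z p i m" "trajectory mb a b C V z' p' i' m'" "t \<ge> 0"
  shows "z t = z' t" "p t = p' t"
proof -
  obtain B L where "lipschitz_ode rhs B L" using lipschitz_ode_rhs by blast
  from lipschitz_ode.integral_curve_unique[OF this trajectory.integral_curve_trajectory[OF assms(1)]
      trajectory.integral_curve_trajectory[OF assms(2)] assms(3)]
  show "z t = z' t" "p t = p' t" by auto
qed

text \<open>Each step uses only the preceding ones: speed at most 1 identifies \<open>U\<close>, the
  formula for \<open>U\<close> on the world-line makes the mass positive, and positivity equates
  \<open>proper_rate\<close> with \<open>rate\<close>, which is the missing equation for
  \<open>i\<close>.\<close>

lemma joint_solution_imp_trajectory: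
  assumes V: "free_wave V0 V1 V" "smooth V0" "smooth V1" and joint: "joint_solution mb a V0 V1 V U z p"
  shows "\<exists>i. trajectory mb a b C V z p i (\<lambda>s. mass s (z s) (i s))"
    and "x \<in> {0..} \<times> UNIV \<Longrightarrow> U x = full_field a V z x"
proof -
  define M where "M = dyn_mass mb a U z"
  have U_cont: "continuous_on ({0..} \<times> UNIV) U"
    using joint unfolding joint_solution_def by (auto intro: lipschitz_on_continuous_on)
  have "particle_motion mb a V U z p" using joint by (simp add: joint_solution_def)
  then have 0: "z 0 = 0" "p 0 = 0" and
    z_int: "\<And>t. t \<ge> 0 \<Longrightarrow> ((\<lambda>s. velo (M s) (p s)) has_integral z t) {0..t}" and
    p_int: "\<And>t. t \<ge> 0 \<Longrightarrow> ((\<lambda>s. - (a\<^sup>2 / 2) * velo (M s) (p s) + a * rate (M s) (p s) * d1 V (s, z s)) has_integral p t) {0..t}"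
    unfolding particle_motion_def Let_def M_def velo_def rate_def by auto
  have z_cont: "continuous_on {0..} z" and p_cont: "continuous_on {0..} p"
    by (rule indefinite_integral_continuous[OF z_int], assumption)
      (rule indefinite_integral_continuous[OF p_int], assumption)
  have M_cont: "continuous_on {0..} M"
    unfolding M_def dyn_mass_def[abs_def]
    by (intro continuous_intros continuous_on_compose2[OF U_cont] z_cont) auto
  have "1-lipschitz_on {0..} z"
    by (rule indefinite_integral_lipschitz[OF z_int]) (auto simp: velo_rate_le)
  then interpret worldline z using 0 by unfold_locales
  show U: "U x = full_field a V z x" if "x \<in> {0..} \<times> UNIV" for x
    using joint that by (intro full_field_unique[OF V U_cont]) (auto simp: joint_solution_def)
  define i where "i t = integral {0..t} (\<lambda>s. 1 - proper_rate z s)" for t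
  have rate_int: "(\<lambda>s. 1 - proper_rate z s) integrable_on {0..t}" if "t \<ge> 0" for t
    using that by (intro integrable_diff proper_rate_integral) auto
  have M_eq: "M t = mass t (z t) (i t)" if "t \<ge> 0" for t
    using that by (simp add: M_def dyn_mass_def U full_field_worldline i_def mass_def power2_eq_square algebra_simps)
  have M_pos: "M t > 0" if "t \<ge> 0" for t
  proof -
    \<comment> \<open>Only \<open>proper_rate \<le> 1\<close> is available here; its identification
      with \<open>rate\<close> relies on the positivity being shown.\<close>
    have "i t \<ge> 0"
      unfolding i_def using proper_rate_le_1 by (intro integral_nonneg rate_int that) (auto simp: algebra_simps)
    then show ?thesis using mass_ge[of "i t" t "z t"] m0_pos M_eq[OF that] by linarith
  qed
  have rate_eq: "proper_rate z t = rate (M t) (p t)" if "t \<ge> 0" for t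
    using velocity_integral_curve(2)[OF M_cont p_cont M_pos _ that, of z] z_int by (simp add: velo_def rate_def)
  have i_int: "((\<lambda>s. 1 - rate (M s) (p s)) has_integral i t) {0..t}" if "t \<ge> 0" for t
    by (rule has_integral_eq[OF _ integrable_integral[OF rate_int[OF that], folded i_def]]) (simp add: rate_eq)
  have "trajectory mb a b C V z p i (\<lambda>s. mass s (z s) (i s))"
  proof
    show "continuous_on {0..} i" by (rule indefinite_integral_continuous[OF i_int])
    fix t :: real assume t: "t \<ge> 0"
    show "((\<lambda>s. velo (mass s (z s) (i s)) (p s)) has_integral z t) {0..t}"
      by (rule has_integral_eq[OF _ z_int[OF t]]) (simp add: M_eq)
    show "((\<lambda>s. - (a\<^sup>2 / 2) * velo (mass s (z s) (i s)) (p s) + a * rate (mass s (z s) (i s)) (p s) * d1 V (s, z s)) has_integral p t) {0..t}"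
      by (rule has_integral_eq[OF _ p_int[OF t]]) (simp add: M_eq)
    show "((\<lambda>s. 1 - rate (mass s (z s) (i s)) (p s)) has_integral i t) {0..t}"
      by (rule has_integral_eq[OF _ i_int[OF t]]) (simp add: M_eq)
  qed (use z_cont p_cont in auto)
  then show "\<exists>i. trajectory mb a b C V z p i (\<lambda>s. mass s (z s) (i s))" by blast
qed

end

section \<open>From small data to bounds on the free field\<close>

lemma smooth_compactly_supported_bounds:
  fixes f :: "real \<Rightarrow> real"
  assumes "smooth f" "compactly_supported f"
  obtains B where "B \<ge> 0" "\<And>x. \<bar>f x\<bar> \<le> B" "\<And>x y. \<bar>f x - f y\<bar> \<le> B * \<bar>x - y\<bar>"
proof -
  have bounded: "\<exists>B. \<forall>x. \<bar>g x\<bar> \<le> B" if g: "smooth g" "compactly_supported g" for g :: "real \<Rightarrow> real"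
  proof -
    have "loc_bdd g" by (intro loc_bdd_continuous smooth_real_continuous g)
    then obtain B where B: "\<forall>x\<in>{x. g x \<noteq> 0}. \<bar>g x\<bar> \<le> B"
      using g(2) by (auto simp: loc_bdd_def compactly_supported_alt)
    have "\<bar>g x\<bar> \<le> max B 0" for x
      using B by (cases "g x = 0") auto
    then show ?thesis by blast
  qed
  obtain B B' where B: "\<And>x. \<bar>f x\<bar> \<le> B" "\<And>x. \<bar>dderiv 1 f x\<bar> \<le> B'"
    using bounded[OF assms] bounded[OF smooth_dderiv[OF assms(1)] compactly_supported_dderiv[OF assms(2)], of 1] by auto
  have "\<bar>f x - f y\<bar> \<le> B' * \<bar>x - y\<bar>" for x y
    using field_differentiable_bound[of UNIV f "dderiv 1 f" B' x y] smooth_real_deriv[OF assms(1)] B(2) by simp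
  then have "\<bar>f x - f y\<bar> \<le> max B B' * \<bar>x - y\<bar>" for x y
    by (rule order_trans) (intro mult_right_mono; simp)
  moreover have "\<bar>f x\<bar> \<le> max B B'" for x
    using B(1)[of x] by simp
  moreover have "max B B' \<ge> 0"
    using B(1)[of 0] by linarith
  ultimately show ?thesis using that by blast
qed

text \<open>The derivatives of \<open>V\<close> are half-sums, up to sign, of \<open>V1\<close> and
  the derivative of \<open>V0\<close> at the feet of the two characteristics, so bounds and
  Lipschitz constants of these compactly supported functions hold for all times.\<close>

lemma small_data_dynamics:
  assumes "a \<noteq> 0" "smooth V0" "compactly_supported V0" "smooth V1" "compactly_supported V1"
    and "esssup lborel (\<lambda>y. ereal \<bar>V0 y\<bar>) + ereal (1 / 2 * (LINT y|lborel. \<bar>V1 y\<bar>)) < ereal (mb / \<bar>a\<bar>)"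
    and free: "free_wave V0 V1 V"
  shows "\<exists>b C. dynamics mb a b C V"
proof -
  obtain b where b: "b < mb" "\<And>x. \<bar>a * V x\<bar> \<le> b"
    using small_data_bound[OF assms(1) free assms(2,4,5,6)] by blast
  obtain B where B: "B \<ge> 0" "\<And>x. \<bar>dderiv 1 V0 x\<bar> \<le> B" "\<And>x y. \<bar>dderiv 1 V0 x - dderiv 1 V0 y\<bar> \<le> B * \<bar>x - y\<bar>"
    using smooth_compactly_supported_bounds[OF smooth_dderiv[OF assms(2)] compactly_supported_dderiv[OF assms(3)], of 1] by auto
  obtain B' where B': "B' \<ge> 0" "\<And>x. \<bar>V1 x\<bar> \<le> B'" "\<And>x y. \<bar>V1 x - V1 y\<bar> \<le> B' * \<bar>x - y\<bar>"
    using smooth_compactly_supported_bounds[OF assms(4,5)] by blast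
  have "dynamics mb a b (B + B') V"
  proof
    show "smooth V" by (rule free_smooth[OF free])
    fix x :: "real \<times> real" and t y y' :: real
    show "\<bar>d0 V x\<bar> \<le> B + B'"
      unfolding free_d0[OF free] using B(2)[of "fst x + snd x"] B(2)[of "snd x - fst x"] B'(2)[of "fst x + snd x"] B'(2)[of "snd x - fst x"]
      by argo
    show "\<bar>d1 V x\<bar> \<le> B + B'"
      unfolding free_d1[OF free] using B(2)[of "fst x + snd x"] B(2)[of "snd x - fst x"] B'(2)[of "fst x + snd x"] B'(2)[of "snd x - fst x"]
      by argo
    have average: "\<bar>(r + s - u + v) / 2 - (r' + s' - u' + v') / 2\<bar> \<le> D + D'"
      if "\<bar>r - r'\<bar> \<le> D'" "\<bar>s - s'\<bar> \<le> D" "\<bar>u - u'\<bar> \<le> D'" "\<bar>v - v'\<bar> \<le> D" for r s u v r' s' u' v' D D' :: real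
      using that by argo
    have "\<bar>V1 (t + y) - V1 (t + y')\<bar> \<le> B' * \<bar>y - y'\<bar>" "\<bar>dderiv 1 V0 (t + y) - dderiv 1 V0 (t + y')\<bar> \<le> B * \<bar>y - y'\<bar>"
      "\<bar>V1 (y - t) - V1 (y' - t)\<bar> \<le> B' * \<bar>y - y'\<bar>" "\<bar>dderiv 1 V0 (y - t) - dderiv 1 V0 (y' - t)\<bar> \<le> B * \<bar>y - y'\<bar>"
      using B(3)[of "t + y" "t + y'"] B(3)[of "y - t" "y' - t"] B'(3)[of "t + y" "t + y'"] B'(3)[of "y - t" "y' - t"] by simp_all
    then show "\<bar>d1 V (t, y) - d1 V (t, y')\<bar> \<le> (B + B') * \<bar>y - y'\<bar>"
      unfolding free_d1[OF free] distrib_right fst_conv snd_conv by (rule average)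
  qed (use assms(1) b in auto)
  then show ?thesis by blast
qed

theorem theorem3p1:
  fixes mb a :: real and V0 V1 :: "real \<Rightarrow> real" and V :: "real \<times> real \<Rightarrow> real"
  assumes "mb > 0" and "a \<noteq> 0"
    and "smooth V0" and "compactly_supported V0"
    and "smooth V1" and "compactly_supported V1"
    and "esssup lborel (\<lambda>y. ereal \<bar>V0 y\<bar>) + ereal (1 / 2 * (LINT y|lborel. \<bar>V1 y\<bar>))
           < ereal (mb / \<bar>a\<bar>)"
    and "free_wave V0 V1 V"
  shows "\<exists>U z p. joint_solution mb a V0 V1 V U z p \<and>
           (\<forall>U' z' p'. joint_solution mb a V0 V1 V U' z' p' \<longrightarrow>
              (\<forall>x \<in> {0..} \<times> UNIV. U' x = U x) \<and> (\<forall>t\<ge>0. z' t = z t \<and> p' t = p t))"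
proof -
  obtain b C where "dynamics mb a b C V"
    using small_data_dynamics[OF assms(2-8)] by blast
  then interpret dynamics mb a b C V .
  obtain z p i where traj: "trajectory mb a b C V z p i (\<lambda>s. mass s (z s) (i s))"
    using trajectory_exists by blast
  show ?thesis
  proof (intro exI conjI allI impI)
    show "joint_solution mb a V0 V1 V (full_field a V z) z p"
      by (rule trajectory.joint_solution_trajectory[OF traj assms(8,3,5)])
    fix U' z' p' assume joint: "joint_solution mb a V0 V1 V U' z' p'"
    obtain i' where traj': "trajectory mb a b C V z' p' i' (\<lambda>s. mass s (z' s) (i' s))"
      using joint_solution_imp_trajectory(1)[OF assms(8,3,5) joint] by blast
    show zp: "z' t = z t" "p' t = p t" if "t \<ge> 0" for t
      using trajectory_unique[OF traj' traj that] by auto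
    \<comment> \<open>Each field is the explicit field of its own world-line, so agreement of the
      world-lines for \<open>t \<ge> 0\<close> settles that of the fields.\<close>
    have "full_field a V z' = full_field a V z"
      by (rule full_field_cong) (rule zp)
    then show "\<forall>x\<in>{0..} \<times> UNIV. U' x = full_field a V z x"
      using joint_solution_imp_trajectory(2)[OF assms(8,3,5) joint] by auto
  qed
qed

end
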